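(* Let $\gamma\in(0,2)$, and consider the general SQG equation on $\mathbb{T}^2$ $$\begin{cases}\partial_t\theta+\mathbf{u}\cdot\nabla\theta+\Lambda^\gamma\theta=f,\\ \mathbf{u}=\mathcal{R}^\perp\theta=\nabla^\perp\Lambda^{-1}\theta,\\ \theta(0)=\theta_0,\quad \int_{\mathbb{T}^2}\theta_0(x)\,dx=0.\end{cases}$$ Let $\alpha\in(0,1)$ and assume that, for some $$\beta\in(\max\{1-\gamma,0\},1),$$ we have the a priori control $$[\theta(t)]_{C^\beta}\le K_\beta\quad\text{for all }t\ge0.$$ Then the differential inequality $$\frac{d}{dt}\|\theta\|_{H^\alpha}^2+\frac14\|\theta\|_{H^{\alpha+\gamma/2}}^2\le c\,K_\beta^{\frac{4\gamma}{\gamma+\beta-1}}+c\,\|f\|_{H^\alpha}^2$$ holds true for every $t\ge0$ with a constant $c>0$.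
   Context: All functions on $\mathbb{T}^2=(-\pi,\pi)^2$ are $2\pi$-periodic in both variables (identified with their periodic extensions to $\mathbb{R}^2$) and have zero mean; $\theta=\theta(x,t)$ is the unknown, $\theta_0$ is the initial condition and $f$ is a time-independent, mean-free force. For $\sigma\in\mathbb{R}$, $\|\phi\|_{H^\sigma}^2=\sum_{k\in\mathbb{Z}^2\setminus\{0\}}|k|^{2\sigma}|\widehat\phi_k|^2$, where $\widehat\phi_k=(2\pi)^{-2}\int_{\mathbb{T}^2}\phi(x)e^{-ik\cdot x}\,dx$. $\Lambda^\sigma=(-\Delta)^{\sigma/2}$ is the Fourier multiplier with symbol $|k|^\sigma$, $\Lambda=\Lambda^1$, $\nabla^\perp=(-\partial_{x_2},\partial_{x_1})$, and $\mathcal{R}^\perp=(-\mathcal{R}_2,\mathcal{R}_1)$ with $\mathcal{R}_j=\partial_{x_j}\Lambda^{-1}$ the $j$-th Riesz transform. The Hölder seminorm is $[\theta]_{C^\beta}=\sup_{x\ne y\in\mathbb{T}^2}\frac{|\theta(x)-\theta(y)|}{|x-y|^\beta}$. *)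

theory Defs
  imports "HOL-Analysis.Analysis"
begin

text \<open>
  Functions on the two-dimensional torus are represented by their \<open>2\<pi>\<close>-periodic extensions to the
  plane; integrals are taken over the fundamental cell \<open>(-\<pi>, \<pi>)\<^sup>2\<close>.
\<close>

definition torus :: "(real^2) set" where
  "torus = box (\<chi> i. - pi) (\<chi> i. pi)"

definition periodic :: "(real^2 \<Rightarrow> real) \<Rightarrow> bool" where
  "periodic \<phi> \<longleftrightarrow> (\<forall>x i. \<phi> (x + axis i (2 * pi)) = \<phi> x)"

definition torus_L2 :: "(real^2 \<Rightarrow> real) set" where
  "torus_L2 = {\<phi>. periodic \<phi> \<and> \<phi> \<in> borel_measurable borel \<and>
                  set_integrable lborel torus (\<lambda>x. (\<phi> x)\<^sup>2)}"

definition wavevec :: "int^2 \<Rightarrow> real^2" where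
  "wavevec k = (\<chi> i. real_of_int (k $ i))"

definition fourier_coeff :: "(real^2 \<Rightarrow> real) \<Rightarrow> int^2 \<Rightarrow> complex" where
  "fourier_coeff \<phi> k =
     (LINT x:torus|lborel. complex_of_real (\<phi> x) * exp (- (\<i> * complex_of_real (wavevec k \<bullet> x))))
       / complex_of_real ((2 * pi)\<^sup>2)"

definition Hnorm_sq :: "real \<Rightarrow> (real^2 \<Rightarrow> real) \<Rightarrow> real" where
  "Hnorm_sq \<sigma> \<phi> =
     (\<Sum>\<^sub>\<infinity>k\<in>UNIV - {0}. norm (wavevec k) powr (2 * \<sigma>) * (cmod (fourier_coeff \<phi> k))\<^sup>2)"

text \<open>
  The mean-free space \<open>H\<^sup>\<sigma>\<close>. It is used for \<open>\<sigma> \<ge> 0\<close> only, where all elements are square integrable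
  functions. The summability condition makes \<open>Hnorm_sq \<sigma>\<close> a genuine sum on this space.
\<close>

definition sobolev :: "real \<Rightarrow> (real^2 \<Rightarrow> real) set" where
  "sobolev \<sigma> = {\<phi> \<in> torus_L2. (LINT x:torus|lborel. \<phi> x) = 0 \<and>
     (\<lambda>k. norm (wavevec k) powr (2 * \<sigma>) * (cmod (fourier_coeff \<phi> k))\<^sup>2) summable_on (UNIV - {0})}"

text \<open>
  The supremum runs over the plane; for periodic functions this is the supremum over pairs of
  distinct points of the torus with the torus distance.
\<close>

definition holder_seminorm :: "real \<Rightarrow> (real^2 \<Rightarrow> real) \<Rightarrow> ereal" where
  "holder_seminorm \<beta> \<phi> =
     (SUP (x, y) \<in> {(x, y). x \<noteq> y}. ereal (\<bar>\<phi> x - \<phi> y\<bar> / norm (x - y) powr \<beta>))"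

text \<open>
  \<open>multiplier_image m \<phi> \<psi>\<close>: the square integrable function \<open>\<psi>\<close>, unique up to null sets, is the image
  of \<open>\<phi>\<close> under the Fourier multiplier with symbol \<open>m\<close>. The symbols below vanish at \<open>k = 0\<close>
  (\<open>0 powr \<sigma> = 0\<close> and \<open>z / 0 = 0\<close>), as is appropriate for mean-free functions.
\<close>

definition multiplier_image ::
    "(int^2 \<Rightarrow> complex) \<Rightarrow> (real^2 \<Rightarrow> real) \<Rightarrow> (real^2 \<Rightarrow> real) \<Rightarrow> bool" where
  "multiplier_image m \<phi> \<psi> \<longleftrightarrow>
     \<psi> \<in> torus_L2 \<and> (\<forall>k. fourier_coeff \<psi> k = m k * fourier_coeff \<phi> k)"

definition partial_symbol :: "2 \<Rightarrow> int^2 \<Rightarrow> complex" where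
  "partial_symbol j k = \<i> * complex_of_real (wavevec k $ j)"

definition Lambda_symbol :: "real \<Rightarrow> int^2 \<Rightarrow> complex" where
  "Lambda_symbol \<sigma> k = complex_of_real (norm (wavevec k) powr \<sigma>)"

definition riesz_symbol :: "2 \<Rightarrow> int^2 \<Rightarrow> complex" where
  "riesz_symbol j k = partial_symbol j k / Lambda_symbol 1 k"

text \<open>The derivative in time, one-sided at \<open>t = 0\<close>, as a limit of difference quotients in \<open>L\<^sup>2\<close>.\<close>

definition has_time_derivative ::
    "(real \<Rightarrow> real^2 \<Rightarrow> real) \<Rightarrow> (real^2 \<Rightarrow> real) \<Rightarrow> real \<Rightarrow> bool" where
  "has_time_derivative \<theta> \<theta>' t \<longleftrightarrow> \<theta>' \<in> torus_L2 \<and>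
     ((\<lambda>\<tau>. LINT x:torus|lborel. ((\<theta> \<tau> x - \<theta> t x) / (\<tau> - t) - \<theta>' x)\<^sup>2) \<longlongrightarrow> 0) (at t within {0..})"

text \<open>
  Strong solutions on \<open>[0, \<infinity>)\<close>, continuous in time with values in \<open>H\<^sup>s\<close> and differentiable in time
  with values in \<open>L\<^sup>2\<close>. Here \<open>D j\<close> and \<open>R j\<close> are the partial derivatives and the Riesz transforms of
  \<open>\<theta> t\<close>, so that the velocity is \<open>(- R 2, R 1)\<close>, and \<open>L\<close> is \<open>\<Lambda>\<^sup>\<gamma>\<close> applied to \<open>\<theta> t\<close>. For
  \<open>s \<ge> max 1 \<gamma>\<close> all of these exist in \<open>L\<^sup>2\<close>, hence the existential quantifier only names them.
\<close>

definition sqg_solution ::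
    "real \<Rightarrow> real \<Rightarrow> (real^2 \<Rightarrow> real) \<Rightarrow> (real^2 \<Rightarrow> real) \<Rightarrow> (real \<Rightarrow> real^2 \<Rightarrow> real) \<Rightarrow> bool" where
  "sqg_solution \<gamma> s f \<theta>\<^sub>0 \<theta> \<longleftrightarrow>
     \<theta> 0 = \<theta>\<^sub>0 \<and>
     (\<forall>t\<ge>0. \<theta> t \<in> sobolev s) \<and>
     (\<forall>t\<ge>0. ((\<lambda>\<tau>. Hnorm_sq s (\<lambda>x. \<theta> \<tau> x - \<theta> t x)) \<longlongrightarrow> 0) (at t within {0..})) \<and>
     (\<forall>t\<ge>0. \<exists>\<theta>' D R L.
        has_time_derivative \<theta> \<theta>' t \<and>
        (\<forall>j. multiplier_image (partial_symbol j) (\<theta> t) (D j)) \<and>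
        (\<forall>j. multiplier_image (riesz_symbol j) (\<theta> t) (R j)) \<and>
        multiplier_image (Lambda_symbol \<gamma>) (\<theta> t) L \<and>
        (AE x in lborel. \<theta>' x + (- R 2 x * D 1 x + R 1 x * D 2 x) + L x = f x))"

end

theory Submission
  imports Defs "HOL-Probability.Probability"
begin

text \<open>
  The derivative of \<open>Hnorm_sq \<alpha> (\<theta> t)\<close> is \<open>2 \<langle>\<theta>', \<Lambda>\<^sup>2\<^sup>\<alpha>\<theta>\<rangle>\<close>, so everything rests on the trilinear form
  \<open>T = \<langle>u \<cdot> \<nabla>\<theta>, \<Lambda>\<^sup>2\<^sup>\<alpha>\<theta>\<rangle>\<close>. Write \<open>\<Lambda>\<^sup>2\<^sup>\<alpha>\<close> as a superposition of \<open>1 - heat r\<close>. The divergence-free structure and a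
  Gaussian integration by parts in the increment \<open>h\<close> bound \<open>T\<close> by the integral of
  \<open>\<bar>\<delta>\<^sub>hu\<bar> \<bar>\<delta>\<^sub>h\<theta>\<bar>\<^sup>2 / \<bar>h\<bar> powr (3 + 2 * \<alpha>)\<close>, that is, by cubic means of increments of \<open>\<theta>\<close> and of its Riesz transforms,
  which inherit the Hoelder bound. Passing from first to second differences and using the Hoelder bound for one of the
  three factors yields \<open>\<bar>T\<bar> \<le> C K \<Sum> \<bar>k\<bar> powr (2 * \<alpha> + 1 - \<beta>) \<bar>\<theta>\<^sub>k\<bar>\<^sup>2\<close>. The exponent is below \<open>2 * \<alpha> + \<gamma>\<close>, and
  splitting at a frequency depending on \<open>K\<close> leaves a dissipative part and a multiple of
  \<open>K powr (p - 2) \<Sum> \<bar>k\<bar> powr (2 * \<alpha> * \<beta>) \<bar>\<theta>\<^sub>k\<bar>\<^sup>2 \<le> C K powr p\<close> with \<open>p = 4 * \<gamma> / (\<gamma> + \<beta> - 1)\<close>. All of this is done for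
  trigonometric polynomials, and Fejer means transfer the bound on \<open>T\<close> to the solution because they preserve the
  Hoelder bound and converge in \<open>L\<^sup>2\<close>.
\<close>

subsection \<open>Characters and the torus measure\<close>

text \<open>No singular kernel of a fractional Laplacian or of a Riesz transform on the torus is
  estimated anywhere. Averaging over a Gaussian displacement of scale \<open>r\<close> multiplies
  the character \<open>wave k\<close> by \<open>heat r k\<close>, so
  \<open>\<Lambda>\<^sup>2\<^sup>\<alpha>\<close> and the Riesz transforms become integrals over
  \<open>r\<close>, identities are checked on characters, and every singularity ends up in a scalar
  half-line integral that scaling evaluates. The passage to the limit is the second difficulty. For
  a strong solution \<open>u \<cdot> \<nabla>\<theta>\<close> is a product of two square integrable
  functions, so the coefficients of products of Fejer means converge only one by one. They
  nevertheless stay bounded in square sum, since a mean-free Hoelder velocity is bounded, and this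
  gives weak convergence against \<open>\<Lambda>\<^sup>2\<^sup>\<alpha>\<theta>\<close>. The power
  \<open>p\<close> leaves room: with the low-frequency weight \<open>2 * \<alpha> * \<beta>\<close>
  the splitting asks for \<open>2 * \<alpha> + 1 - \<beta> - 2 * \<alpha> * \<beta> \<le> (p - 3) *
  (\<gamma> + \<beta> - 1)\<close>, and the difference of the two sides is
  \<open>\<gamma> + 2 * (1 - \<alpha>) * (1 - \<beta>)\<close>, positive in the whole range of
  parameters.\<close>

definition TM :: "(real^2) measure" where
  "TM = restrict_space lborel torus"

definition wave :: "int^2 \<Rightarrow> real^2 \<Rightarrow> complex" where
  "wave k x = cis (wavevec k \<bullet> x)"

lemma wavevec_simps [simp]:
  "wavevec 0 = 0" "wavevec (j + k) = wavevec j + wavevec k" "wavevec (- k) = - wavevec k"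
  "wavevec (j - k) = wavevec j - wavevec k"
  by (auto simp: wavevec_def vec_eq_iff)

lemma wavevec_component: "wavevec k $ i = real_of_int (k $ i)"
  by (simp add: wavevec_def)

lemma wave_simps [simp]:
  "wave 0 x = 1" "wave k 0 = 1" "cmod (wave k x) = 1" "wave (- k) x = cnj (wave k x)"
  by (auto simp: wave_def cis_cnj)

lemma wave_add: "wave (j + k) x = wave j x * wave k x"
  by (simp add: wave_def inner_add_left cis_mult)

lemma wave_diff: "wave (j - k) x = wave j x * cnj (wave k x)"
  using wave_add[of j "-k" x] by simp

lemma wave_plus: "wave k (x + y) = wave k x * wave k y"
  by (simp add: wave_def inner_add_right cis_mult)

lemma wave_minus: "wave k (- x) = cnj (wave k x)"
  by (simp add: wave_def cis_cnj)

lemma wave_periodic: "wave k (x + axis i (2 * pi)) = wave k x"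
proof -
  have "wave k (axis i (2 * pi)) = 1"
    using cis_multiple_2pi[of "of_int (k $ i)"]
    by (simp add: wave_def inner_axis wavevec_component algebra_simps)
  then show ?thesis by (simp add: wave_plus)
qed

lemma continuous_wave [continuous_intros]: "continuous_on S (wave k)"
  unfolding wave_def by (intro continuous_intros)

lemma measurable_wave [measurable]: "wave k \<in> borel_measurable borel"
  by (intro borel_measurable_continuous_onI continuous_wave)

text \<open>Supplies the translation that makes characters orthogonal without any explicit
  integration.\<close>

lemma wave_neq_one: assumes "k \<noteq> 0" shows "\<exists>h. wave k h \<noteq> 1"
proof -
  obtain i where i: "k $ i \<noteq> 0" using assms by (auto simp: vec_eq_iff)
  have "wave k (axis i (pi / k $ i)) = -1"
    using i by (simp add: wave_def inner_axis wavevec_component)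
  then show ?thesis by (intro exI[of _ "axis i (pi / k $ i)"]) simp
qed

text \<open>The spectral gap of the lattice. It makes the weights
  \<open>norm (wavevec k) powr \<sigma>\<close> increasing in \<sigma>, so that the dissipation
  dominates lower norms.\<close>

lemma one_le_norm_wavevec: assumes "k \<noteq> 0" shows "1 \<le> norm (wavevec k)"
proof -
  obtain i where i: "k $ i \<noteq> 0" using assms by (auto simp: vec_eq_iff)
  have "1 \<le> \<bar>wavevec k $ i\<bar>" using i by (simp add: wavevec_component)
  also have "\<dots> \<le> norm (wavevec k)" by (rule component_le_norm_cart)
  finally show ?thesis .
qed

lemma wavevec_eq_0 [simp]: "wavevec k = 0 \<longleftrightarrow> k = 0"
  using one_le_norm_wavevec[of k] by (metis norm_zero not_one_le_zero wavevec_simps(1))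

lemma torus_measurable [measurable, simp]: "torus \<in> sets borel"
  by (simp add: torus_def)

lemma mem_torus: "x \<in> torus \<longleftrightarrow> (\<forall>i. - pi < x $ i \<and> x $ i < pi)"
  by (simp add: torus_def mem_box_cart)

lemma sets_TM [measurable_cong, simp]: "sets TM = sets (restrict_space borel torus)"
  by (simp add: TM_def sets_restrict_space)

lemma space_TM [simp]: "space TM = torus"
  by (simp add: TM_def space_restrict_space)

lemma measurable_TM: "f \<in> borel_measurable borel \<Longrightarrow> f \<in> borel_measurable TM"
  unfolding TM_def by (intro measurable_restrict_space1) auto

lemma emeasure_TM: "emeasure TM torus = ennreal ((2 * pi)\<^sup>2)"
proof -
  have "emeasure TM torus = emeasure lborel torus"
    by (simp add: TM_def emeasure_restrict_space)
  also have "\<dots> = ennreal (\<Prod>b\<in>Basis. ((\<chi> i. pi) - (\<chi> i. - pi)) \<bullet> (b :: real^2))"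
    unfolding torus_def
    by (rule emeasure_lborel_box) (auto simp: Basis_vec_def inner_axis)
  also have "(\<Prod>b\<in>Basis. ((\<chi> i. pi) - (\<chi> i. - pi)) \<bullet> (b :: real^2)) = (\<Prod>b\<in>(Basis::(real^2) set). 2 * pi)"
    by (intro prod.cong) (auto simp: Basis_vec_def inner_axis)
  finally show ?thesis by simp
qed

lemma measure_TM: "measure TM torus = (2 * pi)\<^sup>2"
  by (simp add: measure_def emeasure_TM)

interpretation TM: finite_measure TM
  by standard (simp add: emeasure_TM)

lemma set_integrable_torus: "set_integrable lborel torus f \<longleftrightarrow> integrable TM f"
  for f :: "real^2 \<Rightarrow> 'a::{banach, second_countable_topology}"
  unfolding TM_def set_integrable_def by (subst integrable_restrict_space) auto

lemma set_integral_torus: "(LINT x:torus|lborel. f x) = (LINT x|TM. f x)"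
  for f :: "real^2 \<Rightarrow> 'a::{banach, second_countable_topology}"
  unfolding TM_def set_lebesgue_integral_def by (subst integral_restrict_space) auto

lemma AE_TM: "(AE x in lborel. P x) \<Longrightarrow> (AE x in TM. P x)"
  unfolding TM_def by (subst AE_restrict_space_iff) auto

lemma fourier_coeff_TM:
  "fourier_coeff \<phi> k = (LINT x|TM. complex_of_real (\<phi> x) * cnj (wave k x)) / complex_of_real ((2 * pi)\<^sup>2)"
  unfolding fourier_coeff_def set_integral_torus
  by (simp add: wave_def cis_cnj) (simp add: cis_conv_exp)

section \<open>Translation invariance of integrals of periodic functions\<close>

definition half_open_torus :: "(real^2) set" where
  "half_open_torus = {x. \<forall>i. - pi \<le> x $ i \<and> x $ i < pi}"

lemma half_open_torus_measurable [measurable, simp]: "half_open_torus \<in> sets borel"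
  unfolding half_open_torus_def by measurable

text \<open>Half-open cells tile the plane without gap or overlap, which the cutting argument below
  relies on. The open cell of the definitions differs only by part of the boundary of a box.\<close>

lemma AE_half_open_torus:
  "AE x in lborel. indicator half_open_torus x = (indicator torus x :: real)"
proof -
  have "cbox (\<chi> i. - pi) (\<chi> i. pi) - box (\<chi> i. - pi) (\<chi> i. pi) \<in> null_sets (lborel :: (real^2) measure)"
    using negligible_frontier_interval[of "(\<chi> i. - pi) :: real^2" "\<chi> i. pi"]
    unfolding negligible_iff_null_sets by (subst (asm) null_sets_completion_iff) auto
  moreover have "half_open_torus \<subseteq> cbox (\<chi> i. - pi) (\<chi> i. pi)"
    by (auto simp: half_open_torus_def mem_box_cart less_imp_le)
  moreover have "torus \<subseteq> half_open_torus"
    by (auto simp: half_open_torus_def mem_torus less_imp_le)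
  ultimately show ?thesis
    by (intro AE_I'[where N="cbox (\<chi> i. - pi) (\<chi> i. pi) - box (\<chi> i. - pi) (\<chi> i. pi)"])
       (auto simp: indicator_def torus_def subset_iff split: if_splits)
qed

lemma has_bochner_integral_half_open_torus:
  fixes g :: "real^2 \<Rightarrow> 'a::{banach, second_countable_topology}"
  assumes g: "g \<in> borel_measurable borel"
  shows "has_bochner_integral TM g I \<longleftrightarrow>
    has_bochner_integral lborel (\<lambda>x. indicator half_open_torus x *\<^sub>R g x) I"
proof -
  have "has_bochner_integral TM g I \<longleftrightarrow> has_bochner_integral lborel (\<lambda>x. indicator torus x *\<^sub>R g x) I"
    unfolding TM_def has_bochner_integral_iff
    by (subst integrable_restrict_space, simp, subst integral_restrict_space) auto
  also have "\<dots> \<longleftrightarrow> has_bochner_integral lborel (\<lambda>x. indicator half_open_torus x *\<^sub>R g x) I"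
    by (rule has_bochner_integral_cong_AE) (use g AE_half_open_torus in auto)
  finally show ?thesis .
qed

lemma has_bochner_integral_translate:
  fixes f :: "real^2 \<Rightarrow> 'a::{banach, second_countable_topology}"
  assumes "has_bochner_integral lborel f I"
  shows "has_bochner_integral lborel (\<lambda>x. f (x + c)) I"
proof -
  have "has_bochner_integral (distr lborel borel ((+) c)) f I"
    using assms by (simp add: lborel_distr_plus)
  then have "has_bochner_integral lborel (\<lambda>x. f (c + x)) I"
    using assms
    by (auto simp: has_bochner_integral_iff integrable_distr_eq integral_distr)
  then show ?thesis by (simp add: add.commute)
qed

lemma periodic_int_shift:
  assumes per: "\<And>x i. g (x + axis i (2 * pi)) = g (x :: real^2)"
  shows "g (x + axis i (2 * pi * of_int m)) = g x"
proof -
  have nat: "g (x + axis i (2 * pi * real n)) = g x" for n x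
  proof (induction n)
    case 0 then show ?case by (simp add: axis_def flip: zero_vec_def)
  next
    case (Suc n)
    have "x + axis i (2 * pi * real (Suc n)) = (x + axis i (2 * pi * real n)) + axis i (2 * pi)"
      by (simp add: vec_eq_iff axis_def algebra_simps)
    then show ?case using per Suc.IH by metis
  qed
  show ?thesis
  proof (cases "m \<ge> 0")
    case True then show ?thesis using nat[of x "nat m"] by simp
  next
    case False
    have "g (x + axis i (2 * pi * of_int m)) = g (x + axis i (2 * pi * of_int m) + axis i (2 * pi * real (nat (- m))))"
      by (rule nat[symmetric])
    also have "x + axis i (2 * pi * of_int m) + axis i (2 * pi * real (nat (- m))) = x"
      using False by (simp add: vec_eq_iff axis_def)
    finally show ?thesis .
  qed
qed

text \<open>Modulo the period the shift is some \<open>t\<close> in \<open>[0, 2 * pi)\<close>. Cut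
  the cell at \<open>x $ i = - pi + t\<close>: the upper piece, moved back by \<open>t\<close>, and
  the lower piece, moved forward by \<open>2 * pi - t\<close>, fill the cell again.\<close>

lemma periodic_integral_axis_shift:
  fixes g :: "real^2 \<Rightarrow> 'a::{banach, second_countable_topology}"
  assumes per: "\<And>x i. g (x + axis i (2 * pi)) = g x"
    and I: "has_bochner_integral lborel (\<lambda>x. indicator half_open_torus x *\<^sub>R g x) I"
  shows "has_bochner_integral lborel (\<lambda>x. indicator half_open_torus x *\<^sub>R g (x + axis i s)) I"
proof -
  define m where "m = \<lfloor>s / (2 * pi)\<rfloor>"
  define t where "t = s - 2 * pi * of_int m"
  have "of_int m \<le> s / (2 * pi)" "s / (2 * pi) < of_int m + 1"
    unfolding m_def by linarith+
  then have t: "0 \<le> t" "t < 2 * pi"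
    by (auto simp: t_def field_simps)
  have gt: "g (x + axis i s) = g (x + axis i t)" for x
  proof -
    have "x + axis i s = (x + axis i t) + axis i (2 * pi * of_int m)"
      by (simp add: vec_eq_iff axis_def t_def)
    then show ?thesis using periodic_int_shift[of g, OF per] by metis
  qed
  have gt': "g (x + axis i (t - 2 * pi)) = g (x + axis i t)" for x
  proof -
    have "x + axis i t = (x + axis i (t - 2 * pi)) + axis i (2 * pi)"
      by (simp add: vec_eq_iff axis_def)
    then show ?thesis using per by metis
  qed
  define F where "F = (\<lambda>x. indicator half_open_torus x *\<^sub>R g x)"
  define F1 where "F1 = (\<lambda>x. indicator {x. - pi + t \<le> x $ i} x *\<^sub>R F x)"
  define F2 where "F2 = (\<lambda>x. indicator {x. x $ i < - pi + t} x *\<^sub>R F x)"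
  have F: "integrable lborel F" "integral\<^sup>L lborel F = I"
    using I by (auto simp: F_def has_bochner_integral_iff)
  have F1: "integrable lborel F1" unfolding F1_def
    by (rule integrable_mult_indicator) (use F in auto)
  have F2: "integrable lborel F2" unfolding F2_def
    by (rule integrable_mult_indicator) (use F in auto)
  have F12: "F = (\<lambda>x. F1 x + F2 x)"
  proof
    fix x show "F x = F1 x + F2 x"
      unfolding F1_def F2_def by (cases "x $ i < - pi + t") simp_all
  qed
  have sum: "integral\<^sup>L lborel F1 + integral\<^sup>L lborel F2 = I"
    using F(2) Bochner_Integration.integral_add[OF F1 F2] unfolding F12 by simp
  have "has_bochner_integral lborel (\<lambda>x. F1 (x + axis i t) + F2 (x + axis i (t - 2 * pi)))
          (integral\<^sup>L lborel F1 + integral\<^sup>L lborel F2)"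
    by (intro has_bochner_integral_add has_bochner_integral_translate)
       (auto simp: has_bochner_integral_iff F1 F2)
  also have "(\<lambda>x. F1 (x + axis i t) + F2 (x + axis i (t - 2 * pi))) =
             (\<lambda>x. indicator half_open_torus x *\<^sub>R g (x + axis i s))"
  proof
    fix x :: "real^2"
    have split: "(\<forall>j. Q j) \<longleftrightarrow> (\<forall>j. j \<noteq> i \<longrightarrow> Q j) \<and> Q i" for Q by metis
    have mem: "x + axis i c \<in> half_open_torus \<longleftrightarrow>
        (\<forall>j. j \<noteq> i \<longrightarrow> - pi \<le> x $ j \<and> x $ j < pi) \<and> - pi \<le> x $ i + c \<and> x $ i + c < pi" for c
      unfolding half_open_torus_def mem_Collect_eq
      by (subst split) (simp add: axis_def)
    have mem0: "x \<in> half_open_torus \<longleftrightarrow>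
        (\<forall>j. j \<noteq> i \<longrightarrow> - pi \<le> x $ j \<and> x $ j < pi) \<and> - pi \<le> x $ i \<and> x $ i < pi"
      unfolding half_open_torus_def mem_Collect_eq by (subst split) simp
    have comp: "(x + axis i c) $ i = x $ i + c" for c by (simp add: axis_def)
    have H1: "x + axis i t \<in> half_open_torus \<and> - pi + t \<le> (x + axis i t) $ i \<longleftrightarrow>
       x \<in> half_open_torus \<and> x $ i + t < pi"
      unfolding mem mem0 comp by (insert t, intro iffI conjI; elim conjE; (assumption | linarith))
    have H2: "x + axis i (t - 2 * pi) \<in> half_open_torus \<and> (x + axis i (t - 2 * pi)) $ i < - pi + t \<longleftrightarrow>
       x \<in> half_open_torus \<and> \<not> x $ i + t < pi"
      unfolding mem mem0 comp by (insert t, intro iffI conjI; elim conjE; (assumption | linarith))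
    have "F1 (x + axis i t) = (if x \<in> half_open_torus \<and> x $ i + t < pi then g (x + axis i t) else 0)"
      unfolding H1[symmetric] by (auto simp: F1_def F_def indicator_def)
    moreover have "F2 (x + axis i (t - 2 * pi)) =
        (if x \<in> half_open_torus \<and> \<not> x $ i + t < pi then g (x + axis i t) else 0)"
      unfolding H2[symmetric] by (auto simp: F2_def F_def indicator_def gt')
    ultimately show "F1 (x + axis i t) + F2 (x + axis i (t - 2 * pi)) =
         indicator half_open_torus x *\<^sub>R g (x + axis i s)"
      by (auto simp: gt indicator_def)
  qed
  finally show ?thesis unfolding sum .
qed

lemma periodic_integral_translate:
  fixes g :: "real^2 \<Rightarrow> 'a::{banach, second_countable_topology}"
  assumes per: "\<And>x i. g (x + axis i (2 * pi)) = g x"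
    and meas: "g \<in> borel_measurable borel" and int: "integrable TM g"
  shows "integrable TM (\<lambda>x. g (x + h))" "(LINT x|TM. g (x + h)) = (LINT x|TM. g x)"
proof -
  have *: "has_bochner_integral lborel (\<lambda>x. indicator half_open_torus x *\<^sub>R g x) (LINT x|TM. g x)"
    using int by (subst has_bochner_integral_half_open_torus[symmetric, OF meas]) (rule has_bochner_integral_integrable)
  have per': "g (x + axis i (2 * pi) + axis 1 (h $ 1)) = g (x + axis 1 (h $ 1))" for x i
    using per[of "x + axis 1 (h $ 1)" i] by (simp add: algebra_simps)
  have "has_bochner_integral lborel (\<lambda>x. indicator half_open_torus x *\<^sub>R g (x + axis 2 (h $ 2) + axis 1 (h $ 1))) (LINT x|TM. g x)"
    by (rule periodic_integral_axis_shift[of "\<lambda>x. g (x + axis 1 (h $ 1))", OF per'])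
       (rule periodic_integral_axis_shift[OF per *])
  moreover have "x + axis 2 (h $ 2) + axis 1 (h $ 1) = x + h" for x :: "real^2"
    by (simp add: vec_eq_iff axis_def forall_2)
  ultimately have "has_bochner_integral lborel (\<lambda>x. indicator half_open_torus x *\<^sub>R g (x + h)) (LINT x|TM. g x)"
    by simp
  then have "has_bochner_integral TM (\<lambda>x. g (x + h)) (LINT x|TM. g x)"
    by (subst has_bochner_integral_half_open_torus) (use meas in measurable)
  then show "integrable TM (\<lambda>x. g (x + h))" "(LINT x|TM. g (x + h)) = (LINT x|TM. g x)"
    by (auto simp: has_bochner_integral_iff)
qed

lemma integrable_TM_bounded:
  fixes g :: "real^2 \<Rightarrow> 'a::{banach, second_countable_topology}"
  assumes "g \<in> borel_measurable borel" "\<And>x. x \<in> torus \<Longrightarrow> norm (g x) \<le> B"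
  shows "integrable TM g"
  by (rule TM.integrable_const_bound[of _ B]) (use assms measurable_TM in auto)

lemma integrable_wave [simp]: "integrable TM (wave k)"
  by (rule integrable_TM_bounded[of _ 1]) auto

text \<open>Translation by \<open>h\<close> multiplies the integral by \<open>wave k h\<close>, and
  for \<open>k \<noteq> 0\<close> some \<open>h\<close> makes this factor different from 1.\<close>

lemma integral_wave: "(LINT x|TM. wave k x) = (if k = 0 then complex_of_real ((2 * pi)\<^sup>2) else 0)"
proof (cases "k = 0")
  case True
  then show ?thesis by (simp add: measure_TM scaleR_conv_of_real)
next
  case False
  then obtain h where h: "wave k h \<noteq> 1" using wave_neq_one by blast
  have "(LINT x|TM. wave k x) = (LINT x|TM. wave k (x + h))"
    by (rule periodic_integral_translate(2)[symmetric]) (auto simp: wave_periodic)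
  also have "\<dots> = (LINT x|TM. wave k x) * wave k h" by (simp add: wave_plus)
  finally show ?thesis using h False by simp
qed

section \<open>Trigonometric polynomials, resonant products and square integrable functions\<close>

definition trig :: "(int^2) set \<Rightarrow> (int^2 \<Rightarrow> complex) \<Rightarrow> real^2 \<Rightarrow> complex" where
  "trig A a x = (\<Sum>k\<in>A. a k * wave k x)"

text \<open>Periodicity is left out on purpose: coefficients and norms see the cell only, and
  indicators of arbitrary Borel sets then belong to the class, as the density argument for Fejer
  means requires.\<close>

definition L2 :: "(real^2 \<Rightarrow> complex) set" where
  "L2 = {\<phi>. \<phi> \<in> borel_measurable borel \<and> integrable TM (\<lambda>x. (cmod (\<phi> x))\<^sup>2)}"

definition sqnorm :: "(real^2 \<Rightarrow> complex) \<Rightarrow> real" where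
  "sqnorm \<phi> = (LINT x|TM. (cmod (\<phi> x))\<^sup>2)"

definition fc :: "(real^2 \<Rightarrow> complex) \<Rightarrow> int^2 \<Rightarrow> complex" where
  "fc \<phi> k = (LINT x|TM. \<phi> x * cnj (wave k x)) / complex_of_real ((2 * pi)\<^sup>2)"

lemma fourier_coeff_fc: "fourier_coeff \<phi> k = fc (\<lambda>x. complex_of_real (\<phi> x)) k"
  by (simp add: fourier_coeff_TM fc_def)

lemma integrable_TM_continuous:
  fixes g :: "real^2 \<Rightarrow> 'a::{banach, second_countable_topology}"
  assumes "continuous_on UNIV g"
  shows "integrable TM g"
proof -
  have "compact (g ` cbox (\<chi> i. - pi) (\<chi> i. pi))"
    by (intro compact_continuous_image compact_cbox continuous_on_subset[OF assms]) auto
  then obtain B where B: "\<forall>y\<in>g ` cbox (\<chi> i. - pi) (\<chi> i. pi). norm y \<le> B"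
    using compact_imp_bounded bounded_iff by metis
  have "torus \<subseteq> cbox (\<chi> i. - pi) (\<chi> i. pi)"
    unfolding torus_def by (rule box_subset_cbox)
  with B show ?thesis
    by (intro integrable_TM_bounded[of _ B] borel_measurable_continuous_onI assms) blast+
qed

lemma continuous_trig [continuous_intros]: "continuous_on S (trig A a)"
  unfolding trig_def by (intro continuous_intros)

lemma continuous_trig' [continuous_intros]:
  "continuous_on S f \<Longrightarrow> continuous_on S (\<lambda>x. trig A a (f x))"
  by (rule continuous_on_compose2[OF continuous_trig[of UNIV]]) auto

lemma continuous_wave' [continuous_intros]:
  "continuous_on S f \<Longrightarrow> continuous_on S (\<lambda>x. wave k (f x))"
  by (rule continuous_on_compose2[OF continuous_wave[of UNIV]]) auto

lemma measurable_trig [measurable]: "trig A a \<in> borel_measurable borel"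
  by (intro borel_measurable_continuous_onI continuous_trig)

lemma integrable_trig [simp]: "integrable TM (trig A a)"
  by (intro integrable_TM_continuous continuous_trig)

lemma trig_L2: "trig A a \<in> L2"
  unfolding L2_def by (auto intro!: integrable_TM_continuous continuous_intros)

lemma integral_trig_mult_wave:
  assumes "finite A"
  shows "(LINT x|TM. trig A a x * wave q x) = complex_of_real ((2 * pi)\<^sup>2) * (if - q \<in> A then a (- q) else 0)"
proof -
  have "(LINT x|TM. trig A a x * wave q x) = (LINT x|TM. (\<Sum>k\<in>A. a k * wave (k + q) x))"
    by (simp add: trig_def sum_distrib_right wave_add mult.assoc)
  also have "\<dots> = (\<Sum>k\<in>A. a k * (LINT x|TM. wave (k + q) x))"
    by (subst Bochner_Integration.integral_sum) auto
  also have "\<dots> = (\<Sum>k\<in>A. if k = - q then a k * complex_of_real ((2 * pi)\<^sup>2) else 0)"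
    by (intro sum.cong) (auto simp: integral_wave add_eq_0_iff2)
  also have "\<dots> = complex_of_real ((2 * pi)\<^sup>2) * (if - q \<in> A then a (- q) else 0)"
    using assms by (simp add: sum.delta)
  finally show ?thesis .
qed

lemma fc_trig: "finite A \<Longrightarrow> fc (trig A a) k = (if k \<in> A then a k else 0)"
  using integral_trig_mult_wave[of A a "- k"] by (simp add: fc_def)

lemma trig_mult:
  "trig A a x * trig A b x = (\<Sum>j\<in>A. \<Sum>k\<in>A. a j * b k * wave (j + k) x)"
  by (simp add: trig_def sum_product wave_add mult_ac)

text \<open>Orthogonality of characters keeps only the resonant triples; this is how cubic integrals
  turn into the sums over triads below.\<close>

lemma integral_trig_mult3:
  assumes A: "finite A"
  shows "(LINT x|TM. trig A a x * (trig A b x * trig A c x)) = complex_of_real ((2 * pi)\<^sup>2) *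
    (\<Sum>j\<in>A. \<Sum>k\<in>A. \<Sum>l\<in>A. if j + k + l = 0 then a j * b k * c l else 0)"
proof -
  have *: "trig A a x * (trig A b x * trig A c x) =
     (\<Sum>j\<in>A. \<Sum>k\<in>A. \<Sum>l\<in>A. a j * b k * c l * wave (j + k + l) x)" for x
  proof -
    have "trig A a x * (trig A b x * trig A c x) =
      (\<Sum>j\<in>A. \<Sum>k\<in>A. a j * wave j x * (b k * wave k x * trig A c x))"
      unfolding trig_def[of A a] trig_def[of A b]
      by (simp only: sum_distrib_right sum_distrib_left) (rule sum.swap)
    also have "\<dots> = (\<Sum>j\<in>A. \<Sum>k\<in>A. \<Sum>l\<in>A. a j * b k * c l * wave (j + k + l) x)"
      by (intro sum.cong) (auto simp: trig_def sum_distrib_left wave_add mult_ac)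
    finally show ?thesis .
  qed
  have "(LINT x|TM. trig A a x * (trig A b x * trig A c x)) =
     (\<Sum>j\<in>A. \<Sum>k\<in>A. \<Sum>l\<in>A. a j * b k * c l * (LINT x|TM. wave (j + k + l) x))"
    unfolding * by (simp add: Bochner_Integration.integral_sum)
  also have "\<dots> = (\<Sum>j\<in>A. \<Sum>k\<in>A. \<Sum>l\<in>A. complex_of_real ((2 * pi)\<^sup>2) *
      (if j + k + l = 0 then a j * b k * c l else 0))"
    by (intro sum.cong) (auto simp: integral_wave)
  finally show ?thesis by (simp add: sum_distrib_left)
qed

lemma trig_parseval:
  assumes A: "finite A"
  shows "sqnorm (trig A a) = (2 * pi)\<^sup>2 * (\<Sum>k\<in>A. (cmod (a k))\<^sup>2)"
proof -
  have "complex_of_real (sqnorm (trig A a)) = (LINT x|TM. complex_of_real ((cmod (trig A a x))\<^sup>2))"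
    by (simp only: sqnorm_def integral_complex_of_real)
  also have "\<dots> = (LINT x|TM. (\<Sum>k\<in>A. cnj (a k) * (trig A a x * wave (- k) x)))"
    by (intro Bochner_Integration.integral_cong refl, subst complex_norm_square)
       (simp add: trig_def sum_distrib_left mult_ac)
  also have "\<dots> = (\<Sum>k\<in>A. cnj (a k) * (LINT x|TM. trig A a x * wave (- k) x))"
    by (subst Bochner_Integration.integral_sum)
       (auto intro!: integrable_TM_continuous continuous_intros)
  also have "\<dots> = (\<Sum>k\<in>A. complex_of_real ((2 * pi)\<^sup>2) * complex_of_real ((cmod (a k))\<^sup>2))"
    by (intro sum.cong refl, subst integral_trig_mult_wave[OF A], simp only: complex_norm_square) simp
  also have "\<dots> = complex_of_real ((2 * pi)\<^sup>2 * (\<Sum>k\<in>A. (cmod (a k))\<^sup>2))"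
    by (simp add: sum_distrib_left)
  finally show ?thesis by (simp only: of_real_eq_iff)
qed

subsection \<open>Square integrable functions\<close>

lemma L2_D:
  assumes "\<phi> \<in> L2"
  shows "\<phi> \<in> borel_measurable borel" "\<phi> \<in> borel_measurable TM" "integrable TM (\<lambda>x. (cmod (\<phi> x))\<^sup>2)"
  using assms measurable_TM by (auto simp: L2_def)

lemma cmod_mult_le: "cmod (a * b) \<le> ((cmod a)\<^sup>2 + (cmod b)\<^sup>2) / 2"
  using sum_squares_bound[of "cmod a" "cmod b"] by (simp add: norm_mult)

lemma L2_mult_integrable:
  assumes "\<phi> \<in> L2" "\<psi> \<in> L2"
  shows "integrable TM (\<lambda>x. \<phi> x * \<psi> x)"
proof (rule Bochner_Integration.integrable_bound)
  show "integrable TM (\<lambda>x. ((cmod (\<phi> x))\<^sup>2 + (cmod (\<psi> x))\<^sup>2) / 2)"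
    using assms[THEN L2_D(3)] by auto
  show "(\<lambda>x. \<phi> x * \<psi> x) \<in> borel_measurable TM"
    using assms[THEN L2_D(2)] by auto
qed (use cmod_mult_le in \<open>auto intro!: always_eventually order_trans[OF _ abs_ge_self]\<close>)

lemma L2_const [simp]: "(\<lambda>x. c) \<in> L2"
  by (auto simp: L2_def)

lemma borel_measurable_cnj [measurable (raw)]:
  "f \<in> borel_measurable M \<Longrightarrow> (\<lambda>x. cnj (f x)) \<in> borel_measurable M"
  by (rule borel_measurable_continuous_on[of cnj]) (auto intro: continuous_intros)

lemma L2_cnj: "\<phi> \<in> L2 \<Longrightarrow> (\<lambda>x. cnj (\<phi> x)) \<in> L2"
  unfolding L2_def by (auto intro: borel_measurable_cnj)

lemma L2_integrable: "\<phi> \<in> L2 \<Longrightarrow> integrable TM \<phi>"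
  using L2_mult_integrable[of \<phi> "\<lambda>_. 1"] by simp

lemma L2_bounded:
  assumes "\<phi> \<in> borel_measurable borel" "\<And>x. cmod (\<phi> x) \<le> B"
  shows "\<phi> \<in> L2"
proof -
  have "integrable TM (\<lambda>x. (cmod (\<phi> x))\<^sup>2)"
    using assms by (intro integrable_TM_bounded[of _ "B\<^sup>2"]) (auto intro!: power_mono)
  then show ?thesis using assms by (simp add: L2_def)
qed

lemma wave_L2: "wave k \<in> L2"
  by (rule L2_bounded[of _ 1]) auto

lemma L2_cmult:
  assumes "\<phi> \<in> L2"
  shows "(\<lambda>x. c * \<phi> x) \<in> L2"
  using L2_D[OF assms] by (auto simp: L2_def norm_mult power_mult_distrib)

lemma L2_add:
  assumes "\<phi> \<in> L2" "\<psi> \<in> L2"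
  shows "(\<lambda>x. \<phi> x + \<psi> x) \<in> L2"
proof -
  have "integrable TM (\<lambda>x. (cmod (\<phi> x + \<psi> x))\<^sup>2)"
  proof (rule Bochner_Integration.integrable_bound)
    show "integrable TM (\<lambda>x. 2 * (cmod (\<phi> x))\<^sup>2 + 2 * (cmod (\<psi> x))\<^sup>2)"
      using assms[THEN L2_D(3)] by auto
    show "(\<lambda>x. (cmod (\<phi> x + \<psi> x))\<^sup>2) \<in> borel_measurable TM"
      using assms[THEN L2_D(2)] by auto
    have "(cmod (a + b))\<^sup>2 \<le> 2 * (cmod a)\<^sup>2 + 2 * (cmod b)\<^sup>2" for a b
    proof -
      have "(cmod (a + b))\<^sup>2 \<le> (cmod a + cmod b)\<^sup>2" by (intro power_mono norm_triangle_ineq) auto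
      also have "\<dots> \<le> 2 * (cmod a)\<^sup>2 + 2 * (cmod b)\<^sup>2"
        using sum_squares_bound[of "cmod a" "cmod b"] by (simp add: power2_sum)
      finally show ?thesis .
    qed
    then show "AE x in TM. norm ((cmod (\<phi> x + \<psi> x))\<^sup>2) \<le> norm (2 * (cmod (\<phi> x))\<^sup>2 + 2 * (cmod (\<psi> x))\<^sup>2)"
      by auto
  qed
  then show ?thesis using assms[THEN L2_D(1)] by (simp add: L2_def borel_measurable_add)
qed

lemma L2_diff: "\<phi> \<in> L2 \<Longrightarrow> \<psi> \<in> L2 \<Longrightarrow> (\<lambda>x. \<phi> x - \<psi> x) \<in> L2"
  using L2_add[of \<phi> "\<lambda>x. (-1) * \<psi> x"] L2_cmult[of \<psi> "-1"] by simp

lemma sqnorm_nonneg: "0 \<le> sqnorm \<phi>"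
  by (auto simp: sqnorm_def intro!: integral_nonneg)

lemma sqnorm_cmult: "sqnorm (\<lambda>x. c * \<phi> x) = (cmod c)\<^sup>2 * sqnorm \<phi>"
  by (simp add: sqnorm_def norm_mult power_mult_distrib)

lemma sqnorm_mono:
  assumes "\<phi> \<in> L2" "\<psi> \<in> L2" "\<And>x. x \<in> torus \<Longrightarrow> cmod (\<phi> x) \<le> cmod (\<psi> x)"
  shows "sqnorm \<phi> \<le> sqnorm \<psi>"
  unfolding sqnorm_def using assms by (intro integral_mono L2_D(3)) auto

lemma sqnorm_add3_le:
  assumes "\<phi> \<in> L2" "\<psi> \<in> L2" "\<xi> \<in> L2"
  shows "sqnorm (\<lambda>x. \<phi> x + \<psi> x + \<xi> x) \<le> 3 * (sqnorm \<phi> + sqnorm \<psi> + sqnorm \<xi>)"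
proof -
  have "(cmod (a + b + c))\<^sup>2 \<le> 3 * ((cmod a)\<^sup>2 + (cmod b)\<^sup>2 + (cmod c)\<^sup>2)" for a b c
  proof -
    have "(cmod (a + b + c))\<^sup>2 \<le> (cmod a + cmod b + cmod c)\<^sup>2"
      by (intro power_mono norm_triangle_le add_right_mono norm_triangle_ineq) auto
    also have "\<dots> \<le> 3 * ((cmod a)\<^sup>2 + (cmod b)\<^sup>2 + (cmod c)\<^sup>2)"
      using sum_squares_bound[of "cmod a" "cmod b"] sum_squares_bound[of "cmod a" "cmod c"]
        sum_squares_bound[of "cmod b" "cmod c"]
      by (simp add: power2_eq_square algebra_simps)
    finally show ?thesis .
  qed
  then have "sqnorm (\<lambda>x. \<phi> x + \<psi> x + \<xi> x) \<le> (LINT x|TM. 3 * ((cmod (\<phi> x))\<^sup>2 + (cmod (\<psi> x))\<^sup>2 + (cmod (\<xi> x))\<^sup>2))"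
    unfolding sqnorm_def using assms L2_D(3)[OF L2_add[OF L2_add[OF assms(1,2)] assms(3)]]
    by (intro integral_mono) (auto intro!: L2_D(3) assms Bochner_Integration.integrable_add integrable_mult_right)
  also have "\<dots> = 3 * (sqnorm \<phi> + sqnorm \<psi> + sqnorm \<xi>)"
    unfolding sqnorm_def using assms by (simp add: L2_D(3))
  finally show ?thesis .
qed

text \<open>Integrate \<open>2 * s * a * b \<le> (s * a)\<^sup>2 + b\<^sup>2\<close> for the two
  moduli and choose the optimal \<open>s\<close>; if \<open>sqnorm \<phi> = 0\<close>, arbitrarily
  large \<open>s\<close> forces the integral to vanish.\<close>

lemma L2_cauchy_schwarz:
  assumes "\<phi> \<in> L2" "\<psi> \<in> L2"
  shows "(LINT x|TM. cmod (\<phi> x) * cmod (\<psi> x)) \<le> sqrt (sqnorm \<phi>) * sqrt (sqnorm \<psi>)"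
proof -
  define I where "I = (LINT x|TM. cmod (\<phi> x) * cmod (\<psi> x))"
  have int: "integrable TM (\<lambda>x. cmod (\<phi> x) * cmod (\<psi> x))"
    using integrable_norm[OF L2_mult_integrable[OF assms]] by (simp add: norm_mult)
  have I0: "0 \<le> I" unfolding I_def by (auto intro!: integral_nonneg)
  have key: "2 * s * I \<le> s\<^sup>2 * sqnorm \<phi> + sqnorm \<psi>" for s
  proof -
    have "2 * s * I = (LINT x|TM. 2 * s * (cmod (\<phi> x) * cmod (\<psi> x)))" by (simp add: I_def)
    also have "\<dots> \<le> (LINT x|TM. s\<^sup>2 * (cmod (\<phi> x))\<^sup>2 + (cmod (\<psi> x))\<^sup>2)"
      using assms int sum_squares_bound[of "s * cmod (\<phi> _)" "cmod (\<psi> _)"]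
      by (intro integral_mono) (auto intro!: L2_D(3) simp: power_mult_distrib mult_ac)
    also have "\<dots> = s\<^sup>2 * sqnorm \<phi> + sqnorm \<psi>" using assms by (simp add: sqnorm_def L2_D(3))
    finally show ?thesis .
  qed
  have "I\<^sup>2 \<le> sqnorm \<phi> * sqnorm \<psi>"
  proof (cases "sqnorm \<phi> = 0")
    case True
    have "I = 0"
    proof (rule ccontr)
      assume "I \<noteq> 0"
      \<comment> \<open>For this \<open>s\<close> the left side of \<open>key\<close> is
        \<open>sqnorm \<psi> + 1\<close> and the right side only
        \<open>sqnorm \<psi>\<close>.\<close>
      then show False using key[of "(sqnorm \<psi> + 1) / (2 * I)"] True I0 by simp
    qed
    then show ?thesis using True by simp
  next
    case False
    then have p: "sqnorm \<phi> > 0" using sqnorm_nonneg[of \<phi>] by simp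
    from key[of "I / sqnorm \<phi>"] p show ?thesis
      by (simp add: power2_eq_square field_simps)
  qed
  then have "I \<le> sqrt (sqnorm \<phi> * sqnorm \<psi>)" by (rule real_le_rsqrt)
  then show ?thesis by (simp add: I_def real_sqrt_mult)
qed

lemma fc_add: "\<phi> \<in> L2 \<Longrightarrow> \<psi> \<in> L2 \<Longrightarrow> fc (\<lambda>x. \<phi> x + \<psi> x) k = fc \<phi> k + fc \<psi> k"
  using L2_mult_integrable[OF _ wave_L2[of "- k"]]
  by (simp add: fc_def distrib_right add_divide_distrib)

lemma fc_cmult: "fc (\<lambda>x. c * \<phi> x) k = c * fc \<phi> k"
  by (simp add: fc_def mult.assoc)

lemma fc_diff: "\<phi> \<in> L2 \<Longrightarrow> \<psi> \<in> L2 \<Longrightarrow> fc (\<lambda>x. \<phi> x - \<psi> x) k = fc \<phi> k - fc \<psi> k"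
  using fc_add[of \<phi> "\<lambda>x. (-1) * \<psi> x" k] L2_cmult[of \<psi> "-1"] fc_cmult[of "-1" \<psi> k] by simp

text \<open>The partial Fourier sum \<open>p\<close> is an orthogonal projection: its inner product
  with \<phi> equals \<open>sqnorm p\<close>, so the squared distance from \<phi> to
  \<open>p\<close> is \<open>sqnorm \<phi> - sqnorm p\<close>.\<close>

lemma bessel:
  assumes "\<phi> \<in> L2" "finite A"
  shows "(2 * pi)\<^sup>2 * (\<Sum>k\<in>A. (cmod (fc \<phi> k))\<^sup>2) \<le> sqnorm \<phi>"
proof -
  define p where "p = trig A (fc \<phi>)"
  have pL: "p \<in> L2" unfolding p_def by (rule trig_L2)
  have cpL: "(\<lambda>x. cnj (p x)) \<in> L2"
    using pL by (rule L2_cnj)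
  have cross: "(LINT x|TM. \<phi> x * cnj (p x)) = complex_of_real (sqnorm p)"
  proof -
    have "(LINT x|TM. \<phi> x * cnj (p x)) = (LINT x|TM. (\<Sum>k\<in>A. cnj (fc \<phi> k) * (\<phi> x * cnj (wave k x))))"
      by (simp add: p_def trig_def sum_distrib_left mult_ac)
    also have "\<dots> = (\<Sum>k\<in>A. cnj (fc \<phi> k) * (LINT x|TM. \<phi> x * cnj (wave k x)))"
      using L2_mult_integrable[OF assms(1) wave_L2[of "- _"]]
      by (subst Bochner_Integration.integral_sum) auto
    also have "\<dots> = (\<Sum>k\<in>A. complex_of_real ((2 * pi)\<^sup>2) * complex_of_real ((cmod (fc \<phi> k))\<^sup>2))"
    proof (intro sum.cong refl)
      fix k
      have "(LINT x|TM. \<phi> x * cnj (wave k x)) = complex_of_real ((2 * pi)\<^sup>2) * fc \<phi> k"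
        by (simp add: fc_def)
      then show "cnj (fc \<phi> k) * (LINT x|TM. \<phi> x * cnj (wave k x)) =
          complex_of_real ((2 * pi)\<^sup>2) * complex_of_real ((cmod (fc \<phi> k))\<^sup>2)"
        by (simp only: complex_norm_square mult_ac)
    qed
    also have "\<dots> = complex_of_real (sqnorm p)"
      unfolding p_def trig_parseval[OF assms(2)] by (simp add: sum_distrib_left)
    finally show ?thesis .
  qed
  have int: "integrable TM (\<lambda>x. \<phi> x * cnj (p x))" by (rule L2_mult_integrable[OF assms(1) cpL])
  have "0 \<le> sqnorm (\<lambda>x. \<phi> x - p x)" by (rule sqnorm_nonneg)
  also have "sqnorm (\<lambda>x. \<phi> x - p x) = (LINT x|TM. (cmod (\<phi> x))\<^sup>2 - 2 * Re (\<phi> x * cnj (p x)) + (cmod (p x))\<^sup>2)"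
    unfolding sqnorm_def
    by (intro Bochner_Integration.integral_cong refl) (simp add: cmod_power2 power2_diff algebra_simps)
  also have "\<dots> = sqnorm \<phi> - 2 * (LINT x|TM. Re (\<phi> x * cnj (p x))) + sqnorm p"
    unfolding sqnorm_def using integrable_Re[OF int] L2_D(3)[OF assms(1)] L2_D(3)[OF pL]
    by (simp del: times_complex.sel)
  also have "(LINT x|TM. Re (\<phi> x * cnj (p x))) = sqnorm p"
    using int cross by (subst integral_Re) auto
  finally have "sqnorm p \<le> sqnorm \<phi>" by simp
  then show ?thesis unfolding p_def trig_parseval[OF assms(2)] .
qed

subsection \<open>Fejer means\<close>

definition fejer_box :: "nat \<Rightarrow> (int^2) set" where
  "fejer_box n = {j. \<forall>i. 0 \<le> j $ i \<and> j $ i < int n}"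

definition fejer_supp :: "nat \<Rightarrow> (int^2) set" where
  "fejer_supp n = {k. \<forall>i. - int n < k $ i \<and> k $ i < int n}"

text \<open>Counts the representations of \<open>k\<close> as a difference of two points of the box.
  With these coefficients the kernel is a squared modulus and hence nonnegative; in closed form the
  weight is a product of two triangle functions.\<close>

definition fejer_weight :: "nat \<Rightarrow> int^2 \<Rightarrow> real" where
  "fejer_weight n k = real (card {j \<in> fejer_box n. j - k \<in> fejer_box n}) / real (n\<^sup>2)"

definition fejer_kernel :: "nat \<Rightarrow> real^2 \<Rightarrow> real" where
  "fejer_kernel n x = (cmod (\<Sum>j\<in>fejer_box n. wave j x))\<^sup>2 / real (n\<^sup>2)"

text \<open>Defined through coefficients, so that the means are trigonometric polynomials by
  construction; \<open>fejer_eq_integral\<close> recovers the convolution with the nonnegative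
  kernel.\<close>

definition fejer :: "nat \<Rightarrow> (real^2 \<Rightarrow> complex) \<Rightarrow> real^2 \<Rightarrow> complex" where
  "fejer n \<phi> = trig (fejer_supp n) (\<lambda>k. fejer_weight n k * fc \<phi> k)"

lemma card_int_box:
  fixes a b :: "int^2"
  shows "finite {j :: int^2. \<forall>i. a $ i \<le> j $ i \<and> j $ i < b $ i}"
    and "card {j :: int^2. \<forall>i. a $ i \<le> j $ i \<and> j $ i < b $ i} = nat (b $ 1 - a $ 1) * nat (b $ 2 - a $ 2)"
proof -
  define f where "f = (\<lambda>(p, q). (\<chi> i. if i = 1 then p else q) :: int^2)"
  have inj: "inj_on f X" for X
    by (auto simp: inj_on_def f_def vec_eq_iff forall_2)
  have "{j :: int^2. \<forall>i. a $ i \<le> j $ i \<and> j $ i < b $ i} = f ` ({a $ 1..<b $ 1} \<times> {a $ 2..<b $ 2})"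
  proof (intro set_eqI iffI)
    fix j assume "j \<in> {j :: int^2. \<forall>i. a $ i \<le> j $ i \<and> j $ i < b $ i}"
    moreover have "j = f (j $ 1, j $ 2)" by (simp add: f_def vec_eq_iff forall_2)
    ultimately show "j \<in> f ` ({a $ 1..<b $ 1} \<times> {a $ 2..<b $ 2})" by auto
  qed (auto simp: f_def forall_2)
  then show "finite {j :: int^2. \<forall>i. a $ i \<le> j $ i \<and> j $ i < b $ i}"
    and "card {j :: int^2. \<forall>i. a $ i \<le> j $ i \<and> j $ i < b $ i} = nat (b $ 1 - a $ 1) * nat (b $ 2 - a $ 2)"
    by (auto simp: card_image[OF inj] card_cartesian_product)
qed

lemma finite_fejer_box [simp]: "finite (fejer_box n)"
  using card_int_box(1)[of 0 "\<chi> i. int n"] by (simp add: fejer_box_def)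

lemma finite_fejer_supp [simp]: "finite (fejer_supp n)"
  by (rule finite_subset[OF _ card_int_box(1)[of "\<chi> i. - int n" "\<chi> i. int n"]])
     (auto simp: fejer_supp_def less_imp_le)

lemma fejer_weight_eq:
  "fejer_weight n k = real (nat (int n - \<bar>k $ 1\<bar>) * nat (int n - \<bar>k $ 2\<bar>)) / real (n\<^sup>2)"
proof -
  have iff: "(0 \<le> p \<and> p < int n) \<and> (0 \<le> p - q \<and> p - q < int n) \<longleftrightarrow>
        max 0 q \<le> p \<and> p < min (int n) (int n + q)" for p q
    by auto
  have "{j \<in> fejer_box n. j - k \<in> fejer_box n} =
    {j. \<forall>i. (\<chi> i. max 0 (k $ i)) $ i \<le> j $ i \<and> j $ i < (\<chi> i. min (int n) (int n + k $ i)) $ i}"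
    by (intro Collect_cong, simp only: fejer_box_def mem_Collect_eq vec_lambda_beta
          vector_minus_component iff[symmetric] all_conj_distrib conj_assoc)
  moreover have "min (int n) (int n + q) - max 0 q = int n - \<bar>q\<bar>" for q by auto
  ultimately show ?thesis
    unfolding fejer_weight_def by (simp only: card_int_box(2)) simp
qed

lemma fejer_weight_nonneg: "0 \<le> fejer_weight n k"
  by (simp add: fejer_weight_def)

lemma fejer_weight_le_1: "fejer_weight n k \<le> 1"
proof -
  have "real (nat (int n - \<bar>k $ 1\<bar>) * nat (int n - \<bar>k $ 2\<bar>)) \<le> real (n * n)"
    by (intro of_nat_mono mult_mono) auto
  then show ?thesis
    by (cases "n = 0") (auto simp: fejer_weight_eq power2_eq_square divide_simps)
qed

lemma fejer_weight_0: "n > 0 \<Longrightarrow> fejer_weight n 0 = 1"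
  by (simp add: fejer_weight_eq power2_eq_square)

lemma fejer_weight_outside: "k \<notin> fejer_supp n \<Longrightarrow> fejer_weight n k = 0"
  by (auto simp: fejer_supp_def fejer_weight_eq forall_2)

lemma fejer_weight_tendsto: "(\<lambda>n. fejer_weight n k) \<longlonglongrightarrow> 1"
proof -
  define c d where "c = real_of_int \<bar>k $ 1\<bar>" and "d = real_of_int \<bar>k $ 2\<bar>"
  have "((\<lambda>n. (1 - c * inverse (real n)) * (1 - d * inverse (real n))) \<longlongrightarrow> (1 - c * 0) * (1 - d * 0)) sequentially"
    by (intro tendsto_intros lim_inverse_n)
  moreover have "eventually (\<lambda>n. (1 - c * inverse (real n)) * (1 - d * inverse (real n)) = fejer_weight n k) sequentially"
    using eventually_ge_at_top[of "nat (1 + \<bar>k $ 1\<bar> + \<bar>k $ 2\<bar>)"]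
  proof eventually_elim
    case (elim n)
    then have n: "\<bar>k $ 1\<bar> \<le> int n" "\<bar>k $ 2\<bar> \<le> int n" "n > 0" by linarith+
    then have "real (nat (int n - \<bar>k $ 1\<bar>)) = real n - c" "real (nat (int n - \<bar>k $ 2\<bar>)) = real n - d"
      by (auto simp: c_def d_def)
    then show ?case using n unfolding fejer_weight_eq
      by (simp add: power2_eq_square field_simps)
  qed
  ultimately show ?thesis using Lim_transform_eventually by fastforce
qed

lemma fejer_kernel_nonneg: "0 \<le> fejer_kernel n x"
  by (simp add: fejer_kernel_def)

text \<open>Expand the squared modulus into pairs of box points and group the pairs by their
  difference.\<close>

lemma fejer_kernel_eq:
  "complex_of_real (fejer_kernel n x) = trig (fejer_supp n) (\<lambda>k. complex_of_real (fejer_weight n k)) x"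
proof -
  let ?B = "fejer_box n"
  have group: "(\<Sum>k\<in>fejer_supp n. \<Sum>p\<in>{p \<in> ?B \<times> ?B. fst p - snd p = k}. wave (fst p - snd p) x) =
        (\<Sum>p\<in>?B \<times> ?B. wave (fst p - snd p) x)"
  proof (rule sum.group)
    have "j - l \<in> fejer_supp n" if "j \<in> ?B" "l \<in> ?B" for j l
    proof -
      have "- int n < (j - l) $ i \<and> (j - l) $ i < int n" for i
      proof -
        have "0 \<le> j $ i \<and> j $ i < int n" "0 \<le> l $ i \<and> l $ i < int n"
          using that by (auto simp: fejer_box_def)
        then show ?thesis by auto
      qed
      then show ?thesis by (simp add: fejer_supp_def)
    qed
    then show "(\<lambda>p. fst p - snd p) ` (?B \<times> ?B) \<subseteq> fejer_supp n" by auto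
  qed auto
  have fibre: "(\<Sum>p\<in>{p \<in> ?B \<times> ?B. fst p - snd p = k}. wave (fst p - snd p) x) =
       complex_of_real (card {j \<in> ?B. j - k \<in> ?B}) * wave k x" for k
  proof -
    have "(\<Sum>p\<in>{p \<in> ?B \<times> ?B. fst p - snd p = k}. wave (fst p - snd p) x) =
      (\<Sum>p\<in>{p \<in> ?B \<times> ?B. fst p - snd p = k}. wave k x)"
      by (intro sum.cong) auto
    moreover have "card {p \<in> ?B \<times> ?B. fst p - snd p = k} = card {j \<in> ?B. j - k \<in> ?B}"
      by (rule bij_betw_same_card[of fst], rule bij_betw_byWitness[where f'="\<lambda>j. (j, j - k)"]) auto
    ultimately show ?thesis by simp
  qed
  have "(\<Sum>k\<in>fejer_supp n. complex_of_real (card {j \<in> ?B. j - k \<in> ?B}) * wave k x) =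
      (\<Sum>p\<in>?B \<times> ?B. wave (fst p - snd p) x)" using group by (simp only: fibre)
  also have "\<dots> = (\<Sum>j\<in>?B. \<Sum>l\<in>?B. wave j x * cnj (wave l x))"
    by (simp add: sum.cartesian_product case_prod_beta wave_diff)
  also have "\<dots> = complex_of_real ((cmod (\<Sum>j\<in>?B. wave j x))\<^sup>2)"
    by (simp only: complex_norm_square cnj_sum sum_product)
  finally have eq: "complex_of_real ((cmod (\<Sum>j\<in>?B. wave j x))\<^sup>2) =
      (\<Sum>k\<in>fejer_supp n. complex_of_real (card {j \<in> ?B. j - k \<in> ?B}) * wave k x)" ..
  have "complex_of_real (fejer_kernel n x) =
      complex_of_real ((cmod (\<Sum>j\<in>?B. wave j x))\<^sup>2) / complex_of_real (real (n\<^sup>2))"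
    unfolding fejer_kernel_def by (rule of_real_divide)
  also have "\<dots> = trig (fejer_supp n) (\<lambda>k. complex_of_real (fejer_weight n k)) x"
    unfolding eq by (simp add: trig_def fejer_weight_def sum_divide_distrib)
  finally show ?thesis .
qed

lemma continuous_fejer_kernel: "continuous_on S f \<Longrightarrow> continuous_on S (\<lambda>x. fejer_kernel n (f x))"
  unfolding fejer_kernel_def divide_inverse by (intro continuous_intros)

lemma fejer_kernel_bound: "\<exists>C. \<forall>x. fejer_kernel n x \<le> C"
proof -
  have "(cmod (\<Sum>j\<in>fejer_box n. wave j x))\<^sup>2 \<le> (real (card (fejer_box n)))\<^sup>2" for x
    using norm_sum[of "\<lambda>j. wave j x" "fejer_box n"] by (intro power_mono) auto
  then have "\<forall>x. fejer_kernel n x \<le> (real (card (fejer_box n)))\<^sup>2 / real (n\<^sup>2)"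
    unfolding fejer_kernel_def by (auto intro!: divide_right_mono)
  then show ?thesis by blast
qed

lemma integrable_mult_fejer_kernel:
  fixes \<phi> :: "real^2 \<Rightarrow> 'a::{banach, second_countable_topology, real_normed_algebra_1}"
  assumes "integrable TM \<phi>"
  shows "integrable TM (\<lambda>y. \<phi> y * of_real (fejer_kernel n (x - y)))"
proof -
  obtain C where C: "\<forall>x. fejer_kernel n x \<le> C" using fejer_kernel_bound by blast
  have "(\<lambda>y. fejer_kernel n (x - y)) \<in> borel_measurable TM"
    by (intro measurable_TM borel_measurable_continuous_onI continuous_fejer_kernel continuous_intros)
  then have meas: "(\<lambda>y. \<phi> y * of_real (fejer_kernel n (x - y))) \<in> borel_measurable TM"
    using assms by auto
  show ?thesis
  proof (rule Bochner_Integration.integrable_bound[OF integrable_mult_right[of C, OF integrable_norm[OF assms]] meas])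
    have "norm (\<phi> y * of_real (fejer_kernel n (x - y))) \<le> norm (C * norm (\<phi> y))" for y
    proof -
      have "norm (\<phi> y * of_real (fejer_kernel n (x - y))) \<le> norm (\<phi> y) * fejer_kernel n (x - y)"
        using norm_mult_ineq[of "\<phi> y" "of_real (fejer_kernel n (x - y))"] fejer_kernel_nonneg[of n "x - y"] by simp
      also have "\<dots> \<le> norm (\<phi> y) * C" using C by (intro mult_left_mono) auto
      also have "\<dots> \<le> norm (C * norm (\<phi> y))" by (simp add: mult.commute abs_mult) (metis abs_ge_self abs_norm_cancel mult_right_mono norm_ge_zero)
      finally show ?thesis .
    qed
    then show "AE y in TM. norm (\<phi> y * of_real (fejer_kernel n (x - y))) \<le> norm (C * norm (\<phi> y))" by simp
  qed
qed

lemma fejer_eq_integral: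
  assumes "\<phi> \<in> L2"
  shows "fejer n \<phi> x = (LINT y|TM. \<phi> y * complex_of_real (fejer_kernel n (x - y))) / complex_of_real ((2 * pi)\<^sup>2)"
proof -
  have "(LINT y|TM. \<phi> y * complex_of_real (fejer_kernel n (x - y))) =
     (LINT y|TM. (\<Sum>k\<in>fejer_supp n. fejer_weight n k * wave k x * (\<phi> y * cnj (wave k y))))"
    unfolding fejer_kernel_eq trig_def
    by (simp add: sum_distrib_left diff_conv_add_uminus wave_plus wave_minus mult_ac del: add_uminus_conv_diff)
  also have "\<dots> = (\<Sum>k\<in>fejer_supp n. fejer_weight n k * wave k x * (LINT y|TM. \<phi> y * cnj (wave k y)))"
    using L2_mult_integrable[OF assms wave_L2[of "- _"]]
    by (subst Bochner_Integration.integral_sum) auto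
  finally show ?thesis
    by (simp add: fejer_def trig_def fc_def sum_divide_distrib mult_ac)
qed

lemma fejer_L2 [simp]: "fejer n \<phi> \<in> L2"
  by (simp add: fejer_def trig_L2)

lemma fejer_wave: "fejer n (wave q) x = fejer_weight n q * wave q x"
proof -
  have "fc (wave q) k = (if k = q then 1 else 0)" for k
  proof -
    have "trig {q} (\<lambda>_. 1) = wave q" by (simp add: trig_def fun_eq_iff)
    then show ?thesis using fc_trig[of "{q}" "\<lambda>_. 1" k] by simp
  qed
  then have "fejer n (wave q) x = (\<Sum>k\<in>fejer_supp n. if k = q then fejer_weight n q * wave q x else 0)"
    unfolding fejer_def trig_def by (intro sum.cong) auto
  then show ?thesis using fejer_weight_outside[of q n] by (auto simp: sum.delta)
qed

lemma fejer_const: "n > 0 \<Longrightarrow> fejer n (\<lambda>x. c) x = c"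
proof -
  assume n: "n > 0"
  have *: "(\<lambda>x. c) = (\<lambda>x. c * wave 0 x)" by simp
  have "fejer n (\<lambda>x. c) x = c * fejer n (wave 0) x"
    unfolding * fejer_def trig_def fc_cmult by (simp add: sum_distrib_left mult_ac)
  then show ?thesis by (simp only: fejer_wave fejer_weight_0[OF n]) simp
qed

lemma fejer_contraction: assumes "\<phi> \<in> L2" shows "sqnorm (fejer n \<phi>) \<le> sqnorm \<phi>"
proof -
  have "(\<Sum>k\<in>fejer_supp n. (cmod (fejer_weight n k * fc \<phi> k))\<^sup>2) \<le> (\<Sum>k\<in>fejer_supp n. (cmod (fc \<phi> k))\<^sup>2)"
    using fejer_weight_nonneg fejer_weight_le_1
    by (intro sum_mono power_mono) (auto simp: norm_mult mult_left_le_one_le)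
  then show ?thesis
    unfolding fejer_def using bessel[OF assms finite_fejer_supp[of n]]
    by (subst trig_parseval) (auto intro: order_trans[OF mult_left_mono])
qed

lemma fejer_add: "\<phi> \<in> L2 \<Longrightarrow> \<psi> \<in> L2 \<Longrightarrow> fejer n (\<lambda>x. \<phi> x + \<psi> x) x = fejer n \<phi> x + fejer n \<psi> x"
  by (simp add: fejer_def trig_def fc_add algebra_simps sum.distrib)

lemma fejer_diff: "\<phi> \<in> L2 \<Longrightarrow> \<psi> \<in> L2 \<Longrightarrow> fejer n (\<lambda>x. \<phi> x - \<psi> x) x = fejer n \<phi> x - fejer n \<psi> x"
  by (simp add: fejer_def trig_def fc_diff algebra_simps sum_subtractf)

lemma fejer_cmult: "fejer n (\<lambda>x. c * \<phi> x) x = c * fejer n \<phi> x"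
  unfolding fejer_def trig_def fc_cmult by (simp add: sum_distrib_left mult_ac)

lemma integral_fejer_kernel: "n > 0 \<Longrightarrow> (LINT y|TM. complex_of_real (fejer_kernel n (x - y))) = complex_of_real ((2 * pi)\<^sup>2)"
  using fejer_eq_integral[of "\<lambda>x. 1" n x] fejer_const[of n 1 x] by simp

section \<open>Mean-square convergence of Fejer means\<close>

definition fejer_conv :: "(real^2 \<Rightarrow> complex) \<Rightarrow> bool" where
  "fejer_conv \<phi> \<longleftrightarrow> (\<lambda>n. sqnorm (\<lambda>x. \<phi> x - fejer n \<phi> x)) \<longlonglongrightarrow> 0"

lemma sqnorm_zero [simp]: "sqnorm (\<lambda>x. 0) = 0"
  by (simp add: sqnorm_def)

lemma sqnorm_diff_commute: "sqnorm (\<lambda>x. \<phi> x - \<psi> x) = sqnorm (\<lambda>x. \<psi> x - \<phi> x)"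
  by (simp add: sqnorm_def norm_minus_commute)

text \<open>Since Fejer means are contractions in mean square, the functions whose means converge
  form a closed set.\<close>

lemma fejer_conv_limit:
  assumes \<phi>: "\<phi> \<in> L2"
    and approx: "\<And>\<epsilon>. \<epsilon> > 0 \<Longrightarrow> \<exists>\<psi>\<in>L2. fejer_conv \<psi> \<and> sqnorm (\<lambda>x. \<phi> x - \<psi> x) < \<epsilon>"
  shows "fejer_conv \<phi>"
  unfolding fejer_conv_def
proof (rule tendsto_sandwich[of "\<lambda>_. 0"])
  show "\<forall>\<^sub>F n in sequentially. sqnorm (\<lambda>x. \<phi> x - fejer n \<phi> x) \<le> sqnorm (\<lambda>x. \<phi> x - fejer n \<phi> x)" by simp
  show "(\<lambda>n. sqnorm (\<lambda>x. \<phi> x - fejer n \<phi> x)) \<longlonglongrightarrow> 0"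
  proof (rule LIMSEQ_I)
    fix \<epsilon> :: real assume "\<epsilon> > 0"
    \<comment> \<open>Three error terms, and a factor 3 from \<open>sqnorm_add3_le\<close>, account
      for the ninth.\<close>
    then obtain \<psi> where \<psi>: "\<psi> \<in> L2" "fejer_conv \<psi>" "sqnorm (\<lambda>x. \<phi> x - \<psi> x) < \<epsilon> / 9"
      using approx[of "\<epsilon> / 9"] by auto
    obtain N where N: "\<And>n. n \<ge> N \<Longrightarrow> sqnorm (\<lambda>x. \<psi> x - fejer n \<psi> x) < \<epsilon> / 9"
      using LIMSEQ_D[OF \<psi>(2)[unfolded fejer_conv_def], of "\<epsilon> / 9"] \<open>\<epsilon> > 0\<close> sqnorm_nonneg by auto
    have "sqnorm (\<lambda>x. \<phi> x - fejer n \<phi> x) < \<epsilon>" if "n \<ge> N" for n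
    proof -
      have "sqnorm (\<lambda>x. \<phi> x - fejer n \<phi> x) =
        sqnorm (\<lambda>x. (\<phi> x - \<psi> x) + (\<psi> x - fejer n \<psi> x) + fejer n (\<lambda>x. \<psi> x - \<phi> x) x)"
        using \<phi> \<psi>(1) by (simp add: fejer_diff)
      also have "\<dots> \<le> 3 * (sqnorm (\<lambda>x. \<phi> x - \<psi> x) + sqnorm (\<lambda>x. \<psi> x - fejer n \<psi> x) + sqnorm (fejer n (\<lambda>x. \<psi> x - \<phi> x)))"
        using \<phi> \<psi>(1) by (intro sqnorm_add3_le L2_diff) auto
      also have "\<dots> \<le> 3 * (sqnorm (\<lambda>x. \<phi> x - \<psi> x) + sqnorm (\<lambda>x. \<psi> x - fejer n \<psi> x) + sqnorm (\<lambda>x. \<psi> x - \<phi> x))"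
        using fejer_contraction[OF L2_diff[OF \<psi>(1) \<phi>]] by auto
      also have "\<dots> < \<epsilon>"
        using N[OF that] \<psi>(3) sqnorm_diff_commute[of \<psi> \<phi>] by simp
      finally show ?thesis .
    qed
    then show "\<exists>no. \<forall>n\<ge>no. norm (sqnorm (\<lambda>x. \<phi> x - fejer n \<phi> x) - 0) < \<epsilon>"
      using sqnorm_nonneg by auto
  qed
qed (auto simp: sqnorm_nonneg)

lemma fejer_conv_add:
  assumes "\<phi> \<in> L2" "\<psi> \<in> L2" "fejer_conv \<phi>" "fejer_conv \<psi>"
  shows "fejer_conv (\<lambda>x. \<phi> x + \<psi> x)"
  unfolding fejer_conv_def
proof (rule tendsto_sandwich[of "\<lambda>_. 0"])
  show "\<forall>\<^sub>F n in sequentially. sqnorm (\<lambda>x. \<phi> x + \<psi> x - fejer n (\<lambda>x. \<phi> x + \<psi> x) x) \<le>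
     3 * (sqnorm (\<lambda>x. \<phi> x - fejer n \<phi> x) + sqnorm (\<lambda>x. \<psi> x - fejer n \<psi> x) + sqnorm (\<lambda>x. 0))"
  proof (intro always_eventually allI)
    fix n
    have "sqnorm (\<lambda>x. \<phi> x + \<psi> x - fejer n (\<lambda>x. \<phi> x + \<psi> x) x) =
      sqnorm (\<lambda>x. (\<phi> x - fejer n \<phi> x) + (\<psi> x - fejer n \<psi> x) + 0)"
      using assms by (simp add: fejer_add algebra_simps)
    also have "\<dots> \<le> 3 * (sqnorm (\<lambda>x. \<phi> x - fejer n \<phi> x) + sqnorm (\<lambda>x. \<psi> x - fejer n \<psi> x) + sqnorm (\<lambda>x. 0))"
      using assms by (intro sqnorm_add3_le L2_diff) auto
    finally show "sqnorm (\<lambda>x. \<phi> x + \<psi> x - fejer n (\<lambda>x. \<phi> x + \<psi> x) x) \<le>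
      3 * (sqnorm (\<lambda>x. \<phi> x - fejer n \<phi> x) + sqnorm (\<lambda>x. \<psi> x - fejer n \<psi> x) + sqnorm (\<lambda>x. 0))" .
  qed
  show "(\<lambda>n. 3 * (sqnorm (\<lambda>x. \<phi> x - fejer n \<phi> x) + sqnorm (\<lambda>x. \<psi> x - fejer n \<psi> x) + sqnorm (\<lambda>x. 0))) \<longlonglongrightarrow> 0"
    using tendsto_mult_right_zero[OF tendsto_add_zero[OF assms(3,4)[unfolded fejer_conv_def]], of 3] by simp
qed (auto simp: sqnorm_nonneg)

lemma fejer_conv_cmult:
  assumes "fejer_conv \<phi>"
  shows "fejer_conv (\<lambda>x. c * \<phi> x)"
proof -
  have "sqnorm (\<lambda>x. c * \<phi> x - fejer n (\<lambda>x. c * \<phi> x) x) = (cmod c)\<^sup>2 * sqnorm (\<lambda>x. \<phi> x - fejer n \<phi> x)" for n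
    by (simp add: fejer_cmult right_diff_distrib[symmetric] sqnorm_cmult)
  then show ?thesis
    using assms unfolding fejer_conv_def by (simp add: tendsto_mult_right_zero)
qed

lemma fejer_conv_const: "fejer_conv (\<lambda>x. c)"
proof -
  have "eventually (\<lambda>n. sqnorm (\<lambda>x. c - fejer n (\<lambda>x. c) x) = 0) sequentially"
    using eventually_gt_at_top[of 0] by eventually_elim (simp add: fejer_const)
  then show ?thesis unfolding fejer_conv_def by (rule tendsto_eventually)
qed

lemma fejer_conv_sum:
  assumes "finite I" "\<And>i. i \<in> I \<Longrightarrow> \<phi> i \<in> L2 \<and> fejer_conv (\<phi> i)"
  shows "(\<lambda>x. \<Sum>i\<in>I. \<phi> i x) \<in> L2 \<and> fejer_conv (\<lambda>x. \<Sum>i\<in>I. \<phi> i x)"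
  using assms by (induction I rule: finite_induct) (auto intro: L2_add fejer_conv_add fejer_conv_const)

text \<open>This moment tends to zero and replaces pointwise bounds on the Fejer kernel.\<close>

lemma integral_cos_fejer_kernel:
  assumes n: "n > 0"
  shows "(LINT y|TM. (1 - cos (x $ i - y $ i)) * fejer_kernel n (x - y)) =
    (2 * pi)\<^sup>2 * (1 - fejer_weight n (axis i 1))"
proof -
  define q :: "int^2" where "q = axis i 1"
  have qx: "wavevec q \<bullet> z = z $ i" for z
  proof -
    have "wavevec q = axis i 1" by (auto simp: wavevec_def q_def axis_def vec_eq_iff)
    then show ?thesis by (simp add: inner_axis' inner_axis)
  qed
  define \<phi> where "\<phi> = (\<lambda>y. 1 - cnj (wave q x) * wave q y)"
  have \<phi>: "\<phi> \<in> L2" unfolding \<phi>_def by (intro L2_diff L2_const L2_cmult wave_L2)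
  have "fejer n \<phi> x = fejer n (\<lambda>y. 1) x - cnj (wave q x) * fejer n (wave q) x"
    unfolding \<phi>_def by (subst fejer_diff) (auto intro: L2_cmult wave_L2 simp: fejer_cmult)
  also have "\<dots> = 1 - fejer_weight n q * (wave q x * cnj (wave q x))"
    by (simp add: fejer_const[OF n] fejer_wave mult_ac)
  also have "wave q x * cnj (wave q x) = 1"
    by (simp add: wave_diff[symmetric])
  finally have eq: "(LINT y|TM. \<phi> y * complex_of_real (fejer_kernel n (x - y))) =
      complex_of_real ((2 * pi)\<^sup>2 * (1 - fejer_weight n q))"
    unfolding fejer_eq_integral[OF \<phi>] by (simp add: divide_eq_eq mult.commute)
  have "(LINT y|TM. (1 - cos (x $ i - y $ i)) * fejer_kernel n (x - y)) =
      (LINT y|TM. Re (\<phi> y * complex_of_real (fejer_kernel n (x - y))))"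
    by (intro Bochner_Integration.integral_cong refl)
       (simp add: \<phi>_def wave_def qx cos_diff algebra_simps)
  also have "\<dots> = Re (LINT y|TM. \<phi> y * complex_of_real (fejer_kernel n (x - y)))"
    by (rule integral_Re[OF integrable_mult_fejer_kernel[OF L2_integrable[OF \<phi>], unfolded of_real_eq_id id_def]])
  finally show ?thesis unfolding eq q_def by simp
qed

text \<open>The error is an average of \<open>\<phi> x - \<phi> y\<close> against the kernel. A
  modulus of continuity built from \<open>1 - cos\<close> is integrated exactly by
  \<open>integral_cos_fejer_kernel\<close>, so no decay estimate for the kernel enters.\<close>

lemma fejer_pointwise:
  assumes \<phi>: "\<phi> \<in> L2"
    and C: "\<And>y. y \<in> torus \<Longrightarrow> cmod (\<phi> x - \<phi> y) \<le> C * (\<Sum>i\<in>UNIV. 1 - cos (x $ i - y $ i))"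
  shows "(\<lambda>n. fejer n \<phi> x) \<longlonglongrightarrow> \<phi> x"
proof -
  let ?F = "\<lambda>n y. fejer_kernel n (x - y)"
  have bound: "cmod (\<phi> x - fejer n \<phi> x) \<le> C * (\<Sum>i\<in>UNIV. 1 - fejer_weight n (axis i 1))" if n: "n > 0" for n
  proof -
    have int: "integrable TM (\<lambda>y. (\<phi> x - \<phi> y) * complex_of_real (?F n y))"
      using integrable_mult_fejer_kernel[OF L2_integrable[OF L2_diff[OF L2_const \<phi>]]] by simp
    have "complex_of_real ((2 * pi)\<^sup>2) * (\<phi> x - fejer n \<phi> x) =
       \<phi> x * (LINT y|TM. complex_of_real (?F n y)) - (LINT y|TM. \<phi> y * complex_of_real (?F n y))"
      unfolding fejer_eq_integral[OF \<phi>] integral_fejer_kernel[OF n] by (simp add: field_simps)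
    also have "\<dots> = (LINT y|TM. (\<phi> x - \<phi> y) * complex_of_real (?F n y))"
      using integrable_mult_fejer_kernel[OF L2_integrable[OF \<phi>]]
        integrable_mult_fejer_kernel[OF L2_integrable[OF L2_const]]
      by (simp add: left_diff_distrib)
    finally have "(2 * pi)\<^sup>2 * cmod (\<phi> x - fejer n \<phi> x) =
       cmod (LINT y|TM. (\<phi> x - \<phi> y) * complex_of_real (?F n y))"
      by (metis norm_mult norm_of_real abs_of_nonneg zero_le_power2)
    also have "\<dots> \<le> (LINT y|TM. cmod ((\<phi> x - \<phi> y) * complex_of_real (?F n y)))"
      by (rule integral_norm_bound)
    also have "\<dots> \<le> (LINT y|TM. (\<Sum>i\<in>UNIV. C * ((1 - cos (x $ i - y $ i)) * ?F n y)))"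
    proof (rule integral_mono[OF integrable_norm[OF int]])
      show "integrable TM (\<lambda>y. \<Sum>i\<in>UNIV. C * ((1 - cos (x $ i - y $ i)) * ?F n y))"
        by (intro integrable_TM_continuous continuous_intros continuous_fejer_kernel)
      fix y assume "y \<in> space TM"
      then have "cmod (\<phi> x - \<phi> y) * ?F n y \<le> C * (\<Sum>i\<in>UNIV. 1 - cos (x $ i - y $ i)) * ?F n y"
        using C by (intro mult_right_mono fejer_kernel_nonneg) auto
      then show "cmod ((\<phi> x - \<phi> y) * complex_of_real (?F n y)) \<le> (\<Sum>i\<in>UNIV. C * ((1 - cos (x $ i - y $ i)) * ?F n y))"
        using fejer_kernel_nonneg[of n "x - y"]
        by (simp add: norm_mult sum_distrib_left sum_distrib_right mult.assoc)
    qed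
    also have "\<dots> = (\<Sum>i\<in>UNIV. C * (LINT y|TM. (1 - cos (x $ i - y $ i)) * ?F n y))"
      by (subst Bochner_Integration.integral_sum)
         (auto intro!: integrable_TM_continuous continuous_intros continuous_fejer_kernel)
    also have "\<dots> = (2 * pi)\<^sup>2 * (C * (\<Sum>i\<in>UNIV. 1 - fejer_weight n (axis i 1)))"
      unfolding integral_cos_fejer_kernel[OF n] by (simp only: sum_distrib_left mult_ac)
    finally show ?thesis by (rule mult_left_le_imp_le) simp
  qed
  have lim: "(\<lambda>n. C * (\<Sum>i\<in>UNIV. 1 - fejer_weight n (axis i 1))) \<longlonglongrightarrow> C * (\<Sum>i\<in>(UNIV :: 2 set). 1 - 1)"
    by (intro tendsto_intros fejer_weight_tendsto)
  have "(\<lambda>n. cmod (\<phi> x - fejer n \<phi> x)) \<longlonglongrightarrow> 0"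
    by (rule tendsto_sandwich[OF _ eventually_mono[OF eventually_gt_at_top[of 0]] tendsto_const])
       (use bound lim in auto)
  then show ?thesis
    by (subst tendsto_iff) (simp add: tendsto_iff dist_norm norm_minus_commute)
qed

lemma indicator_L2 [simp]: "A \<in> sets borel \<Longrightarrow> (\<lambda>x. complex_of_real (indicator A x)) \<in> L2"
  by (rule L2_bounded[of _ 1]) (auto simp: indicator_def)

lemma fejer_norm_le_1:
  assumes "\<phi> \<in> L2" "\<And>x. cmod (\<phi> x) \<le> 1" "n > 0"
  shows "cmod (fejer n \<phi> x) \<le> 1"
proof -
  have "(LINT y|TM. complex_of_real (fejer_kernel n (x - y))) = complex_of_real (LINT y|TM. fejer_kernel n (x - y))"
    by (rule integral_complex_of_real)
  then have F: "(LINT y|TM. fejer_kernel n (x - y)) = (2 * pi)\<^sup>2"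
    using integral_fejer_kernel[OF assms(3), of x] by (simp only: of_real_eq_iff)
  have "cmod (LINT y|TM. \<phi> y * complex_of_real (fejer_kernel n (x - y))) \<le>
      (LINT y|TM. cmod (\<phi> y * complex_of_real (fejer_kernel n (x - y))))"
    by (rule integral_norm_bound)
  also have "\<dots> \<le> (LINT y|TM. fejer_kernel n (x - y))"
  proof (rule integral_mono)
    show "integrable TM (\<lambda>y. cmod (\<phi> y * complex_of_real (fejer_kernel n (x - y))))"
      by (intro integrable_norm integrable_mult_fejer_kernel L2_integrable assms)
    show "integrable TM (\<lambda>y. fejer_kernel n (x - y))"
      by (intro integrable_TM_continuous continuous_intros continuous_fejer_kernel)
    show "cmod (\<phi> y * complex_of_real (fejer_kernel n (x - y))) \<le> fejer_kernel n (x - y)" for y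
      using assms(2)[of y] fejer_kernel_nonneg[of n "x - y"]
      by (simp add: norm_mult mult_left_le_one_le)
  qed
  finally show ?thesis
    unfolding fejer_eq_integral[OF assms(1)] F by (simp add: norm_divide norm_mult norm_power divide_le_eq)
qed

text \<open>Off its frontier the indicator is constant near \<open>x\<close>. Away from that
  neighbourhood the sum of the \<open>1 - cos\<close> terms has a positive minimum by compactness,
  because an interior point of the cell is not congruent to any other point of the closed
  cell.\<close>

lemma box_locally_const:
  assumes x: "x \<in> torus" "x \<notin> frontier A"
  shows "\<exists>C. \<forall>y\<in>torus. cmod (complex_of_real (indicator A x) - complex_of_real (indicator A y)) \<le>
    C * (\<Sum>i\<in>UNIV. 1 - cos (x $ i - y $ i))"
proof -
  obtain d where d: "d > 0" "\<And>y. dist y x < d \<Longrightarrow> (y \<in> A \<longleftrightarrow> x \<in> A)"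
  proof -
    have "x \<in> interior A \<or> x \<in> interior (- A)"
      using x(2) by (auto simp: frontier_def interior_complement)
    then show thesis
    proof
      assume "x \<in> interior A"
      then obtain e where "e > 0" "ball x e \<subseteq> A" using mem_interior by blast
      then show thesis using that[of e] by (auto simp: subset_iff dist_commute)
    next
      assume "x \<in> interior (- A)"
      then obtain e where "e > 0" "ball x e \<subseteq> - A" using mem_interior by blast
      then show thesis using that[of e] by (auto simp: subset_iff dist_commute)
    qed
  qed
  define g where "g = (\<lambda>y :: real^2. \<Sum>i\<in>UNIV. 1 - cos (x $ i - y $ i))"
  define K where "K = cbox (\<chi> i. - pi) (\<chi> i. pi) - ball x d"
  have gpos: "g y > 0" if "y \<in> K" for y
  proof -
    have "y \<noteq> x" using that d(1) by (auto simp: K_def)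
    then obtain i where i: "y $ i \<noteq> x $ i" by (auto simp: vec_eq_iff)
    have "- pi < x $ i" "x $ i < pi" "- pi \<le> y $ i" "y $ i \<le> pi"
      using x(1) that by (auto simp: mem_torus K_def mem_box_cart)
    then have abs: "\<bar>x $ i - y $ i\<bar> < 2 * pi" "x $ i - y $ i \<noteq> 0" using i by auto
    have "cos (x $ i - y $ i) \<noteq> 1"
    proof
      assume "cos (x $ i - y $ i) = 1"
      then obtain m :: int where m: "x $ i - y $ i = of_int m * 2 * pi" by (auto simp: cos_one_2pi_int)
      then have "m \<noteq> 0" using \<open>x $ i - y $ i \<noteq> 0\<close> by auto
      then have "1 \<le> \<bar>real_of_int m\<bar>" by linarith
      then have "2 * pi \<le> \<bar>real_of_int m\<bar> * (2 * pi)" using pi_gt_zero by (simp add: mult_le_cancel_right1)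
      also have "\<dots> = \<bar>x $ i - y $ i\<bar>" unfolding m by (simp add: abs_mult)
      finally show False using \<open>\<bar>x $ i - y $ i\<bar> < 2 * pi\<close> by simp
    qed
    then have "1 - cos (x $ i - y $ i) > 0" using cos_le_one[of "x $ i - y $ i"] by linarith
    then show ?thesis unfolding g_def by (intro sum_pos2[of _ i]) auto
  qed
  show ?thesis
  proof (cases "K = {}")
    case True
    then have "dist y x < d" if "y \<in> torus" for y
      using that by (auto simp: K_def torus_def dist_commute dest: box_subset_cbox[THEN subsetD])
    then have "indicator A y = (indicator A x :: real)" if "y \<in> torus" for y
      using d(2)[of y] that by (auto simp: indicator_def)
    then show ?thesis by (intro exI[of _ 0]) simp
  next
    case False
    have "compact K" unfolding K_def by (intro compact_diff compact_cbox open_ball)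
    moreover have "continuous_on K g" unfolding g_def by (intro continuous_intros)
    ultimately obtain y0 where y0: "y0 \<in> K" "\<And>y. y \<in> K \<Longrightarrow> g y0 \<le> g y"
      using continuous_attains_inf[of K g] False by blast
    have g0: "g y \<ge> 0" for y unfolding g_def by (intro sum_nonneg) auto
    show ?thesis
    \<comment> \<open>The reciprocal of the minimum of \<open>g\<close> over \<open>K\<close>, since
      two indicator values differ by at most 1.\<close>
    proof (intro exI[of _ "1 / g y0"] ballI)
      fix y assume y: "y \<in> torus"
      have "cmod (complex_of_real (indicator A x) - complex_of_real (indicator A y)) \<le> 1 / g y0 * g y"
      proof (cases "dist y x < d")
        case True
        then have "indicator A y = (indicator A x :: real)" using d(2)[of y] by (auto simp: indicator_def)
        then show ?thesis using g0[of y] g0[of y0] by simp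
      next
        case False
        then have "y \<in> K" using y by (auto simp: K_def torus_def dist_commute dest: box_subset_cbox[THEN subsetD])
        then have "1 \<le> 1 / g y0 * g y" using y0 gpos[OF y0(1)] by simp
        moreover have "cmod (complex_of_real (indicator A x) - complex_of_real (indicator A y)) \<le> 1"
          by (auto simp: indicator_def)
        ultimately show ?thesis by linarith
      qed
      then show "cmod (complex_of_real (indicator A x) - complex_of_real (indicator A y)) \<le>
        1 / g y0 * (\<Sum>i\<in>UNIV. 1 - cos (x $ i - y $ i))" by (simp add: g_def)
    qed
  qed
qed

lemma sqnorm_dominated_convergence:
  assumes "\<And>n. \<psi> n \<in> L2" "\<chi>' \<in> L2"
    and "\<And>n x. x \<in> torus \<Longrightarrow> cmod (\<psi> n x) \<le> cmod (\<chi>' x)"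
    and "AE x in TM. (\<lambda>n. \<psi> n x) \<longlonglongrightarrow> 0"
  shows "(\<lambda>n. sqnorm (\<psi> n)) \<longlonglongrightarrow> 0"
proof -
  have "(\<lambda>n. LINT x|TM. (cmod (\<psi> n x))\<^sup>2) \<longlonglongrightarrow> (LINT x|TM. 0)"
  proof (rule integral_dominated_convergence)
    show "integrable TM (\<lambda>x. (cmod (\<chi>' x))\<^sup>2)" using assms(2) by (rule L2_D)
    show "(\<lambda>x. (cmod (\<psi> n x))\<^sup>2) \<in> borel_measurable TM" for n
      using L2_D(2)[OF assms(1)] by auto
    show "AE x in TM. norm ((cmod (\<psi> n x))\<^sup>2) \<le> (cmod (\<chi>' x))\<^sup>2" for n
      using assms(3) by (intro AE_I2) (auto intro: power_mono)
    show "AE x in TM. (\<lambda>n. (cmod (\<psi> n x))\<^sup>2) \<longlonglongrightarrow> 0"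
      using assms(4)
    proof eventually_elim
      case (elim x)
      then have "(\<lambda>n. (cmod (\<psi> n x))\<^sup>2) \<longlonglongrightarrow> (cmod 0)\<^sup>2" by (intro tendsto_intros)
      then show ?case by simp
    qed
  qed auto
  then show ?thesis by (simp add: sqnorm_def)
qed

text \<open>The frontier of a box is a null set, the means converge pointwise off it, and they are
  bounded by 1, so dominated convergence applies. The index \<open>Suc n\<close> skips the
  degenerate mean of order 0.\<close>

lemma fejer_conv_box: "fejer_conv (\<lambda>x. complex_of_real (indicator (box a b) x))"
proof -
  let ?\<phi> = "\<lambda>x. complex_of_real (indicator (box a b) x)"
  have "frontier (box a b) \<in> null_sets lborel"
    using negligible_convex_frontier[OF convex_box(2), of a b]
    unfolding negligible_iff_null_sets by (subst (asm) null_sets_completion_iff) auto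
  then have "AE x in lborel. x \<notin> frontier (box a b)" by (rule AE_not_in)
  then have ae: "AE x in TM. x \<notin> frontier (box a b)" by (rule AE_TM)
  have "(\<lambda>n. sqnorm (\<lambda>x. ?\<phi> x - fejer (Suc n) ?\<phi> x)) \<longlonglongrightarrow> 0"
  proof (rule sqnorm_dominated_convergence[where \<chi>'="\<lambda>_. 2"])
    show "(\<lambda>x. ?\<phi> x - fejer (Suc n) ?\<phi> x) \<in> L2" for n
      by (intro L2_diff fejer_L2 indicator_L2) auto
    show "cmod (?\<phi> x - fejer (Suc n) ?\<phi> x) \<le> cmod 2" for n x
    proof -
      have "cmod (fejer (Suc n) ?\<phi> x) \<le> 1" by (rule fejer_norm_le_1, rule indicator_L2) (auto simp: indicator_def)
      moreover have "cmod (?\<phi> x) \<le> 1" by (auto simp: indicator_def)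
      ultimately show ?thesis using norm_triangle_ineq4[of "?\<phi> x" "fejer (Suc n) ?\<phi> x"]
        unfolding norm_numeral by linarith
    qed
    show "AE x in TM. (\<lambda>n. ?\<phi> x - fejer (Suc n) ?\<phi> x) \<longlonglongrightarrow> 0"
      using ae AE_space
    proof eventually_elim
      case (elim x)
      then obtain C where "\<forall>y\<in>torus. cmod (?\<phi> x - ?\<phi> y) \<le> C * (\<Sum>i\<in>UNIV. 1 - cos (x $ i - y $ i))"
        using box_locally_const[of x "box a b"] by auto
      then have "(\<lambda>n. fejer n ?\<phi> x) \<longlonglongrightarrow> ?\<phi> x" by (intro fejer_pointwise indicator_L2) auto
      then have "(\<lambda>n. ?\<phi> x - fejer (Suc n) ?\<phi> x) \<longlonglongrightarrow> ?\<phi> x - ?\<phi> x"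
        by (intro tendsto_diff tendsto_const LIMSEQ_Suc)
      then show ?case by simp
    qed
  qed simp
  then show ?thesis unfolding fejer_conv_def by (rule LIMSEQ_imp_Suc)
qed

text \<open>A Dynkin argument: boxes form an intersection-stable generator, complements follow by
  linearity, and countable disjoint unions by closedness under mean-square limits.\<close>

lemma fejer_conv_indicator:
  assumes "A \<in> sets borel"
  shows "fejer_conv (\<lambda>x. complex_of_real (indicator A x))"
proof -
  have sets: "sets borel = sigma_sets UNIV (range (\<lambda>(a, b). box a b :: (real^2) set))"
    by (simp add: borel_eq_box)
  have "Int_stable (range (\<lambda>(a, b). box a b :: (real^2) set))"
    by (auto simp: Int_stable_def box_Int_box)
  moreover have "range (\<lambda>(a, b). box a b :: (real^2) set) \<subseteq> Pow UNIV" by simp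
  moreover have "A \<in> sigma_sets UNIV (range (\<lambda>(a, b). box a b :: (real^2) set))"
    using assms sets by simp
  ultimately show ?thesis
  proof (induction rule: sigma_sets_induct_disjoint)
    case (basic A)
    then show ?case using fejer_conv_box by auto
  next
    case empty
    then show ?case using fejer_conv_const[of 0] by simp
  next
    case (compl A)
    then have "A \<in> sets borel" by (simp add: sets)
    then have "fejer_conv (\<lambda>x. 1 + (-1) * complex_of_real (indicator A x))"
      using compl by (intro fejer_conv_add fejer_conv_cmult fejer_conv_const L2_cmult indicator_L2 L2_const) auto
    moreover have "(\<lambda>x. 1 + (-1) * complex_of_real (indicator A x)) = (\<lambda>x. complex_of_real (indicator (UNIV - A) x))"
      by (auto simp: fun_eq_iff indicator_def)
    ultimately show ?case by simp
  next
    case (union A)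
    have Ab: "A i \<in> sets borel" for i using union(2) by (auto simp: sets)
    let ?U = "\<Union>i. A i"
    let ?\<phi> = "\<lambda>x. complex_of_real (indicator ?U x)"
    let ?\<psi> = "\<lambda>N x. \<Sum>i<N. complex_of_real (indicator (A i) x)"
    have \<psi>: "?\<psi> N \<in> L2 \<and> fejer_conv (?\<psi> N)" for N
      using Ab union(3) by (intro fejer_conv_sum) auto
    have U: "?U \<in> sets borel" using Ab by auto
    have eq: "?\<psi> N x = complex_of_real (indicator (\<Union>i<N. A i) x)" for N x
    proof -
      have "disjoint_family_on A {..<N}" using union(1) by (rule disjoint_family_on_mono[rotated]) simp
      then show ?thesis by (simp add: indicator_UN_disjoint flip: of_real_sum)
    qed
    have lim: "(\<lambda>N. sqnorm (\<lambda>x. ?\<phi> x - ?\<psi> N x)) \<longlonglongrightarrow> 0"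
    proof (rule sqnorm_dominated_convergence[where \<chi>'="\<lambda>_. 1"])
      show "(\<lambda>x. ?\<phi> x - ?\<psi> N x) \<in> L2" for N using U \<psi> by (intro L2_diff indicator_L2) auto
      show "cmod (?\<phi> x - ?\<psi> N x) \<le> cmod 1" for N x
        unfolding eq by (auto simp: indicator_def)
      show "AE x in TM. (\<lambda>N. ?\<phi> x - ?\<psi> N x) \<longlonglongrightarrow> 0"
      proof (intro AE_I2)
        fix x
        have "eventually (\<lambda>N. ?\<phi> x - ?\<psi> N x = 0) sequentially"
        proof (cases "x \<in> ?U")
          case True
          then obtain i where "x \<in> A i" by auto
          then show ?thesis unfolding eq
            by (intro eventually_mono[OF eventually_gt_at_top[of i]]) (auto simp: indicator_def)
        qed (auto simp: eq indicator_def)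
        then show "(\<lambda>N. ?\<phi> x - ?\<psi> N x) \<longlonglongrightarrow> 0" by (rule tendsto_eventually)
      qed
    qed simp
    show ?case
    proof (rule fejer_conv_limit)
      show "?\<phi> \<in> L2" using U by simp
      fix \<epsilon> :: real assume "\<epsilon> > 0"
      then obtain N where "sqnorm (\<lambda>x. ?\<phi> x - ?\<psi> N x) < \<epsilon>"
        using LIMSEQ_D[OF lim, of \<epsilon>] sqnorm_nonneg by auto
      then show "\<exists>\<psi>\<in>L2. fejer_conv \<psi> \<and> sqnorm (\<lambda>x. ?\<phi> x - \<psi> x) < \<epsilon>" using \<psi> by blast
    qed
  qed
qed

text \<open>Approximation by simple functions bounded by \<open>2 * cmod (\<phi> x)\<close>, whence
  the majorant \<open>3 * \<phi> x\<close>; simple functions are covered by linearity from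
  indicators.\<close>

theorem L2_fejer_conv:
  assumes \<phi>: "\<phi> \<in> L2"
  shows "fejer_conv \<phi>"
proof -
  obtain s where s: "\<And>i. simple_function borel (s i)" "\<And>x. (\<lambda>i. s i x) \<longlonglongrightarrow> \<phi> x"
      "\<And>i x. cmod (s i x) \<le> 2 * cmod (\<phi> x)"
    using borel_measurable_implies_sequence_metric[OF L2_D(1)[OF \<phi>], of 0] by auto
  have conv: "fejer_conv (s i)" and sL2: "s i \<in> L2" for i
  proof -
    have fin: "finite (range (s i))" using simple_functionD(1)[OF s(1)[of i]] by simp
    have meas: "s i -` {y} \<in> sets borel" for y using simple_functionD(2)[OF s(1)[of i], of "{y}"] by simp
    have "s i x = (\<Sum>y\<in>range (s i). y * complex_of_real (indicator (s i -` {y}) x))" for x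
    proof -
      have "(\<Sum>y\<in>range (s i). y * complex_of_real (indicator (s i -` {y}) x)) =
        (\<Sum>y\<in>range (s i). if y = s i x then y else 0)"
        by (intro sum.cong) (auto simp: indicator_def)
      then show ?thesis using fin by simp
    qed
    then have eq: "s i = (\<lambda>x. \<Sum>y\<in>range (s i). y * complex_of_real (indicator (s i -` {y}) x))" by blast
    have "(\<lambda>x. \<Sum>y\<in>range (s i). y * complex_of_real (indicator (s i -` {y}) x)) \<in> L2 \<and>
       fejer_conv (\<lambda>x. \<Sum>y\<in>range (s i). y * complex_of_real (indicator (s i -` {y}) x))"
      using fin meas by (intro fejer_conv_sum) (auto intro!: L2_cmult fejer_conv_cmult fejer_conv_indicator)
    then show "fejer_conv (s i)" "s i \<in> L2" using eq by auto
  qed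
  have lim: "(\<lambda>i. sqnorm (\<lambda>x. \<phi> x - s i x)) \<longlonglongrightarrow> 0"
  proof (rule sqnorm_dominated_convergence[where \<chi>'="\<lambda>x. 3 * \<phi> x"])
    show "(\<lambda>x. \<phi> x - s i x) \<in> L2" for i using \<phi> sL2 by (intro L2_diff)
    show "(\<lambda>x. 3 * \<phi> x) \<in> L2" using \<phi> by (rule L2_cmult)
    show "cmod (\<phi> x - s i x) \<le> cmod (3 * \<phi> x)" for i x
      using norm_triangle_ineq4[of "\<phi> x" "s i x"] s(3)[of i x] by (simp add: norm_mult)
    have "(\<lambda>i. \<phi> x - s i x) \<longlonglongrightarrow> \<phi> x - \<phi> x" for x by (intro tendsto_intros s(2))
    then show "AE x in TM. (\<lambda>i. \<phi> x - s i x) \<longlonglongrightarrow> 0" by simp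
  qed
  show ?thesis
  proof (rule fejer_conv_limit[OF \<phi>])
    fix \<epsilon> :: real assume "\<epsilon> > 0"
    then obtain N where "sqnorm (\<lambda>x. \<phi> x - s N x) < \<epsilon>"
      using LIMSEQ_D[OF lim, of \<epsilon>] sqnorm_nonneg by auto
    then show "\<exists>\<psi>\<in>L2. fejer_conv \<psi> \<and> sqnorm (\<lambda>x. \<phi> x - \<psi> x) < \<epsilon>" using conv sL2 by blast
  qed
qed

subsection \<open>The Gaussian measure on the plane\<close>

text \<open>The standard Gaussian, built as the image of a product measure so that Fubini and the
  one-dimensional characteristic function give its Fourier transform.\<close>

definition gauss :: "(real^2) measure" where
  "gauss = distr (std_normal_distribution \<Otimes>\<^sub>M std_normal_distribution) borel
     (\<lambda>p. \<chi> i. if i = 1 then fst p else snd p)"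

interpretation normal: prob_space std_normal_distribution
  by (rule prob_space_normal_density) simp

interpretation normal2: pair_prob_space std_normal_distribution std_normal_distribution ..

lemma measurable_pair_vec:
  "(\<lambda>p. \<chi> i. if i = 1 then fst p else snd p :: real^2) \<in>
    measurable (std_normal_distribution \<Otimes>\<^sub>M std_normal_distribution) borel"
proof (rule borel_measurable_euclidean_space[THEN iffD2], intro ballI)
  fix b :: "real^2" assume "b \<in> Basis"
  then obtain i where b: "b = axis i 1" by (auto simp: Basis_vec_def)
  show "(\<lambda>p. (\<chi> i. if i = 1 then fst p else snd p) \<bullet> b) \<in>
      borel_measurable (std_normal_distribution \<Otimes>\<^sub>M std_normal_distribution)"
    unfolding b inner_axis by (cases "i = 1") auto
qed

interpretation gauss: prob_space gauss
  unfolding gauss_def by (rule normal2.prob_space_distr[OF measurable_pair_vec])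

lemma sets_gauss [measurable_cong, simp]: "sets gauss = sets borel"
  by (simp add: gauss_def)

lemma space_gauss [simp]: "space gauss = UNIV"
  by (simp add: gauss_def)

lemma measurable_gauss: "f \<in> borel_measurable gauss \<longleftrightarrow> f \<in> borel_measurable borel"
  by (simp cong: measurable_cong_sets)

lemma integral_gauss_product:
  fixes f g :: "real \<Rightarrow> complex"
  assumes f: "integrable std_normal_distribution f" and g: "integrable std_normal_distribution g"
  shows "integrable gauss (\<lambda>z. f (z $ 1) * g (z $ 2))"
    and "(LINT z|gauss. f (z $ 1) * g (z $ 2)) = (LINT x|std_normal_distribution. f x) * (LINT y|std_normal_distribution. g y)"
proof -
  let ?N = std_normal_distribution
  have meas: "f \<in> borel_measurable borel" "g \<in> borel_measurable borel"
    using f g by (auto dest: borel_measurable_integrable)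
  have int: "integrable (?N \<Otimes>\<^sub>M ?N) (\<lambda>p. f (fst p) * g (snd p))"
  proof (rule normal2.Fubini_integrable)
    show "(\<lambda>p. f (fst p) * g (snd p)) \<in> borel_measurable (?N \<Otimes>\<^sub>M ?N)"
      using meas by measurable
    show "integrable ?N (\<lambda>x. LINT y|?N. norm (f (fst (x, y)) * g (snd (x, y))))"
      using f by (simp add: norm_mult integrable_norm)
    show "AE x in ?N. integrable ?N (\<lambda>y. f (fst (x, y)) * g (snd (x, y)))"
      using g by simp
  qed
  have meas': "(\<lambda>z. f (z $ 1) * g (z $ 2)) \<in> borel_measurable (borel :: (real^2) measure)"
    using meas by measurable
  show "integrable gauss (\<lambda>z. f (z $ 1) * g (z $ 2))"
    unfolding gauss_def by (subst integrable_distr_eq[OF measurable_pair_vec meas']) (use int in simp)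
  have "(LINT z|gauss. f (z $ 1) * g (z $ 2)) = (LINT p|(?N \<Otimes>\<^sub>M ?N). f (fst p) * g (snd p))"
    unfolding gauss_def by (subst integral_distr[OF measurable_pair_vec meas']) simp
  also have "\<dots> = (LINT x|?N. (LINT y|?N. f x * g y))"
    using normal2.integral_fst'[OF int] by simp
  also have "\<dots> = (LINT x|?N. f x) * (LINT y|?N. g y)"
    by simp
  finally show "(LINT z|gauss. f (z $ 1) * g (z $ 2)) = (LINT x|?N. f x) * (LINT y|?N. g y)" .
qed

lemma integrable_normal_bounded:
  fixes f :: "real \<Rightarrow> complex"
  assumes "f \<in> borel_measurable borel" "\<And>x. cmod (f x) \<le> 1 + \<bar>x\<bar> ^ m"
  shows "integrable std_normal_distribution f"
proof (rule Bochner_Integration.integrable_bound)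
  have "integrable std_normal_distribution (\<lambda>x. \<bar>x ^ m\<bar>)"
    using integrable_norm[OF integrable_std_normal_distribution_moment[of m]] by simp
  then show "integrable std_normal_distribution (\<lambda>x. 1 + \<bar>x\<bar> ^ m)" by (simp add: power_abs)
qed (use assms in \<open>auto intro: order_trans[OF _ abs_ge_self]\<close>)

lemma normal_char: "(LINT x|std_normal_distribution. cis (t * x)) = complex_of_real (exp (- t\<^sup>2 / 2))"
  using fun_cong[OF char_std_normal_distribution, of t]
  by (simp add: char_def cis_conv_exp)

lemma std_normal_density_tendsto_0:
  "(std_normal_density \<longlongrightarrow> 0) at_top" "(std_normal_density \<longlongrightarrow> 0) at_bot"
proof -
  have *: "filterlim (\<lambda>x::real. - x\<^sup>2 / 2) at_bot F" if F: "filterlim (\<lambda>x. x\<^sup>2) at_top F" for F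
  proof -
    have "filterlim (\<lambda>x. - (x\<^sup>2 * (1 / 2))) at_bot F"
      by (intro filterlim_uminus_at_top[THEN iffD1] filterlim_at_top_mult_tendsto_pos[OF tendsto_const _ F]) auto
    then show ?thesis by simp
  qed
  have e: "((\<lambda>x. exp (- x\<^sup>2 / 2)) \<longlongrightarrow> 0) F" if "filterlim (\<lambda>x::real. x\<^sup>2) at_top F" for F
    by (rule filterlim_compose[OF exp_at_bot *[OF that]])
  have top: "filterlim (\<lambda>x::real. x\<^sup>2) at_top at_top"
    by (rule filterlim_pow_at_top) (auto intro: filterlim_ident)
  have bot: "filterlim (\<lambda>x::real. x\<^sup>2) at_top at_bot"
    by (rule filterlim_pow_at_bot_even) (auto intro: filterlim_ident)
  show "(std_normal_density \<longlongrightarrow> 0) at_top" "(std_normal_density \<longlongrightarrow> 0) at_bot"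
    unfolding std_normal_density_def[abs_def]
    using tendsto_mult_right_zero[OF e[OF top], of "1 / sqrt (2 * pi)"]
      tendsto_mult_right_zero[OF e[OF bot], of "1 / sqrt (2 * pi)"] by auto
qed

text \<open>Integration by parts for the normal density: the product of the density with
  \<open>cis (t * x)\<close> vanishes at both ends, and its derivative is the density times
  \<open>(\<i> * t - x) * cis (t * x)\<close>.\<close>

lemma normal_char_moment:
  "(LINT x|std_normal_distribution. complex_of_real x * cis (t * x)) =
     \<i> * t * complex_of_real (exp (- t\<^sup>2 / 2))"
proof -
  define F where "F = (\<lambda>x. complex_of_real (std_normal_density x) * cis (t * x))"
  define f where "f = (\<lambda>x. complex_of_real (std_normal_density x) * ((\<i> * t - x) * cis (t * x)))"
  have int1: "integrable std_normal_distribution (\<lambda>x. cis (t * x))"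
    by (rule integrable_normal_bounded[of _ 0]) (auto intro!: borel_measurable_continuous_onI continuous_intros)
  have int2: "integrable std_normal_distribution (\<lambda>x. complex_of_real x * cis (t * x))"
    by (rule integrable_normal_bounded[of _ 1])
       (auto intro!: borel_measurable_continuous_onI continuous_intros simp: norm_mult)
  have dens: "integrable lborel (\<lambda>x. complex_of_real (std_normal_density x) * h x)"
     "(LINT x|lborel. complex_of_real (std_normal_density x) * h x) = (LINT x|std_normal_distribution. h x)"
    if "integrable std_normal_distribution h" for h :: "real \<Rightarrow> complex"
  proof -
    have m: "h \<in> borel_measurable lborel" using borel_measurable_integrable[OF that] by simp
    show "integrable lborel (\<lambda>x. complex_of_real (std_normal_density x) * h x)"
      using that m by (subst (asm) integrable_density) (auto simp: scaleR_conv_of_real)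
    show "(LINT x|lborel. complex_of_real (std_normal_density x) * h x) = (LINT x|std_normal_distribution. h x)"
      using m by (subst integral_density) (auto simp: scaleR_conv_of_real)
  qed
  have inth: "integrable std_normal_distribution (\<lambda>x. (\<i> * t - x) * cis (t * x))"
    using int1 int2 by (simp add: left_diff_distrib)
  have deriv: "(std_normal_density has_real_derivative - x * std_normal_density x) (at x)" for x
  proof -
    have "((\<lambda>x. exp (- x\<^sup>2 / 2)) has_real_derivative - x * exp (- x\<^sup>2 / 2)) (at x)"
      by (auto intro!: derivative_eq_intros)
    from DERIV_cmult[OF this, of "1 / sqrt (2 * pi)"] show ?thesis
      unfolding std_normal_density_def[abs_def] by (simp add: mult_ac)
  qed
  have Fd: "(F has_vector_derivative f x) (at x)" for x
  proof -
    have 1: "((\<lambda>x. complex_of_real (std_normal_density x)) has_vector_derivative complex_of_real (- x * std_normal_density x)) (at x)"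
      by (rule has_vector_derivative_of_real[OF deriv])
    have "((\<lambda>x. exp (\<i> * t * x)) has_vector_derivative \<i> * t * exp (\<i> * t * x)) (at x)" for x :: real
      by (auto intro!: derivative_eq_intros has_vector_derivative_real_field)
    then have 2: "((\<lambda>x. cis (t * x)) has_vector_derivative \<i> * t * cis (t * x)) (at x)"
      by (simp only: cis_conv_exp of_real_mult mult.assoc)
    show ?thesis unfolding F_def f_def
      using has_vector_derivative_mult[OF 1 2] by (simp add: algebra_simps)
  qed
  have "(LBINT x=-\<infinity>..\<infinity>. f x) = 0 - 0"
  proof (rule interval_integral_FTC_integrable[OF _ Fd])
    show "isCont f x" for x unfolding f_def std_normal_density_def[abs_def] cis_conv_exp
      by (intro continuous_intros) auto
    show "set_integrable lborel (einterval (- \<infinity>) \<infinity>) f"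
      using dens(1)[OF inth] by (simp add: set_integrable_def f_def)
    have lim: "(F \<longlongrightarrow> 0) G" if "(std_normal_density \<longlongrightarrow> 0) G" for G
      by (rule Lim_null_comparison[OF _ that]) (auto simp: F_def norm_mult)
    show "((F \<circ> real_of_ereal) \<longlongrightarrow> 0) (at_right (- \<infinity>))"
      unfolding ereal_tendsto_simps1 by (rule lim[OF std_normal_density_tendsto_0(2)])
    show "((F \<circ> real_of_ereal) \<longlongrightarrow> 0) (at_left \<infinity>)"
      unfolding ereal_tendsto_simps1 by (rule lim[OF std_normal_density_tendsto_0(1)])
  qed auto
  then have "(LINT x|lborel. f x) = 0"
    by (simp add: interval_lebesgue_integral_def set_lebesgue_integral_def)
  then have "(LINT x|std_normal_distribution. (\<i> * t - x) * cis (t * x)) = 0"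
    using dens(2)[OF inth] by (simp add: f_def)
  then have "\<i> * t * (LINT x|std_normal_distribution. cis (t * x)) -
      (LINT x|std_normal_distribution. complex_of_real x * cis (t * x)) = 0"
    using int1 int2 by (simp add: left_diff_distrib)
  then show ?thesis by (simp add: normal_char)
qed

lemma norm_vec2: "(norm (z :: real^2))\<^sup>2 = (z $ 1)\<^sup>2 + (z $ 2)\<^sup>2"
  unfolding power2_norm_eq_inner inner_vec_def by (simp add: sum_2 power2_eq_square)

lemma integral_gauss_cis:
  "(LINT z|gauss. cis (\<xi> \<bullet> z)) = complex_of_real (exp (- (norm \<xi>)\<^sup>2 / 2))"
  and integral_gauss_moment:
  "(LINT z|gauss. complex_of_real (z $ j) * cis (\<xi> \<bullet> z)) =
     \<i> * \<xi> $ j * complex_of_real (exp (- (norm \<xi>)\<^sup>2 / 2))"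
proof -
  have cis: "cis (\<xi> \<bullet> z) = cis (\<xi> $ 1 * z $ 1) * cis (\<xi> $ 2 * z $ 2)" for z
    by (simp add: inner_vec_def sum_2 cis_mult)
  have ex: "complex_of_real (exp (- (norm \<xi>)\<^sup>2 / 2)) =
     complex_of_real (exp (- (\<xi> $ 1)\<^sup>2 / 2)) * complex_of_real (exp (- (\<xi> $ 2)\<^sup>2 / 2))"
    by (simp add: norm_vec2 mult_exp_exp add_divide_distrib flip: of_real_mult)
  have int1: "integrable std_normal_distribution (\<lambda>x. cis (t * x))" for t
    by (rule integrable_normal_bounded[of _ 0]) (auto intro!: borel_measurable_continuous_onI continuous_intros)
  have int2: "integrable std_normal_distribution (\<lambda>x. complex_of_real x * cis (t * x))" for t
    by (rule integrable_normal_bounded[of _ 1])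
       (auto intro!: borel_measurable_continuous_onI continuous_intros simp: norm_mult)
  show "(LINT z|gauss. cis (\<xi> \<bullet> z)) = complex_of_real (exp (- (norm \<xi>)\<^sup>2 / 2))"
    unfolding cis ex by (subst integral_gauss_product(2)[OF int1 int1]) (simp only: normal_char)
  have "j = 1 \<or> j = 2" using exhaust_2 by auto
  then show "(LINT z|gauss. complex_of_real (z $ j) * cis (\<xi> \<bullet> z)) =
     \<i> * \<xi> $ j * complex_of_real (exp (- (norm \<xi>)\<^sup>2 / 2))"
  proof
    assume j: "j = 1"
    have "(LINT z|gauss. complex_of_real (z $ j) * cis (\<xi> \<bullet> z)) =
      (LINT z|gauss. (complex_of_real (z $ 1) * cis (\<xi> $ 1 * z $ 1)) * cis (\<xi> $ 2 * z $ 2))"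
      unfolding cis j by (simp only: mult.assoc)
    also have "\<dots> = \<i> * \<xi> $ 1 * complex_of_real (exp (- (\<xi> $ 1)\<^sup>2 / 2)) * complex_of_real (exp (- (\<xi> $ 2)\<^sup>2 / 2))"
      by (subst integral_gauss_product(2)[OF int2 int1]) (simp only: normal_char normal_char_moment)
    finally show ?thesis unfolding ex j by (simp only: mult.assoc)
  next
    assume j: "j = 2"
    have "(LINT z|gauss. complex_of_real (z $ j) * cis (\<xi> \<bullet> z)) =
      (LINT z|gauss. cis (\<xi> $ 1 * z $ 1) * (complex_of_real (z $ 2) * cis (\<xi> $ 2 * z $ 2)))"
      unfolding cis j by (simp only: mult_ac)
    also have "\<dots> = complex_of_real (exp (- (\<xi> $ 1)\<^sup>2 / 2)) * (\<i> * \<xi> $ 2 * complex_of_real (exp (- (\<xi> $ 2)\<^sup>2 / 2)))"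
      by (subst integral_gauss_product(2)[OF int1 int2]) (simp only: normal_char normal_char_moment)
    finally show ?thesis unfolding ex j by (simp only: mult_ac)
  qed
qed

lemma integrable_gauss_coord_power: "integrable gauss (\<lambda>z. (z $ i) ^ m)"
proof -
  have c: "integrable std_normal_distribution (\<lambda>x. complex_of_real x ^ m)"
    by (rule integrable_normal_bounded[of _ m])
       (auto intro!: borel_measurable_continuous_onI continuous_intros simp: norm_power)
  have 1: "integrable std_normal_distribution (\<lambda>x. 1 :: complex)" by simp
  have "i = 1 \<or> i = 2" using exhaust_2 by auto
  then have "integrable gauss (\<lambda>z. complex_of_real (z $ i) ^ m)"
    using integral_gauss_product(1)[OF c 1] integral_gauss_product(1)[OF 1 c] by auto
  then have "integrable gauss (\<lambda>z. Re (complex_of_real (z $ i) ^ m))" by (rule integrable_Re)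
  then show ?thesis by (simp flip: of_real_power)
qed

lemma integrable_gauss_norm_power: "integrable gauss (\<lambda>z. norm z ^ (2 * m))"
proof (rule Bochner_Integration.integrable_bound)
  show "integrable gauss (\<lambda>z. 2 ^ m * ((z $ 1) ^ (2 * m) + (z $ 2) ^ (2 * m)))"
    by (intro integrable_mult_right Bochner_Integration.integrable_add integrable_gauss_coord_power)
  show "(\<lambda>z. norm z ^ (2 * m)) \<in> borel_measurable gauss"
    unfolding measurable_gauss by measurable
  have "norm z ^ (2 * m) \<le> 2 ^ m * ((z $ 1) ^ (2 * m) + (z $ 2) ^ (2 * m))" for z :: "real^2"
  proof -
    define a b where "a = (z $ 1)\<^sup>2" and "b = (z $ 2)\<^sup>2"
    have ab: "a \<ge> 0" "b \<ge> 0" by (auto simp: a_def b_def)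
    have "norm z ^ (2 * m) = (a + b) ^ m" by (simp add: power_mult norm_vec2 a_def b_def)
    also have "\<dots> \<le> (2 * max a b) ^ m" using ab by (intro power_mono) auto
    also have "\<dots> = 2 ^ m * max a b ^ m" by (rule power_mult_distrib)
    also have "max a b ^ m \<le> a ^ m + b ^ m" using ab by (auto simp: max_def)
    finally show ?thesis by (simp add: a_def b_def power_mult)
  qed
  moreover have "(0::real) \<le> (x :: real) ^ (2 * m)" for x by (simp add: power_mult)
  ultimately show "AE z in gauss. norm (norm z ^ (2 * m)) \<le> norm (2 ^ m * ((z $ 1) ^ (2 * m) + (z $ 2) ^ (2 * m)))"
    by (intro AE_I2) (simp add: abs_mult)
qed

text \<open>One fixed weight of degree 8 serves every later integrand, all of growth below degree 4,
  so that a single constant \<open>gauss_moment\<close> suffices.\<close>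

lemma integrable_gauss_bounded:
  fixes f :: "real^2 \<Rightarrow> 'a::{banach, second_countable_topology}"
  assumes "f \<in> borel_measurable borel" "\<And>z. norm (f z) \<le> C * (1 + norm z ^ 8)"
  shows "integrable gauss f"
proof (rule Bochner_Integration.integrable_bound)
  show "integrable gauss (\<lambda>z. C * (1 + norm z ^ 8))"
    using integrable_gauss_norm_power[of 4] by simp
qed (use assms in \<open>auto simp: measurable_gauss intro: order_trans[OF _ abs_ge_self]\<close>)

lemma power_le_1_plus: "(x::real) \<ge> 0 \<Longrightarrow> m \<le> n \<Longrightarrow> x ^ m \<le> 1 + x ^ n"
  by (cases "x \<le> 1") (auto intro: order_trans[OF power_le_one] order_trans[OF power_increasing] simp: add_increasing2)

lemma powr_le_1_plus:
  assumes "(x::real) \<ge> 0" "0 \<le> p" "p \<le> real n"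
  shows "x powr p \<le> 1 + x ^ n"
proof (cases "x \<le> 1")
  case True
  then show ?thesis using assms powr_mono2[of p x 1] by (simp add: add_increasing2)
next
  case False
  then have "x powr p \<le> x powr real n" using assms by (intro powr_mono) auto
  also have "\<dots> = x ^ n" using False by (simp add: powr_realpow)
  finally show ?thesis by simp
qed

subsection \<open>Integrals over the half line\<close>

definition half_line_integral :: "(real \<Rightarrow> real) \<Rightarrow> real" where
  "half_line_integral F = (LINT r:{0<..}|lborel. F r)"

text \<open>The substitution \<open>\<kappa> * r\<close> for \<open>r\<close>. The homogeneous
  weight turns it into a pure power of \<kappa>, which is how powers of frequencies arise from
  integrals over scales.\<close>

lemma half_line_scaling:
  fixes F :: "real \<Rightarrow> real"
  assumes \<kappa>: "\<kappa> > 0" and int: "set_integrable lborel {0<..} (\<lambda>r. r powr (- q) * F r)"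
  shows "set_integrable lborel {0<..} (\<lambda>r. r powr (- q) * F (\<kappa> * r))"
    and "half_line_integral (\<lambda>r. r powr (- q) * F (\<kappa> * r)) =
      \<kappa> powr (q - 1) * half_line_integral (\<lambda>r. r powr (- q) * F r)"
proof -
  define H where "H = (\<lambda>r. indicator {0<..} r *\<^sub>R (r powr (- q) * F r))"
  have H: "integrable lborel H" using int by (simp add: H_def set_integrable_def)
  have eq: "indicator {0<..} r *\<^sub>R (r powr (- q) * F (\<kappa> * r)) = \<kappa> powr q * H (0 + \<kappa> * r)" for r
    using \<kappa> by (auto simp: H_def indicator_def powr_mult powr_minus zero_less_mult_iff field_simps)
  have "integrable lborel (\<lambda>r. H (0 + \<kappa> * r))"
    using lborel_integrable_real_affine[OF H, of \<kappa> 0] \<kappa> by simp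
  then show "set_integrable lborel {0<..} (\<lambda>r. r powr (- q) * F (\<kappa> * r))"
    unfolding set_integrable_def eq by simp
  have "integral\<^sup>L lborel H = \<kappa> * (LINT r|lborel. H (0 + \<kappa> * r))"
    using lborel_integral_real_affine[of \<kappa> H 0] \<kappa> by simp
  then show "half_line_integral (\<lambda>r. r powr (- q) * F (\<kappa> * r)) =
      \<kappa> powr (q - 1) * half_line_integral (\<lambda>r. r powr (- q) * F r)"
    unfolding half_line_integral_def set_lebesgue_integral_def eq
    using \<kappa> by (simp add: H_def powr_diff)
qed

lemma set_integrable_lborelI:
  fixes F :: "real \<Rightarrow> real"
  assumes "F \<in> borel_measurable borel" "S \<in> sets borel" "F integrable_on S" "\<And>x. x \<in> S \<Longrightarrow> 0 \<le> F x"
  shows "set_integrable lborel S F"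
proof -
  have "F absolutely_integrable_on S"
    using assms(3,4) by (intro nonnegative_absolutely_integrable_1) auto
  then have "integrable (completion lborel) (\<lambda>x. indicator S x *\<^sub>R F x)"
    by (simp add: set_integrable_def)
  then show ?thesis unfolding set_integrable_def
    by (subst (asm) integrable_completion) (use assms in auto)
qed

lemma set_integrable_min_powr:
  fixes p1 p2 :: real
  assumes "- 1 < p1" "p2 < - 1"
  shows "set_integrable lborel {0<..} (\<lambda>r. min (r powr p1) (r powr p2))"
proof -
  have i1: "set_integrable lborel {0..1} (\<lambda>r. r powr p1)"
    using has_integral_powr_from_0[OF assms(1), of 1]
    by (intro set_integrable_lborelI) (auto simp: integrable_on_def)
  have i2: "set_integrable lborel {1..} (\<lambda>r. r powr p2)"
    using has_integral_powr_to_inf[of p2 1] assms(2)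
    by (intro set_integrable_lborelI) (auto simp: integrable_on_def)
  have "integrable lborel (\<lambda>r. indicator {0..1} r *\<^sub>R r powr p1 + indicator {1..} r *\<^sub>R r powr p2)"
    using i1 i2 by (auto simp: set_integrable_def)
  then show ?thesis unfolding set_integrable_def
  proof (rule Bochner_Integration.integrable_bound)
    show "(\<lambda>r. indicator {0<..} r *\<^sub>R min (r powr p1) (r powr p2)) \<in> borel_measurable lborel"
      by measurable
  qed (auto simp: indicator_def)
qed

lemma set_integrable_half_line_bound:
  fixes F G :: "real \<Rightarrow> real"
  assumes "set_integrable lborel {0<..} G" "F \<in> borel_measurable borel" "\<And>r. r > 0 \<Longrightarrow> \<bar>F r\<bar> \<le> G r"
  shows "set_integrable lborel {0<..} F"
  unfolding set_integrable_def
proof (rule Bochner_Integration.integrable_bound[OF assms(1)[unfolded set_integrable_def]])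
  show "(\<lambda>r. indicator {0<..} r *\<^sub>R F r) \<in> borel_measurable lborel"
    using assms(2) by measurable
qed (use assms(3) in \<open>auto simp: indicator_def intro: order_trans[OF _ abs_ge_self]\<close>)

lemma half_line_integral_pos:
  assumes "set_integrable lborel {0<..} F" "\<And>r. r > 0 \<Longrightarrow> 0 < F r"
  shows "0 < half_line_integral F"
proof (rule ccontr)
  assume "\<not> 0 < half_line_integral F"
  moreover have nonneg: "0 \<le> indicator {0<..} r *\<^sub>R F r" for r
    using assms(2)[of r] by (auto simp: indicator_def)
  then have "0 \<le> half_line_integral F"
    unfolding half_line_integral_def set_lebesgue_integral_def by (intro Bochner_Integration.integral_nonneg) auto
  ultimately have "(LINT r|lborel. indicator {0<..} r *\<^sub>R F r) = 0"
    by (simp add: half_line_integral_def set_lebesgue_integral_def)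
  then have "AE r in lborel. indicator {0<..} r *\<^sub>R F r = 0"
    using nonneg assms(1) by (subst (asm) integral_nonneg_eq_0_iff_AE) (auto simp: set_integrable_def)
  then have "AE r in lborel. r \<notin> {0<..<1::real}"
    by eventually_elim (use assms(2) in \<open>force simp: indicator_def\<close>)
  then have "{0<..<1::real} \<in> null_sets lborel"
    by (subst (asm) AE_iff_null_sets[symmetric]) auto
  then show False by (auto simp: null_sets_def)
qed

lemma half_line_integral_mono:
  assumes "set_integrable lborel {0<..} F" "set_integrable lborel {0<..} G"
    and "\<And>r. r > 0 \<Longrightarrow> F r \<le> G r"
  shows "half_line_integral F \<le> half_line_integral G"
  unfolding half_line_integral_def by (rule set_integral_mono) (use assms in auto)

text \<open>Scaling \<open>r\<close> represents \<open>\<kappa> powr (2 * \<alpha>)\<close> and \<open>1 / \<kappa>\<close> as superpositions of Gaussians in \<open>\<kappa>\<close>.\<close>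

definition frac_const :: "real \<Rightarrow> real" where
  "frac_const \<alpha> = half_line_integral (\<lambda>r. r powr (- (1 + 2 * \<alpha>)) * (1 - exp (- r\<^sup>2 / 2)))"

lemma one_minus_exp_bound: "0 \<le> 1 - exp (- (x::real)\<^sup>2 / 2)" "1 - exp (- x\<^sup>2 / 2) \<le> min 1 (x\<^sup>2)"
proof -
  show "0 \<le> 1 - exp (- x\<^sup>2 / 2)" by simp
  have "1 + (- x\<^sup>2 / 2) \<le> exp (- x\<^sup>2 / 2)" by (rule exp_ge_add_one_self)
  then have "1 - exp (- x\<^sup>2 / 2) \<le> x\<^sup>2" using zero_le_power2[of x] by linarith
  then show "1 - exp (- x\<^sup>2 / 2) \<le> min 1 (x\<^sup>2)" by simp
qed

text \<open>The integrand behaves like \<open>r powr (1 - 2 * \<alpha>)\<close> at zero and like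
  \<open>r powr (- (1 + 2 * \<alpha>))\<close> at infinity, so it is integrable exactly because
  \<open>0 < \<alpha> < 1\<close>; the power of \<kappa> is scaling.\<close>

lemma frac_integral:
  assumes "0 < \<alpha>" "\<alpha> < 1"
  shows frac_const_pos: "0 < frac_const \<alpha>"
    and "0 \<le> \<kappa> \<Longrightarrow> set_integrable lborel {0<..} (\<lambda>r. r powr (- (1 + 2 * \<alpha>)) * (1 - exp (- (\<kappa> * r)\<^sup>2 / 2)))"
    and "0 \<le> \<kappa> \<Longrightarrow> half_line_integral (\<lambda>r. r powr (- (1 + 2 * \<alpha>)) * (1 - exp (- (\<kappa> * r)\<^sup>2 / 2))) =
      \<kappa> powr (2 * \<alpha>) * frac_const \<alpha>"
proof -
  let ?F = "\<lambda>r. r powr (- (1 + 2 * \<alpha>)) * (1 - exp (- r\<^sup>2 / 2))"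
  have int: "set_integrable lborel {0<..} ?F"
  proof (rule set_integrable_half_line_bound)
    show "set_integrable lborel {0<..} (\<lambda>r. min (r powr (1 - 2 * \<alpha>)) (r powr (- (1 + 2 * \<alpha>))))"
      using assms by (intro set_integrable_min_powr) auto
    fix r :: real assume r: "r > 0"
    have "r powr (1 - 2 * \<alpha>) = r powr (- (1 + 2 * \<alpha>)) * r\<^sup>2"
      using r by (simp add: powr_diff powr_minus powr_add powr_realpow[symmetric] field_simps power2_eq_square)
    moreover have "?F r \<le> r powr (- (1 + 2 * \<alpha>)) * r\<^sup>2" "?F r \<le> r powr (- (1 + 2 * \<alpha>)) * 1"
      using one_minus_exp_bound[of r] by (intro mult_left_mono; simp)+
    ultimately have "?F r \<le> min (r powr (1 - 2 * \<alpha>)) (r powr (- (1 + 2 * \<alpha>)))" by simp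
    then show "\<bar>?F r\<bar> \<le> min (r powr (1 - 2 * \<alpha>)) (r powr (- (1 + 2 * \<alpha>)))"
      using one_minus_exp_bound[of r] by (simp add: abs_mult)
  qed measurable
  show "0 < frac_const \<alpha>" unfolding frac_const_def
    by (rule half_line_integral_pos[OF int]) auto
  assume "0 \<le> \<kappa>"
  then consider "\<kappa> = 0" | "\<kappa> > 0" by linarith
  then have "set_integrable lborel {0<..} (\<lambda>r. r powr (- (1 + 2 * \<alpha>)) * (1 - exp (- (\<kappa> * r)\<^sup>2 / 2))) \<and>
     half_line_integral (\<lambda>r. r powr (- (1 + 2 * \<alpha>)) * (1 - exp (- (\<kappa> * r)\<^sup>2 / 2))) =
      \<kappa> powr (2 * \<alpha>) * frac_const \<alpha>"
  proof cases
    case 1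
    then show ?thesis by (simp add: half_line_integral_def set_integrable_def set_lebesgue_integral_def)
  next
    case 2
    show ?thesis using half_line_scaling[OF 2 int] by (simp add: frac_const_def)
  qed
  then show "set_integrable lborel {0<..} (\<lambda>r. r powr (- (1 + 2 * \<alpha>)) * (1 - exp (- (\<kappa> * r)\<^sup>2 / 2)))"
    and "half_line_integral (\<lambda>r. r powr (- (1 + 2 * \<alpha>)) * (1 - exp (- (\<kappa> * r)\<^sup>2 / 2))) =
      \<kappa> powr (2 * \<alpha>) * frac_const \<alpha>" by auto
qed

definition exp_const :: real where
  "exp_const = half_line_integral (\<lambda>r. exp (- r\<^sup>2 / 2))"

text \<open>Scaling with exponent \<open>q = 0\<close>. Taken at
  \<open>\<kappa> = norm (wavevec k)\<close> it produces the denominator of the Riesz symbol from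
  the heat flow.\<close>

lemma exp_integral:
  shows exp_const_pos: "0 < exp_const"
    and "0 < \<kappa> \<Longrightarrow> set_integrable lborel {0<..} (\<lambda>r. exp (- (\<kappa> * r)\<^sup>2 / 2))"
    and "0 < \<kappa> \<Longrightarrow> half_line_integral (\<lambda>r. exp (- (\<kappa> * r)\<^sup>2 / 2)) = exp_const / \<kappa>"
proof -
  have "integrable lborel (\<lambda>r. sqrt (2 * pi) * std_normal_density r)"
    by (intro integrable_mult_right integrable_normal_density) simp
  then have "integrable lborel (\<lambda>r::real. exp (- r\<^sup>2 / 2))" by (simp add: std_normal_density_def)
  then have int: "set_integrable lborel {0<..} (\<lambda>r::real. exp (- r\<^sup>2 / 2))"
    unfolding set_integrable_def by (intro integrable_mult_indicator) auto
  show "0 < exp_const" unfolding exp_const_def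
    by (rule half_line_integral_pos[OF int]) auto
  have eq: "set_integrable lborel {0<..} (\<lambda>r. r powr (- 0) * F r) \<longleftrightarrow> set_integrable lborel {0<..} F"
    "half_line_integral (\<lambda>r. r powr (- 0) * F r) = half_line_integral F" for F :: "real \<Rightarrow> real"
    unfolding set_integrable_def half_line_integral_def set_lebesgue_integral_def
    by (auto intro!: Bochner_Integration.integral_cong Bochner_Integration.integrable_cong simp: indicator_def)
  assume \<kappa>: "0 < \<kappa>"
  note sc = half_line_scaling[OF \<kappa>, of 0, unfolded eq, OF int]
  show "set_integrable lborel {0<..} (\<lambda>r. exp (- (\<kappa> * r)\<^sup>2 / 2))" by (rule sc(1))
  show "half_line_integral (\<lambda>r. exp (- (\<kappa> * r)\<^sup>2 / 2)) = exp_const / \<kappa>"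
  proof -
    have "\<kappa> powr (0 - 1) = 1 / \<kappa>" using \<kappa> powr_minus_divide[of \<kappa> 1] by simp
    then show ?thesis using sc(2) by (simp add: exp_const_def)
  qed
qed

text \<open>The two entries of the minimum cross at \<open>r = h\<close>. The first is integrable at
  zero and the second at infinity because \<open>0 < \<beta> < 1\<close>, and scaling by
  \<open>h\<close> gives the power. This is the integral that closes the Riesz transform
  estimate.\<close>

lemma near_far_integral:
  assumes "0 < \<beta>" "\<beta> < 1"
  obtains C where "0 < C"
    "\<And>h. 0 < h \<Longrightarrow> set_integrable lborel {0<..} (\<lambda>r. min (r powr (\<beta> - 1)) (h * r powr (\<beta> - 2)))"
    "\<And>h. 0 < h \<Longrightarrow> half_line_integral (\<lambda>r. min (r powr (\<beta> - 1)) (h * r powr (\<beta> - 2))) = C * h powr \<beta>"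
proof -
  define F where "F = (\<lambda>r::real. min 1 (inverse r))"
  have eq: "r powr (- (1 - \<beta>)) * F (inverse h * r) = min (r powr (\<beta> - 1)) (h * r powr (\<beta> - 2))"
    if "r > 0" "h > 0" for r h
  proof -
    have "r powr (\<beta> - 2) = r powr (\<beta> - 1) * inverse r"
      using that powr_add[of r "\<beta> - 1" "-1"] by (simp add: powr_minus)
    then show ?thesis using that unfolding F_def
      by (subst min_mult_distrib_left) (auto simp: mult_ac)
  qed
  have eq1: "set_integrable lborel {0<..} (\<lambda>r. r powr (- (1 - \<beta>)) * F (inverse h * r)) \<longleftrightarrow>
     set_integrable lborel {0<..} (\<lambda>r. min (r powr (\<beta> - 1)) (h * r powr (\<beta> - 2)))"
    "half_line_integral (\<lambda>r. r powr (- (1 - \<beta>)) * F (inverse h * r)) =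
     half_line_integral (\<lambda>r. min (r powr (\<beta> - 1)) (h * r powr (\<beta> - 2)))" if "h > 0" for h
    unfolding set_integrable_def half_line_integral_def set_lebesgue_integral_def
    using eq[OF _ that]
    by (auto intro!: Bochner_Integration.integral_cong Bochner_Integration.integrable_cong simp: indicator_def)
  have "set_integrable lborel {0<..} (\<lambda>r. min (r powr (\<beta> - 1)) (1 * r powr (\<beta> - 2)))"
    using set_integrable_min_powr[of "\<beta> - 1" "\<beta> - 2"] assms by simp
  then have int: "set_integrable lborel {0<..} (\<lambda>r. r powr (- (1 - \<beta>)) * F r)"
    using eq1(1)[of 1] by simp
  define C where "C = half_line_integral (\<lambda>r. r powr (- (1 - \<beta>)) * F r)"
  have "0 < C" unfolding C_def by (rule half_line_integral_pos[OF int]) (auto simp: F_def)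
  moreover have "set_integrable lborel {0<..} (\<lambda>r. min (r powr (\<beta> - 1)) (h * r powr (\<beta> - 2)))"
    "half_line_integral (\<lambda>r. min (r powr (\<beta> - 1)) (h * r powr (\<beta> - 2))) = C * h powr \<beta>" if "0 < h" for h
  proof -
    have "inverse h powr (1 - \<beta> - 1) = h powr \<beta>"
      using that by (simp add: powr_minus inverse_powr)
    then show "set_integrable lborel {0<..} (\<lambda>r. min (r powr (\<beta> - 1)) (h * r powr (\<beta> - 2)))"
      "half_line_integral (\<lambda>r. min (r powr (\<beta> - 1)) (h * r powr (\<beta> - 2))) = C * h powr \<beta>"
      using half_line_scaling[OF _ int, of "inverse h"] that unfolding eq1[OF that] C_def by auto
  qed
  ultimately show thesis using that by blast
qed

subsection \<open>Hoelder bounds for Riesz transforms of trigonometric polynomials\<close>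

definition holder_bound :: "real \<Rightarrow> real \<Rightarrow> (real^2 \<Rightarrow> complex) \<Rightarrow> bool" where
  "holder_bound \<beta> K w \<longleftrightarrow> (\<forall>x y. cmod (w x - w y) \<le> K * norm (x - y) powr \<beta>)"

definition gauss_moment :: real where
  "gauss_moment = (LINT z|gauss. 1 + norm z ^ 8)"

text \<open>The symbol of the heat semigroup at time \<open>r\<^sup>2 / 2\<close>, equivalently of
  averaging over a standard Gaussian displacement scaled by \<open>r\<close>.\<close>

abbreviation heat :: "real \<Rightarrow> int^2 \<Rightarrow> real" where
  "heat r k \<equiv> exp (- (norm (wavevec k) * r)\<^sup>2 / 2)"

lemma holder_bound_nonneg:
  assumes "holder_bound \<beta> K w" shows "0 \<le> K"
proof -
  have "0 \<le> K * norm (axis 1 1 - (0 :: real^2)) powr \<beta>"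
    using assms unfolding holder_bound_def by (meson norm_ge_zero order_trans)
  then show ?thesis by simp
qed

lemma gauss_moment_integrable: "integrable gauss (\<lambda>z. 1 + norm z ^ 8)"
  using integrable_gauss_norm_power[of 4] by simp

lemma gauss_moment_ge_1: "1 \<le> gauss_moment"
proof -
  have "(LINT z|gauss. 1) \<le> gauss_moment"
    unfolding gauss_moment_def by (rule integral_mono) (use gauss_moment_integrable in auto)
  then show ?thesis using gauss.prob_space by simp
qed

lemma gauss_integral_bound:
  fixes f :: "real^2 \<Rightarrow> 'a::{banach, second_countable_topology}"
  assumes f: "f \<in> borel_measurable borel" "\<And>z. norm (f z) \<le> C * (1 + norm z ^ 8)"
  shows "norm (LINT z|gauss. f z) \<le> C * gauss_moment"
proof -
  have "norm (LINT z|gauss. f z) \<le> (LINT z|gauss. norm (f z))" by (rule integral_norm_bound)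
  also have "\<dots> \<le> (LINT z|gauss. C * (1 + norm z ^ 8))"
    using integrable_gauss_bounded[OF f] gauss_moment_integrable assms
    by (intro integral_mono integrable_norm integrable_mult_right) auto
  finally show ?thesis by (simp add: gauss_moment_def)
qed

lemma wave_shift: "wave k (x + r *\<^sub>R z) = wave k x * cis ((r *\<^sub>R wavevec k) \<bullet> z)"
  by (simp add: wave_def inner_add_right cis_mult)

lemma integrable_gauss_cis:
  "integrable gauss (\<lambda>z. cis (\<xi> \<bullet> z))" "integrable gauss (\<lambda>z. complex_of_real (z $ j) * cis (\<xi> \<bullet> z))"
proof -
  show "integrable gauss (\<lambda>z. cis (\<xi> \<bullet> z))"
    by (rule integrable_gauss_bounded[of _ 1]) (auto intro!: borel_measurable_continuous_onI continuous_intros)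
  have "\<bar>z $ j\<bar> \<le> 1 + norm z ^ 8" for z :: "real^2"
    using component_le_norm_cart[of z j] power_le_1_plus[of "norm z" 1 8] by simp
  then show "integrable gauss (\<lambda>z. complex_of_real (z $ j) * cis (\<xi> \<bullet> z))"
    by (intro integrable_gauss_bounded[of _ 1])
       (auto intro!: borel_measurable_continuous_onI continuous_intros simp: norm_mult)
qed

lemma heat_eq: "exp (- (norm (r *\<^sub>R wavevec k))\<^sup>2 / 2) = heat r k"
  by (simp add: power_mult_distrib mult.commute)

lemma gauss_wave: "(LINT z|gauss. wave k (x + r *\<^sub>R z)) = wave k x * heat r k"
proof -
  have "(LINT z|gauss. wave k (x + r *\<^sub>R z)) = wave k x * (LINT z|gauss. cis ((r *\<^sub>R wavevec k) \<bullet> z))"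
    unfolding wave_shift by simp
  then show ?thesis unfolding integral_gauss_cis heat_eq .
qed

lemma gauss_wave_moment:
  "(LINT z|gauss. complex_of_real (z $ j) * wave k (x + r *\<^sub>R z)) = r * (partial_symbol j k * heat r k * wave k x)"
proof -
  have "(LINT z|gauss. complex_of_real (z $ j) * wave k (x + r *\<^sub>R z)) =
     (LINT z|gauss. wave k x * (complex_of_real (z $ j) * cis ((r *\<^sub>R wavevec k) \<bullet> z)))"
    by (simp add: wave_shift mult_ac)
  also have "\<dots> = wave k x * (LINT z|gauss. complex_of_real (z $ j) * cis ((r *\<^sub>R wavevec k) \<bullet> z))"
    by simp
  finally show ?thesis
    unfolding integral_gauss_moment heat_eq by (simp add: partial_symbol_def mult_ac)
qed

lemma integrable_gauss_wave_moment:
  "integrable gauss (\<lambda>z. complex_of_real (z $ j) * wave k (x + r *\<^sub>R z))"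
proof -
  have "integrable gauss (\<lambda>z. wave k x * (complex_of_real (z $ j) * cis ((r *\<^sub>R wavevec k) \<bullet> z)))"
    by (intro integrable_mult_right integrable_gauss_cis)
  then show ?thesis by (simp add: wave_shift mult_ac)
qed

text \<open>Gaussian integration by parts in spectral form: the gradient of the heat flow is an
  average of values of the polynomial, so it can be bounded by a modulus of continuity.\<close>

lemma gauss_trig_moment:
  "(LINT z|gauss. complex_of_real (z $ j) * trig A a (x + r *\<^sub>R z)) =
     r * trig A (\<lambda>k. partial_symbol j k * heat r k * a k) x"
proof -
  have "(LINT z|gauss. complex_of_real (z $ j) * trig A a (x + r *\<^sub>R z)) =
    (LINT z|gauss. (\<Sum>k\<in>A. a k * (complex_of_real (z $ j) * wave k (x + r *\<^sub>R z))))"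
    by (simp add: trig_def sum_distrib_left mult_ac)
  also have "\<dots> = (\<Sum>k\<in>A. a k * (LINT z|gauss. complex_of_real (z $ j) * wave k (x + r *\<^sub>R z)))"
    by (subst Bochner_Integration.integral_sum) (auto intro: integrable_gauss_wave_moment)
  also have "\<dots> = r * trig A (\<lambda>k. partial_symbol j k * heat r k * a k) x"
    unfolding gauss_wave_moment by (simp add: trig_def sum_distrib_left mult_ac)
  finally show ?thesis .
qed

lemma gauss_coord_mean: "(LINT z|gauss. z $ j) = 0"
  using integral_gauss_moment[of j 0] by simp

text \<open>Coordinates have Gaussian mean zero, so any constant \<open>c\<close> may be subtracted
  under the average. The value at \<open>x\<close> brings in the Hoelder bound, the value 0 a
  supremum bound.\<close>

lemma gauss_gradient_bound:
  assumes r: "r > 0"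
    and meas: "\<And>z. cmod (complex_of_real (z $ j) * (trig A a (x + r *\<^sub>R z) - c)) \<le> M * (1 + norm z ^ 8)"
  shows "cmod (trig A (\<lambda>k. partial_symbol j k * heat r k * a k) x) \<le> gauss_moment * M / r"
proof -
  have i1: "integrable gauss (\<lambda>z. complex_of_real (z $ j) * trig A a (x + r *\<^sub>R z))"
  proof -
    have "integrable gauss (\<lambda>z. \<Sum>k\<in>A. a k * (complex_of_real (z $ j) * wave k (x + r *\<^sub>R z)))"
      by (intro Bochner_Integration.integrable_sum integrable_mult_right integrable_gauss_wave_moment)
    then show ?thesis by (simp add: trig_def sum_distrib_left mult_ac)
  qed
  have i2: "integrable gauss (\<lambda>z. complex_of_real (z $ j) * c)"
    using integrable_gauss_cis(2)[of j 0] by simp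
  have eq: "r * trig A (\<lambda>k. partial_symbol j k * heat r k * a k) x =
      (LINT z|gauss. complex_of_real (z $ j) * (trig A a (x + r *\<^sub>R z) - c))"
    unfolding gauss_trig_moment[symmetric] right_diff_distrib
    using i1 i2 by (simp add: gauss_coord_mean)
  have "r * cmod (trig A (\<lambda>k. partial_symbol j k * heat r k * a k) x) =
     cmod (r * trig A (\<lambda>k. partial_symbol j k * heat r k * a k) x)"
    using r by (simp only: norm_mult norm_of_real abs_of_pos)
  also have "\<dots> = cmod (LINT z|gauss. complex_of_real (z $ j) * (trig A a (x + r *\<^sub>R z) - c))"
    unfolding eq ..
  also have "\<dots> \<le> M * gauss_moment"
    by (intro gauss_integral_bound meas borel_measurable_continuous_onI continuous_intros)
  finally show ?thesis using r by (simp add: field_simps)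
qed

lemma gradient_holder:
  assumes "holder_bound \<beta> K (trig A a)" "0 < \<beta>" "\<beta> < 1" "r > 0"
  shows "cmod (trig A (\<lambda>k. partial_symbol j k * heat r k * a k) x) \<le> gauss_moment * K * r powr (\<beta> - 1)"
proof -
  have K: "0 \<le> K" using assms(1) by (rule holder_bound_nonneg)
  have "cmod (complex_of_real (z $ j) * (trig A a (x + r *\<^sub>R z) - trig A a x)) \<le>
      (K * r powr \<beta>) * (1 + norm z ^ 8)" for z
  proof -
    have "cmod (trig A a (x + r *\<^sub>R z) - trig A a x) \<le> K * norm (r *\<^sub>R z) powr \<beta>"
      using assms(1) unfolding holder_bound_def by (metis add_diff_cancel_left')
    also have "\<dots> = K * r powr \<beta> * norm z powr \<beta>"
      using assms by (simp add: powr_mult)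
    finally have "cmod (complex_of_real (z $ j) * (trig A a (x + r *\<^sub>R z) - trig A a x)) \<le>
        norm z * (K * r powr \<beta> * norm z powr \<beta>)"
      unfolding norm_mult norm_of_real by (intro mult_mono component_le_norm_cart) auto
    also have "\<dots> = K * r powr \<beta> * norm z powr (1 + \<beta>)"
      by (cases "z = 0") (auto simp: powr_add)
    also have "\<dots> \<le> K * r powr \<beta> * (1 + norm z ^ 8)"
      using K assms by (intro mult_left_mono powr_le_1_plus) auto
    finally show ?thesis .
  qed
  from gauss_gradient_bound[OF assms(4) this] show ?thesis
    using assms(4) by (simp add: powr_diff mult_ac)
qed

lemma gradient_bounded:
  assumes "\<And>y. cmod (trig A b y) \<le> M" "r > 0"
  shows "cmod (trig A (\<lambda>k. partial_symbol j k * heat r k * b k) x) \<le> gauss_moment * M / r"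
proof (rule gauss_gradient_bound[OF assms(2), of j A b x 0])
  fix z :: "real^2"
  have "\<bar>z $ j\<bar> \<le> 1 + norm z ^ 8"
    using component_le_norm_cart[of z j] power_le_1_plus[of "norm z" 1 8] by simp
  then have "\<bar>z $ j\<bar> * cmod (trig A b (x + r *\<^sub>R z)) \<le> (1 + norm z ^ 8) * M"
    using assms(1) by (intro mult_mono) auto
  then show "cmod (complex_of_real (z $ j) * (trig A b (x + r *\<^sub>R z) - 0)) \<le> M * (1 + norm z ^ 8)"
    by (simp add: norm_mult mult.commute)
qed

text \<open>Semigroup splitting: one half of the heat flow absorbs each derivative.\<close>

lemma hessian_holder:
  assumes "holder_bound \<beta> K (trig A a)" "0 < \<beta>" "\<beta> < 1" "r > 0"
  shows "cmod (trig A (\<lambda>k. partial_symbol i k * (partial_symbol j k * heat r k * a k)) x) \<le>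
     4 * gauss_moment\<^sup>2 * K * r powr (\<beta> - 2)"
proof -
  \<comment> \<open>Chosen so that two heat steps of scale \<open>s\<close> compose to one of scale
    \<open>r\<close>.\<close>
  define s where "s = r / sqrt 2"
  have s: "s > 0" using assms(4) by (simp add: s_def)
  have K: "0 \<le> K" using assms(1) by (rule holder_bound_nonneg)
  have heat2: "heat r k = heat s k * heat s k" for k
    by (simp add: mult_exp_exp s_def power_mult_distrib power_divide field_simps)
  have "cmod (trig A (\<lambda>k. partial_symbol i k * heat s k * (partial_symbol j k * heat s k * a k)) x) \<le>
     gauss_moment * (gauss_moment * K * s powr (\<beta> - 1)) / s"
    by (intro gradient_bounded gradient_holder assms s)
  also have "\<dots> = gauss_moment\<^sup>2 * K * s powr (\<beta> - 2)"
  proof -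
    have "s powr (\<beta> - 2) = s powr (\<beta> - 1) / s" using s powr_diff[of s "\<beta> - 1" 1] by simp
    then show ?thesis by (simp add: power2_eq_square)
  qed
  also have "\<dots> \<le> gauss_moment\<^sup>2 * K * (4 * r powr (\<beta> - 2))"
  proof -
    have "(1 / sqrt 2) powr (\<beta> - 2) = sqrt 2 powr (2 - \<beta>)"
      by (simp add: powr_divide powr_minus_divide[symmetric])
    also have "\<dots> \<le> sqrt 2 powr 4" using assms by (intro powr_mono) auto
    also have "\<dots> = 4" by (simp add: powr_numeral power4_eq_xxxx)
    finally have "r powr (\<beta> - 2) * (1 / sqrt 2) powr (\<beta> - 2) \<le> r powr (\<beta> - 2) * 4"
      by (intro mult_left_mono) auto
    moreover have "s powr (\<beta> - 2) = r powr (\<beta> - 2) * (1 / sqrt 2) powr (\<beta> - 2)"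
      using assms(4) by (simp add: s_def flip: powr_mult)
    ultimately have "s powr (\<beta> - 2) \<le> 4 * r powr (\<beta> - 2)" by (simp only: mult.commute)
    then show ?thesis using K by (intro mult_left_mono) auto
  qed
  finally show ?thesis
    unfolding heat2 by (simp add: mult_ac)
qed

text \<open>The derivative along the segment is a sum over the two coordinates, each at most
  \<open>norm h * B\<close>; hence the factor 2.\<close>

lemma trig_mean_value:
  assumes B: "\<And>i y. cmod (trig A (\<lambda>k. partial_symbol i k * b k) y) \<le> B"
  shows "cmod (trig A b (x + h) - trig A b x) \<le> 2 * norm h * B"
proof -
  define f where "f = (\<lambda>t::real. trig A b (x + t *\<^sub>R h))"
  define f' where "f' = (\<lambda>t::real. \<Sum>i\<in>UNIV. complex_of_real (h $ i) * trig A (\<lambda>k. partial_symbol i k * b k) (x + t *\<^sub>R h))"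
  have deriv: "(f has_vector_derivative f' t) (at t)" for t
  proof -
    have w: "((\<lambda>t. wave k (x + t *\<^sub>R h)) has_vector_derivative
        (\<Sum>i\<in>UNIV. complex_of_real (h $ i) * partial_symbol i k) * wave k (x + t *\<^sub>R h)) (at t)" for k
    proof -
      define c where "c = wavevec k \<bullet> h"
      have eq: "wave k (x + t *\<^sub>R h) = wave k x * exp (\<i> * c * t)" for t
        by (simp add: wave_shift cis_conv_exp c_def mult_ac)
      have sum: "(\<Sum>i\<in>UNIV. complex_of_real (h $ i) * partial_symbol i k) = \<i> * c"
        by (simp add: c_def partial_symbol_def inner_vec_def sum_2 algebra_simps)
      have "((\<lambda>t. exp (\<i> * c * t)) has_vector_derivative \<i> * c * exp (\<i> * c * t)) (at t)"
        by (auto intro!: derivative_eq_intros has_vector_derivative_real_field)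
      then have "((\<lambda>t. wave k x * exp (\<i> * c * t)) has_vector_derivative wave k x * (\<i> * c * exp (\<i> * c * t))) (at t)"
        by (rule has_vector_derivative_mult_right)
      then show ?thesis unfolding eq sum by (simp only: mult_ac)
    qed
    have "(f has_vector_derivative (\<Sum>k\<in>A. b k * ((\<Sum>i\<in>UNIV. complex_of_real (h $ i) * partial_symbol i k) * wave k (x + t *\<^sub>R h)))) (at t)"
      unfolding f_def trig_def by (intro has_vector_derivative_sum has_vector_derivative_mult_right w)
    also have "(\<Sum>k\<in>A. b k * ((\<Sum>i\<in>UNIV. complex_of_real (h $ i) * partial_symbol i k) * wave k (x + t *\<^sub>R h))) = f' t"
      unfolding f'_def trig_def by (simp add: sum_2 sum_distrib_left sum.distrib algebra_simps)
    finally show ?thesis .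
  qed
  have B0: "0 \<le> B" using B[of 1 0] norm_ge_zero order_trans by blast
  have bound: "cmod (f' t) \<le> 2 * norm h * B" for t
  proof -
    have "cmod (f' t) \<le> (\<Sum>i\<in>(UNIV::2 set). norm h * B)"
      unfolding f'_def by (intro sum_norm_le) (auto simp: norm_mult intro!: mult_mono component_le_norm_cart B)
    then show ?thesis by simp
  qed
  have "cmod (f 1 - f 0) \<le> 2 * norm h * B * 1 - 2 * norm h * B * 0"
  proof (rule differentiable_bound_general)
    show "continuous_on {0..1} f"
      unfolding f_def by (intro continuous_intros)
    show "((\<lambda>t. 2 * norm h * B * t) has_vector_derivative 2 * norm h * B) (at t)" for t :: real
      by (auto intro!: derivative_eq_intros simp: has_real_derivative_iff_has_vector_derivative[symmetric])
  qed (use deriv bound in \<open>auto intro!: continuous_intros\<close>)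
  then show ?thesis by (simp add: f_def)
qed

text \<open>Up to \<open>exp_const\<close>, the Riesz transform is the integral over
  \<open>r\<close> of the gradient of the heat flow. Its increment over distance \<open>h\<close> is
  bounded by two gradients for \<open>r \<le> h\<close>, and by the Hessian and the mean value
  inequality for \<open>r \<ge> h\<close>.\<close>

theorem riesz_holder:
  assumes \<beta>: "0 < \<beta>" "\<beta> < 1"
  obtains C where "C > 0"
    "\<And>A a K j. finite A \<Longrightarrow> holder_bound \<beta> K (trig A a) \<Longrightarrow>
        holder_bound \<beta> (C * K) (trig A (\<lambda>k. riesz_symbol j k * a k))"
proof -
  obtain C where C: "0 < C"
    "\<And>h. 0 < h \<Longrightarrow> set_integrable lborel {0<..} (\<lambda>r. min (r powr (\<beta> - 1)) (h * r powr (\<beta> - 2)))"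
    "\<And>h. 0 < h \<Longrightarrow> half_line_integral (\<lambda>r. min (r powr (\<beta> - 1)) (h * r powr (\<beta> - 2))) = C * h powr \<beta>"
    using near_far_integral[OF \<beta>] by blast
  define G where "G = gauss_moment"
  have G: "1 \<le> G" unfolding G_def by (rule gauss_moment_ge_1)
  \<comment> \<open>The factor \<open>8 * G\<^sup>2\<close> is \<open>2 * (4 * G\<^sup>2)\<close>
    from the Hessian bound and also exceeds the \<open>2 * G\<close> of the gradient bound, as
    \<open>G \<ge> 1\<close>.\<close>
  define C' where "C' = 8 * G\<^sup>2 * C / exp_const"
  have main: "cmod (trig A (\<lambda>k. riesz_symbol j k * a k) x - trig A (\<lambda>k. riesz_symbol j k * a k) y) \<le>
      C' * K * norm (x - y) powr \<beta>"
    if A: "finite A" and hb: "holder_bound \<beta> K (trig A a)" for A a K j x y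
  proof (cases "x = y")
    case True then show ?thesis by simp
  next
    case False
    define h where "h = norm (x - y)"
    have h: "h > 0" using False by (simp add: h_def)
    have K: "0 \<le> K" using hb by (rule holder_bound_nonneg)
    define g where "g = (\<lambda>r z. trig A (\<lambda>k. partial_symbol j k * heat r k * a k) z)"
    define c where "c = (\<lambda>k. partial_symbol j k * a k * (wave k x - wave k y))"
    have gdiff: "g r x - g r y = (\<Sum>k\<in>A. c k * complex_of_real (heat r k))" for r
      by (simp add: g_def trig_def c_def algebra_simps sum_subtractf[symmetric])
    have near: "cmod (g r x - g r y) \<le> 8 * G\<^sup>2 * K * r powr (\<beta> - 1)" if r: "r > 0" for r
    proof -
      have "cmod (g r x - g r y) \<le> cmod (g r x) + cmod (g r y)" by (rule norm_triangle_ineq4)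
      also have "\<dots> \<le> G * K * r powr (\<beta> - 1) + G * K * r powr (\<beta> - 1)"
        unfolding g_def G_def by (intro add_mono gradient_holder hb \<beta> r)
      also have "\<dots> = 2 * G * (K * r powr (\<beta> - 1))" by simp
      also have "\<dots> \<le> 8 * G\<^sup>2 * (K * r powr (\<beta> - 1))"
        using G K by (intro mult_right_mono) (auto simp: power2_eq_square)
      finally show ?thesis by (simp add: mult_ac)
    qed
    have far: "cmod (g r x - g r y) \<le> 8 * G\<^sup>2 * K * (h * r powr (\<beta> - 2))" if r: "r > 0" for r
    proof -
      have "cmod (g r (y + (x - y)) - g r y) \<le> 2 * norm (x - y) * (4 * G\<^sup>2 * K * r powr (\<beta> - 2))"
        unfolding g_def G_def by (intro trig_mean_value hessian_holder hb \<beta> r)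
      then show ?thesis by (simp add: h_def mult_ac)
    qed
    have int: "set_integrable lborel {0<..} (\<lambda>r. c k * complex_of_real (heat r k))"
      and val: "(LINT r:{0<..}|lborel. c k * complex_of_real (heat r k)) =
         exp_const * (riesz_symbol j k * a k * (wave k x - wave k y))" for k
    proof -
      have "set_integrable lborel {0<..} (\<lambda>r. c k * complex_of_real (heat r k)) \<and>
        (LINT r:{0<..}|lborel. c k * complex_of_real (heat r k)) =
         exp_const * (riesz_symbol j k * a k * (wave k x - wave k y))"
      \<comment> \<open>The zero mode does not decay in \<open>r\<close>, but its coefficient is
        zero on both sides because \<open>partial_symbol j 0\<close> is.\<close>
      proof (cases "k = 0")
        case True
        then have "c k = 0" "riesz_symbol j k = 0" by (auto simp: c_def partial_symbol_def riesz_symbol_def)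
        then show ?thesis by (simp add: set_integrable_def set_lebesgue_integral_def)
      next
        case False
        then have p: "0 < norm (wavevec k)" by simp
        have i: "set_integrable lborel {0<..} (\<lambda>r. complex_of_real (heat r k))"
          using exp_integral(2)[OF p] unfolding set_integrable_def
          by (drule_tac integrable_of_real[where 'a=complex]) (simp add: scaleR_conv_of_real)
        have v: "(LINT r:{0<..}|lborel. complex_of_real (heat r k)) = exp_const / norm (wavevec k)"
          using exp_integral(3)[OF p]
          unfolding half_line_integral_def set_lebesgue_integral_def
          by (metis (mono_tags, lifting) Bochner_Integration.integral_cong integral_complex_of_real of_real_mult
              real_scaleR_def scaleR_conv_of_real)
        have rs: "riesz_symbol j k = partial_symbol j k / norm (wavevec k)"
          by (simp add: riesz_symbol_def Lambda_symbol_def)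
        show ?thesis using i v by (simp add: rs c_def)
      qed
      then show "set_integrable lborel {0<..} (\<lambda>r. c k * complex_of_real (heat r k))"
        "(LINT r:{0<..}|lborel. c k * complex_of_real (heat r k)) =
         exp_const * (riesz_symbol j k * a k * (wave k x - wave k y))" by auto
    qed
    have int': "set_integrable lborel {0<..} (\<lambda>r. g r x - g r y)"
      unfolding gdiff using int unfolding set_integrable_def
      by (simp add: scaleR_sum_right)
    have "(LINT r:{0<..}|lborel. g r x - g r y) = (\<Sum>k\<in>A. LINT r:{0<..}|lborel. c k * complex_of_real (heat r k))"
      unfolding gdiff using int unfolding set_integrable_def set_lebesgue_integral_def
      by (simp add: scaleR_sum_right)
    also have "\<dots> = exp_const * (trig A (\<lambda>k. riesz_symbol j k * a k) x - trig A (\<lambda>k. riesz_symbol j k * a k) y)"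
      unfolding val by (simp add: trig_def sum_distrib_left sum_subtractf[symmetric] algebra_simps)
    finally have "exp_const * cmod (trig A (\<lambda>k. riesz_symbol j k * a k) x - trig A (\<lambda>k. riesz_symbol j k * a k) y) =
       cmod (LINT r:{0<..}|lborel. g r x - g r y)"
      using exp_const_pos by (simp add: norm_mult)
    also have "\<dots> \<le> (LINT r:{0<..}|lborel. cmod (g r x - g r y))"
      unfolding set_lebesgue_integral_def by (rule order_trans[OF integral_norm_bound]) simp
    also have "\<dots> \<le> (LINT r:{0<..}|lborel. 8 * G\<^sup>2 * K * min (r powr (\<beta> - 1)) (h * r powr (\<beta> - 2)))"
    proof (rule set_integral_mono)
      show "set_integrable lborel {0<..} (\<lambda>r. cmod (g r x - g r y))"
        using int' by (rule set_integrable_norm)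
      show "set_integrable lborel {0<..} (\<lambda>r. 8 * G\<^sup>2 * K * min (r powr (\<beta> - 1)) (h * r powr (\<beta> - 2)))"
        by (intro set_integrable_mult_right C(2) h)
      fix r :: real assume "r \<in> {0<..}"
      then show "cmod (g r x - g r y) \<le> 8 * G\<^sup>2 * K * min (r powr (\<beta> - 1)) (h * r powr (\<beta> - 2))"
        using near[of r] far[of r] by (auto simp: min_def)
    qed
    also have "\<dots> = 8 * G\<^sup>2 * K * (C * h powr \<beta>)"
      using C(3)[OF h] by (simp add: half_line_integral_def)
    finally show ?thesis
      using exp_const_pos by (simp add: C'_def h_def field_simps)
  qed
  have "C' > 0" using G C(1) exp_const_pos by (simp add: C'_def)
  moreover have "holder_bound \<beta> (C' * K) (trig A (\<lambda>k. riesz_symbol j k * a k))"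
    if "finite A" "holder_bound \<beta> K (trig A a)" for A a K j
    using main[OF that] unfolding holder_bound_def by blast
  ultimately show thesis by (rule that)
qed

subsection \<open>Cubic means of increments\<close>

definition inc3 :: "(real^2 \<Rightarrow> complex) \<Rightarrow> real^2 \<Rightarrow> real" where
  "inc3 w h = (LINT x|TM. cmod (w (x + h) - w x) ^ 3)"

text \<open>The exponent at zero exceeds \<open>1 + 2 * \<alpha>\<close> and the one at infinity is smaller, so that
  \<open>profile \<alpha> \<beta> r / r powr (2 + 2 * \<alpha>)\<close> is integrable.\<close>

definition profile :: "real \<Rightarrow> real \<Rightarrow> real \<Rightarrow> real" where
  "profile \<alpha> \<beta> \<rho> = min (\<rho> powr \<beta>) (\<rho> powr (2 + \<alpha>))"

text \<open>Either \<open>b \<le> \<eta> * a\<close> or \<open>a < b / \<eta>\<close>. As \<eta>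
  tends to 0 the factor of \<open>a ^ 3\<close> approaches \<open>1 / 8\<close>, the price being
  paid by \<open>b ^ 3\<close>.\<close>

lemma cube_split:
  fixes a b \<eta> :: real
  assumes "0 \<le> a" "0 \<le> b" "0 < \<eta>"
  shows "((a + b) / 2) ^ 3 \<le> (1 + \<eta>) ^ 3 / 8 * a ^ 3 + (1 + 1 / \<eta>) ^ 3 / 8 * b ^ 3"
proof (cases "b \<le> \<eta> * a")
  case True
  then have "((a + b) / 2) ^ 3 \<le> ((1 + \<eta>) * a / 2) ^ 3"
    using assms by (intro power_mono) (auto simp: algebra_simps)
  also have "\<dots> = (1 + \<eta>) ^ 3 / 8 * a ^ 3" by (simp add: power_divide power_mult_distrib)
  also have "\<dots> \<le> (1 + \<eta>) ^ 3 / 8 * a ^ 3 + (1 + 1 / \<eta>) ^ 3 / 8 * b ^ 3" using assms by simp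
  finally show ?thesis .
next
  case False
  then have "a \<le> b / \<eta>" using assms by (simp add: field_simps)
  then have "(a + b) / 2 \<le> (1 + 1 / \<eta>) * b / 2"
    using assms(3) by (simp add: field_simps)
  then have "((a + b) / 2) ^ 3 \<le> ((1 + 1 / \<eta>) * b / 2) ^ 3"
    using assms by (intro power_mono) auto
  also have "\<dots> = (1 + 1 / \<eta>) ^ 3 / 8 * b ^ 3" by (simp add: power_divide power_mult_distrib)
  also have "\<dots> \<le> (1 + \<eta>) ^ 3 / 8 * a ^ 3 + (1 + 1 / \<eta>) ^ 3 / 8 * b ^ 3" using assms by simp
  finally show ?thesis .
qed

lemma cmod_cis_minus_1_le: "cmod (cis t - 1) \<le> \<bar>t\<bar>"
proof -
  have "(cmod (cis t - 1))\<^sup>2 = 2 - 2 * cos t"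
    using sin_cos_squared_add[of t] by (simp add: cmod_power2 power2_diff)
  also have "\<dots> = (2 * sin (t / 2))\<^sup>2"
    using cos_double_sin[of "t / 2"] by (simp add: power_mult_distrib)
  also have "\<dots> \<le> t\<^sup>2"
    using abs_sin_x_le_abs_x[of "t / 2"] by (intro abs_le_square_iff[THEN iffD1]) (simp add: abs_mult)
  finally show ?thesis by (simp add: abs_le_square_iff[symmetric])
qed

lemma cmod_wave_minus_1_pow4:
  "cmod (wave k h - 1) ^ 4 \<le> 16 * min 1 ((norm (wavevec k) * norm h) ^ 4)"
proof -
  have "cmod (wave k h - 1) \<le> 2" using norm_triangle_ineq4[of "wave k h" 1] by simp
  then have 1: "cmod (wave k h - 1) ^ 4 \<le> 2 ^ 4" by (intro power_mono) auto
  have "cmod (wave k h - 1) \<le> \<bar>wavevec k \<bullet> h\<bar>" unfolding wave_def by (rule cmod_cis_minus_1_le)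
  also have "\<dots> \<le> norm (wavevec k) * norm h" by (rule Cauchy_Schwarz_ineq2)
  finally have "cmod (wave k h - 1) ^ 4 \<le> (norm (wavevec k) * norm h) ^ 4" by (intro power_mono) auto
  also have "\<dots> \<le> 16 * (norm (wavevec k) * norm h) ^ 4" by simp
  finally show ?thesis using 1 unfolding min_def by (simp split: if_split)
qed

lemma trig_increment: "trig A b (x + h) - trig A b x = trig A (\<lambda>k. b k * (wave k h - 1)) x"
  by (simp add: trig_def wave_plus algebra_simps sum_subtractf[symmetric])

lemma trig_second_increment:
  "trig A (\<lambda>k. b k * (wave k h - 1)\<^sup>2) x =
     (trig A b (x + h + h) - trig A b (x + h)) - (trig A b (x + h) - trig A b x)"
  unfolding trig_increment by (simp add: power2_eq_square mult.assoc)

text \<open>Second differences would allow a higher power near zero. It is lowered to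
  \<open>2 + \<alpha>\<close> so that doubling multiplies the profile by less than 8, as the
  iteration below demands.\<close>

lemma powr_le_min_power:
  assumes "0 \<le> \<rho>" "0 < \<beta>" "\<beta> < 1" "0 < \<alpha>" "\<alpha> < 1"
  shows "\<rho> powr \<beta> * min 1 (\<rho> ^ 4) \<le> profile \<alpha> \<beta> \<rho>"
proof (cases "\<rho> = 0")
  case True then show ?thesis by (simp add: profile_def)
next
  case False
  then have p: "\<rho> > 0" using assms by simp
  have a: "\<rho> powr \<beta> * min 1 (\<rho> ^ 4) \<le> \<rho> powr \<beta> * 1" by (intro mult_left_mono) auto
  have "\<rho> powr \<beta> * min 1 (\<rho> ^ 4) \<le> \<rho> powr (2 + \<alpha>)"
  proof (cases "\<rho> \<le> 1")
    case True
    have "\<rho> powr \<beta> * min 1 (\<rho> ^ 4) \<le> 1 * \<rho> ^ 4"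
      using assms True p by (intro mult_mono) (auto simp: powr_le1)
    also have "\<dots> = \<rho> powr 4" using p by (simp add: powr_numeral)
    also have "\<dots> \<le> \<rho> powr (2 + \<alpha>)" using True p assms by (intro powr_mono') auto
    finally show ?thesis .
  next
    case False
    have "\<rho> powr \<beta> * min 1 (\<rho> ^ 4) \<le> \<rho> powr \<beta>" using a by simp
    also have "\<dots> \<le> \<rho> powr (2 + \<alpha>)" using False assms by (intro powr_mono) auto
    finally show ?thesis .
  qed
  with a show ?thesis by (simp add: profile_def)
qed

lemma profile_nonneg [simp]: "0 \<le> profile \<alpha> \<beta> \<rho>"
  by (simp add: profile_def)

lemma profile_double:
  assumes "0 \<le> \<rho>" "0 < \<beta>" "\<beta> < 1" "0 < \<alpha>"
  shows "profile \<alpha> \<beta> (2 * \<rho>) \<le> 2 powr (2 + \<alpha>) * profile \<alpha> \<beta> \<rho>"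
proof -
  have "2 powr \<beta> * \<rho> powr \<beta> \<le> 2 powr (2 + \<alpha>) * \<rho> powr \<beta>"
    using assms by (intro mult_right_mono powr_mono) auto
  then show ?thesis
    using assms by (simp add: profile_def powr_mult min_mult_distrib_left)
qed

text \<open>One of the three factors is bounded in supremum by
  \<open>2 * L * norm h powr \<beta>\<close>; the other two are handled by Parseval, where the
  second difference contributes \<open>cmod (wave k h - 1) ^ 4\<close>.\<close>

lemma second_increment_cube:
  assumes A: "finite A" and hb: "holder_bound \<beta> L (trig A b)"
    and \<beta>: "0 < \<beta>" "\<beta> < 1" and \<alpha>: "0 < \<alpha>" "\<alpha> < 1"
  shows "(LINT x|TM. cmod (trig A (\<lambda>k. b k * (wave k h - 1)\<^sup>2) x) ^ 3) \<le>
     (2 * pi)\<^sup>2 * 32 * L * (\<Sum>k\<in>A. (cmod (b k))\<^sup>2 * norm (wavevec k) powr (- \<beta>) * profile \<alpha> \<beta> (norm (wavevec k) * norm h))"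
proof -
  let ?d = "trig A (\<lambda>k. b k * (wave k h - 1)\<^sup>2)"
  have L: "0 \<le> L" using hb by (rule holder_bound_nonneg)
  note d = trig_second_increment[of A b h]
  have sup: "cmod (?d x) \<le> 2 * L * norm h powr \<beta>" for x
  proof -
    have "cmod (trig A b (y + h) - trig A b y) \<le> L * norm h powr \<beta>" for y
      using hb unfolding holder_bound_def by (metis add_diff_cancel_left')
    from this[of "x + h"] this[of x] show ?thesis
      unfolding d using norm_triangle_ineq4[of "trig A b (x + h + h) - trig A b (x + h)" "trig A b (x + h) - trig A b x"]
      by linarith
  qed
  have "(LINT x|TM. cmod (?d x) ^ 3) \<le> (LINT x|TM. 2 * L * norm h powr \<beta> * (cmod (?d x))\<^sup>2)"
  proof (rule integral_mono)
    fix x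
    have "cmod (?d x) * (cmod (?d x))\<^sup>2 \<le> 2 * L * norm h powr \<beta> * (cmod (?d x))\<^sup>2"
      by (intro mult_right_mono sup) auto
    then show "cmod (?d x) ^ 3 \<le> 2 * L * norm h powr \<beta> * (cmod (?d x))\<^sup>2"
      by (simp add: power3_eq_cube power2_eq_square mult_ac)
  qed (intro integrable_TM_continuous continuous_intros)+
  also have "\<dots> = 2 * L * norm h powr \<beta> * sqnorm ?d" by (simp add: sqnorm_def)
  also have "\<dots> = (2 * pi)\<^sup>2 * (2 * L) * (\<Sum>k\<in>A. (cmod (b k))\<^sup>2 * (norm h powr \<beta> * cmod (wave k h - 1) ^ 4))"
    unfolding trig_parseval[OF A]
    by (simp add: norm_mult norm_power power_mult_distrib sum_distrib_left mult_ac flip: power_mult)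
  also have "\<dots> \<le> (2 * pi)\<^sup>2 * (2 * L) * (\<Sum>k\<in>A. (cmod (b k))\<^sup>2 *
     (16 * (norm (wavevec k) powr (- \<beta>) * profile \<alpha> \<beta> (norm (wavevec k) * norm h))))"
  proof (intro mult_left_mono sum_mono)
    fix k assume "k \<in> A"
    show "norm h powr \<beta> * cmod (wave k h - 1) ^ 4 \<le>
      16 * (norm (wavevec k) powr (- \<beta>) * profile \<alpha> \<beta> (norm (wavevec k) * norm h))"
    proof (cases "k = 0")
      case False
      define \<rho> where "\<rho> = norm (wavevec k) * norm h"
      \<comment> \<open>Trades the Hoelder gain in \<open>h\<close> for a power of the frequency, so
        that all dependence on \<open>h\<close> passes through \<rho>.\<close>
      have \<rho>: "norm (wavevec k) powr (- \<beta>) * \<rho> powr \<beta> = norm h powr \<beta>"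
        using False by (simp add: \<rho>_def powr_mult flip: powr_add mult.assoc)
      have "norm h powr \<beta> * cmod (wave k h - 1) ^ 4 \<le> norm h powr \<beta> * (16 * min 1 (\<rho> ^ 4))"
        unfolding \<rho>_def by (intro mult_left_mono cmod_wave_minus_1_pow4) auto
      also have "\<dots> = 16 * (norm (wavevec k) powr (- \<beta>) * (\<rho> powr \<beta> * min 1 (\<rho> ^ 4)))"
        unfolding \<rho>[symmetric] by simp
      also have "\<dots> \<le> 16 * (norm (wavevec k) powr (- \<beta>) * profile \<alpha> \<beta> \<rho>)"
        using \<alpha> \<beta> by (intro mult_left_mono powr_le_min_power) (auto simp: \<rho>_def)
      finally show ?thesis by (simp add: \<rho>_def)
    qed simp
  qed (use L in auto)
  finally show ?thesis by (simp add: sum_distrib_left mult_ac)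
qed

text \<open>The identity \<open>\<delta>\<^sub>h = (\<delta>\<^sub>2\<^sub>h - \<delta>\<^sub>h\<delta>\<^sub>h) / 2\<close> gives \<open>inc3 w h \<le> lam * inc3 w (2h) + D * (second differences)\<close>
  with any \<open>lam > 1/8\<close>. The profile grows at most by the factor \<open>2 powr (2 + \<alpha>) < 8\<close> under doubling, so
  the inequality can be iterated. First differences alone would only suffice for \<open>2 * \<alpha> - \<beta> < 1\<close>.\<close>

theorem increment_cube_bound:
  assumes \<beta>: "0 < \<beta>" "\<beta> < 1" and \<alpha>: "0 < \<alpha>" "\<alpha> < 1"
  obtains C where "C > 0"
    "\<And>A b L h. finite A \<Longrightarrow> holder_bound \<beta> L (trig A b) \<Longrightarrow> inc3 (trig A b) h \<le>
       C * L * (\<Sum>k\<in>A. (cmod (b k))\<^sup>2 * norm (wavevec k) powr (- \<beta>) * profile \<alpha> \<beta> (norm (wavevec k) * norm h))"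
proof -
  \<comment> \<open>With this \<eta> the product \<open>q\<close> of \<open>lam\<close> and the
    doubling factor equals \<open>2 powr (- (1 - \<alpha>) / 4)\<close>, which is below 1.\<close>
  define \<eta> where "\<eta> = 2 powr ((1 - \<alpha>) / 4) - 1"
  define lam where "lam = (1 + \<eta>) ^ 3 / 8"
  define D where "D = (1 + 1 / \<eta>) ^ 3 / 8"
  define q where "q = lam * 2 powr (2 + \<alpha>)"
  have \<eta>: "\<eta> > 0" using \<alpha> powr_less_mono[of 0 "(1 - \<alpha>) / 4" 2] unfolding \<eta>_def by simp
  have D: "D > 0" unfolding D_def using \<eta> by (simp add: add_pos_pos)
  have lam0: "lam > 0" unfolding lam_def using \<eta> by simp
  have "(1 + \<eta>) ^ 3 = 2 powr (3 * (1 - \<alpha>) / 4)"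
    by (simp add: \<eta>_def powr_powr powr_realpow[symmetric] mult.commute)
  moreover have "(8::real) = 2 powr 3" by simp
  ultimately have "q = 2 powr (3 * (1 - \<alpha>) / 4 - 3 + (2 + \<alpha>))"
    unfolding q_def lam_def by (simp only: powr_diff powr_add)
  also have "3 * (1 - \<alpha>) / 4 - 3 + (2 + \<alpha>) = - (1 - \<alpha>) / 4" by (simp add: field_simps)
  finally have q1: "q < 1" using \<alpha> powr_less_mono[of "- (1 - \<alpha>) / 4" 0 2] by simp
  have q0: "q > 0" unfolding q_def using lam0 by simp
  have "1 \<le> (2::real) powr (2 + \<alpha>)" using \<alpha> by (intro ge_one_powr_ge_zero) auto
  then have lam1: "lam < 1" using q1 lam0 unfolding q_def
    by (meson le_less_trans less_imp_le mult_le_cancel_left1 not_le)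
  \<comment> \<open>The fixed point of the recursion: the contribution of the second differences is
    \<open>1 - q\<close> times the claimed bound.\<close>
  define C where "C = D * ((2 * pi)\<^sup>2 * 32) / (1 - q)"
  have C: "C > 0" unfolding C_def using D q1 by simp
  have "inc3 (trig A b) h \<le>
       C * L * (\<Sum>k\<in>A. (cmod (b k))\<^sup>2 * norm (wavevec k) powr (- \<beta>) * profile \<alpha> \<beta> (norm (wavevec k) * norm h))"
    if A: "finite A" and hb: "holder_bound \<beta> L (trig A b)" for A b L h
  proof -
    define S where "S = (\<lambda>h :: real^2. \<Sum>k\<in>A. (cmod (b k))\<^sup>2 * norm (wavevec k) powr (- \<beta>) * profile \<alpha> \<beta> (norm (wavevec k) * norm h))"
    have L: "0 \<le> L" using hb by (rule holder_bound_nonneg)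
    have S0: "0 \<le> S h" for h unfolding S_def by (intro sum_nonneg mult_nonneg_nonneg) auto
    have S2: "S (2 *\<^sub>R h) \<le> 2 powr (2 + \<alpha>) * S h" for h
      unfolding S_def sum_distrib_left
    proof (rule sum_mono)
      fix k
      have "(cmod (b k))\<^sup>2 * norm (wavevec k) powr (- \<beta>) * profile \<alpha> \<beta> (2 * (norm (wavevec k) * norm h)) \<le>
        (cmod (b k))\<^sup>2 * norm (wavevec k) powr (- \<beta>) * (2 powr (2 + \<alpha>) * profile \<alpha> \<beta> (norm (wavevec k) * norm h))"
        using \<alpha> \<beta> by (intro mult_left_mono profile_double) auto
      then show "(cmod (b k))\<^sup>2 * norm (wavevec k) powr (- \<beta>) * profile \<alpha> \<beta> (norm (wavevec k) * norm (2 *\<^sub>R h)) \<le>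
        2 powr (2 + \<alpha>) * ((cmod (b k))\<^sup>2 * norm (wavevec k) powr (- \<beta>) * profile \<alpha> \<beta> (norm (wavevec k) * norm h))"
        by (simp add: mult_ac)
    qed
    have rec: "inc3 (trig A b) h \<le> lam * inc3 (trig A b) (2 *\<^sub>R h) + (1 - q) * (C * L * S h)" for h
    proof -
      let ?d = "trig A (\<lambda>k. b k * (wave k h - 1)\<^sup>2)"
      have half: "trig A b (x + h) - trig A b x = ((trig A b (x + 2 *\<^sub>R h) - trig A b x) - ?d x) / 2" for x
      proof -
        have h2: "x + h + h = x + 2 *\<^sub>R h" by (simp add: scaleR_2)
        show ?thesis unfolding trig_second_increment h2 by (simp add: field_simps)
      qed
      have "inc3 (trig A b) h \<le> (LINT x|TM. lam * cmod (trig A b (x + 2 *\<^sub>R h) - trig A b x) ^ 3 + D * cmod (?d x) ^ 3)"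
        unfolding inc3_def
      proof (rule integral_mono)
        fix x
        have "cmod (trig A b (x + h) - trig A b x) \<le> (cmod (trig A b (x + 2 *\<^sub>R h) - trig A b x) + cmod (?d x)) / 2"
          unfolding half using norm_triangle_ineq4 by (simp add: norm_divide divide_right_mono)
        then have "cmod (trig A b (x + h) - trig A b x) ^ 3 \<le>
          ((cmod (trig A b (x + 2 *\<^sub>R h) - trig A b x) + cmod (?d x)) / 2) ^ 3"
          by (intro power_mono) auto
        also have "\<dots> \<le> lam * cmod (trig A b (x + 2 *\<^sub>R h) - trig A b x) ^ 3 + D * cmod (?d x) ^ 3"
          unfolding lam_def D_def by (rule cube_split) (use \<eta> in auto)
        finally show "cmod (trig A b (x + h) - trig A b x) ^ 3 \<le>
          lam * cmod (trig A b (x + 2 *\<^sub>R h) - trig A b x) ^ 3 + D * cmod (?d x) ^ 3" .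
      qed (intro integrable_TM_continuous continuous_intros)+
      also have "\<dots> = lam * inc3 (trig A b) (2 *\<^sub>R h) + D * (LINT x|TM. cmod (?d x) ^ 3)"
        unfolding inc3_def
        by (subst Bochner_Integration.integral_add) (auto intro!: integrable_TM_continuous continuous_intros)
      also have "\<dots> \<le> lam * inc3 (trig A b) (2 *\<^sub>R h) + D * ((2 * pi)\<^sup>2 * 32 * L * S h)"
        using second_increment_cube[OF A hb \<beta> \<alpha>, of h] D unfolding S_def
        by (intro add_left_mono mult_left_mono) auto
      also have "D * ((2 * pi)\<^sup>2 * 32 * L * S h) = (1 - q) * (C * L * S h)"
        using q1 by (simp add: C_def)
      finally show ?thesis .
    qed
    \<comment> \<open>The excess over the claimed bound. It obeys the recursion without a source
      term, so a bound from above uniform in \<open>h\<close> and \<open>lam < 1\<close> force it to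
      be nonpositive.\<close>
    define E where "E = (\<lambda>h. inc3 (trig A b) h - C * L * S h)"
    have Erec: "E h \<le> lam * E (2 *\<^sub>R h)" for h
    proof -
      have "C * L * (lam * S (2 *\<^sub>R h)) \<le> C * L * (q * S h)"
        using S2[of h] C L lam0 unfolding q_def
        by (intro mult_left_mono) (auto simp: mult.assoc)
      then show ?thesis using rec[of h] by (simp add: E_def algebra_simps)
    qed
    \<comment> \<open>This bound may depend on \<open>A\<close> and \<open>b\<close>, since the
      factor \<open>lam ^ n\<close> removes it in the limit.\<close>
    have bounded: "E h \<le> (2 * (\<Sum>k\<in>A. cmod (b k))) ^ 3 * (2 * pi)\<^sup>2" for h
    proof -
      have t: "cmod (trig A b x) \<le> (\<Sum>k\<in>A. cmod (b k))" for x
        unfolding trig_def by (intro sum_norm_le) (simp add: norm_mult)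
      have "cmod (trig A b (x + h) - trig A b x) ^ 3 \<le> (2 * (\<Sum>k\<in>A. cmod (b k))) ^ 3" for x
        using norm_triangle_ineq4[of "trig A b (x + h)" "trig A b x"] t[of x] t[of "x + h"]
        by (intro power_mono) auto
      then have "inc3 (trig A b) h \<le> (LINT x|TM. (2 * (\<Sum>k\<in>A. cmod (b k))) ^ 3)"
        unfolding inc3_def by (intro integral_mono integrable_TM_continuous continuous_intros) auto
      also have "\<dots> = (2 * (\<Sum>k\<in>A. cmod (b k))) ^ 3 * (2 * pi)\<^sup>2" by (simp add: measure_TM)
      finally have "inc3 (trig A b) h \<le> (2 * (\<Sum>k\<in>A. cmod (b k))) ^ 3 * (2 * pi)\<^sup>2" .
      moreover have "0 \<le> C * L * S h" using C L S0[of h] by simp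
      ultimately show ?thesis unfolding E_def by linarith
    qed
    have pow: "E h \<le> lam ^ n * E (2 ^ n *\<^sub>R h)" for n h
    proof (induction n arbitrary: h)
      case (Suc n)
      have "E h \<le> lam * E (2 *\<^sub>R h)" by (rule Erec)
      also have "\<dots> \<le> lam * (lam ^ n * E (2 ^ n *\<^sub>R (2 *\<^sub>R h)))"
        using lam0 by (intro mult_left_mono Suc) auto
      finally show ?case by (simp add: mult_ac)
    qed simp
    have "E h \<le> 0"
    proof (rule LIMSEQ_le_const)
      show "(\<lambda>n. lam ^ n * ((2 * (\<Sum>k\<in>A. cmod (b k))) ^ 3 * (2 * pi)\<^sup>2)) \<longlonglongrightarrow> 0"
        using lam0 lam1 by (intro tendsto_mult_left_zero LIMSEQ_realpow_zero) auto
      have "E h \<le> lam ^ n * ((2 * (\<Sum>k\<in>A. cmod (b k))) ^ 3 * (2 * pi)\<^sup>2)" for n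
        by (rule order_trans[OF pow[of h n] mult_left_mono[OF bounded]]) (use lam0 in simp)
      then show "\<exists>N. \<forall>n\<ge>N. E h \<le> lam ^ n * ((2 * (\<Sum>k\<in>A. cmod (b k))) ^ 3 * (2 * pi)\<^sup>2)" by blast
    qed
    then show ?thesis by (simp add: E_def S_def)
  qed
  with C show thesis by (rule that)
qed

subsection \<open>The trilinear form\<close>

text \<open>For \<open>j \<noteq> 0\<close> this is minus the cross product of the two wave vectors
  divided by the length of the first; \<open>j\<close> is the frequency of the velocity and
  \<open>k\<close> that of the gradient.\<close>

definition sqg_symbol :: "int^2 \<Rightarrow> int^2 \<Rightarrow> complex" where
  "sqg_symbol j k = riesz_symbol 1 j * partial_symbol 2 k - riesz_symbol 2 j * partial_symbol 1 k"

text \<open>The coefficient of \<open>u \<cdot> \<nabla>\<theta>\<close> at \<open>- l\<close>, times that of \<open>\<theta>\<close> at \<open>l\<close>.\<close>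

definition triad :: "(int^2) set \<Rightarrow> (int^2 \<Rightarrow> complex) \<Rightarrow> int^2 \<Rightarrow> complex" where
  "triad A a l = (\<Sum>j\<in>A. \<Sum>k\<in>A. if j + k + l = 0 then sqg_symbol j k * a j * a k * a l else 0)"

lemma partial_symbol_simps [simp]:
  "partial_symbol i 0 = 0" "partial_symbol i (- k) = - partial_symbol i k"
  "partial_symbol i (j + k) = partial_symbol i j + partial_symbol i k"
  by (auto simp: partial_symbol_def algebra_simps)

text \<open>The spectral form of incompressibility: the symbol is linear in its second argument and
  vanishes when both agree, so passing from \<open>k\<close> to \<open>l = - j - k\<close> only
  changes the sign.\<close>

lemma sqg_symbol_triad: "sqg_symbol j j = 0" "j + k + l = 0 \<Longrightarrow> sqg_symbol j l = - sqg_symbol j k"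
proof -
  show 1: "sqg_symbol j j = 0" by (simp add: sqg_symbol_def riesz_symbol_def)
  assume "j + k + l = 0"
  then have l: "l = - j + - k" by (simp add: algebra_simps add_eq_0_iff)
  have "sqg_symbol j l = - sqg_symbol j j - sqg_symbol j k"
    unfolding l by (simp only: sqg_symbol_def partial_symbol_simps) (simp add: algebra_simps)
  then show "sqg_symbol j l = - sqg_symbol j k" using 1 by simp
qed

lemma norm_riesz_symbol_le: "cmod (riesz_symbol j k) \<le> 1"
proof (cases "k = 0")
  case False
  then show ?thesis
    using component_le_norm_cart[of "wavevec k" j]
    by (simp add: riesz_symbol_def partial_symbol_def Lambda_symbol_def norm_divide norm_mult divide_le_eq)
qed (simp add: riesz_symbol_def)

lemma triad_sum:
  "(\<Sum>l\<in>A. \<phi> l * triad A a l) =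
   (\<Sum>j\<in>A. \<Sum>k\<in>A. \<Sum>l\<in>A. if j + k + l = 0 then \<phi> l * (sqg_symbol j k * a j * a k * a l) else 0)"
proof -
  have "(\<Sum>l\<in>A. \<phi> l * triad A a l) =
    (\<Sum>l\<in>A. \<Sum>j\<in>A. \<Sum>k\<in>A. if j + k + l = 0 then \<phi> l * (sqg_symbol j k * a j * a k * a l) else 0)"
    unfolding triad_def sum_distrib_left by (intro sum.cong refl) auto
  also have "\<dots> = (\<Sum>j\<in>A. \<Sum>l\<in>A. \<Sum>k\<in>A. if j + k + l = 0 then \<phi> l * (sqg_symbol j k * a j * a k * a l) else 0)"
    by (rule sum.swap)
  also have "\<dots> = (\<Sum>j\<in>A. \<Sum>k\<in>A. \<Sum>l\<in>A. if j + k + l = 0 then \<phi> l * (sqg_symbol j k * a j * a k * a l) else 0)"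
    by (rule sum.cong[OF refl], rule sum.swap)
  finally show ?thesis .
qed

text \<open>Exchanging the names \<open>k\<close> and \<open>l\<close> moves the weight to the other
  copy of \<theta>, and antisymmetry of the symbol supplies the sign.\<close>

lemma triad_sum_swap:
  "(\<Sum>l\<in>A. \<phi> l * triad A a l) =
   - (\<Sum>j\<in>A. \<Sum>k\<in>A. \<Sum>l\<in>A. if j + k + l = 0 then \<phi> k * (sqg_symbol j k * a j * a k * a l) else 0)"
proof -
  have "(\<Sum>l\<in>A. \<phi> l * triad A a l) =
    (\<Sum>j\<in>A. \<Sum>l\<in>A. \<Sum>k\<in>A. if j + k + l = 0 then \<phi> l * (sqg_symbol j k * a j * a k * a l) else 0)"
    unfolding triad_sum by (rule sum.cong[OF refl], rule sum.swap)
  also have "\<dots> = (\<Sum>j\<in>A. \<Sum>k\<in>A. \<Sum>l\<in>A. - (if j + k + l = 0 then \<phi> k * (sqg_symbol j k * a j * a k * a l) else 0))"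
  proof (intro sum.cong refl)
    fix j k l
    show "(if j + l + k = 0 then \<phi> k * (sqg_symbol j l * a j * a l * a k) else 0) =
      - (if j + k + l = 0 then \<phi> k * (sqg_symbol j k * a j * a k * a l) else 0)"
    proof (cases "j + k + l = 0")
      case True
      then have "j + l + k = 0" by (simp add: add_ac)
      with True sqg_symbol_triad(2)[OF True] show ?thesis by simp
    next
      case False
      then have "j + l + k \<noteq> 0" by (simp add: add_ac)
      with False show ?thesis by simp
    qed
  qed
  finally show ?thesis by (simp add: sum_negf)
qed

text \<open>Transport does no work in mean square: with a constant weight the swap gives the sum
  equal to its negative. Hence constants may be added to any weight.\<close>

lemma triad_total: "(\<Sum>l\<in>A. triad A a l) = 0"
proof -
  have "(\<Sum>l\<in>A. 1 * triad A a l) = - (\<Sum>l\<in>A. 1 * triad A a l)"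
    using triad_sum[of "\<lambda>_. 1" A a] triad_sum_swap[of "\<lambda>_. 1" A a] by (simp only:)
  then show ?thesis by simp
qed

text \<open>\<open>\<integral> \<delta>\<^sub>h R\<^sub>i\<theta> (\<delta>\<^sub>h\<theta>)\<^sup>2\<close>. Since the velocity is divergence free, the trilinear form with weight
  \<open>1 - heat r\<close> is, up to a factor, the Gaussian average over \<open>h\<close> of the divergence in \<open>h\<close> of this
  quantity, and integration by parts moves the divergence to the Gaussian (lemma \<open>triad_heat\<close>).\<close>

definition flux :: "(int^2) set \<Rightarrow> (int^2 \<Rightarrow> complex) \<Rightarrow> 2 \<Rightarrow> real^2 \<Rightarrow> complex" where
  "flux A a i h = (LINT x|TM. (trig A (\<lambda>k. riesz_symbol i k * a k) (x + h) - trig A (\<lambda>k. riesz_symbol i k * a k) x) *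
     ((trig A a (x + h) - trig A a x) * (trig A a (x + h) - trig A a x)))"

lemma flux_eq:
  assumes "finite A"
  shows "flux A a i h = complex_of_real ((2 * pi)\<^sup>2) * (\<Sum>j\<in>A. \<Sum>k\<in>A. \<Sum>l\<in>A. if j + k + l = 0
     then riesz_symbol i j * a j * a k * a l * ((wave j h - 1) * (wave k h - 1) * (wave l h - 1)) else 0)"
  unfolding flux_def trig_increment integral_trig_mult3[OF assms]
  by (intro arg_cong2[of _ _ _ _ "(*)"] sum.cong refl) (auto simp: mult_ac)

text \<open>On a resonant triple the three waves multiply to 1 and any two multiply to the conjugate
  of the third, so constants cancel and only single waves and conjugates remain. The moment is odd
  in the frequency; the conjugates enter with a minus sign and double it.\<close>

lemma gauss_triple_moment:
  assumes "j + k + l = 0"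
  shows "integrable gauss (\<lambda>z. complex_of_real (z $ i) *
      ((wave j (r *\<^sub>R z) - 1) * (wave k (r *\<^sub>R z) - 1) * (wave l (r *\<^sub>R z) - 1)))"
    and "(LINT z|gauss. complex_of_real (z $ i) *
      ((wave j (r *\<^sub>R z) - 1) * (wave k (r *\<^sub>R z) - 1) * (wave l (r *\<^sub>R z) - 1))) =
     complex_of_real (2 * r) * (partial_symbol i j * heat r j + partial_symbol i k * heat r k + partial_symbol i l * heat r l)"
proof -
  let ?W = "\<lambda>q z. complex_of_real (z $ i) * wave q (r *\<^sub>R z)"
  have int: "integrable gauss (?W q)" for q using integrable_gauss_wave_moment[of i q 0 r] by simp
  have val: "(LINT z|gauss. ?W q z) = r * (partial_symbol i q * heat r q)" for q
    using gauss_wave_moment[of i q 0 r] by simp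
  have eq: "complex_of_real (z $ i) * ((wave j (r *\<^sub>R z) - 1) * (wave k (r *\<^sub>R z) - 1) * (wave l (r *\<^sub>R z) - 1)) =
     ?W j z + ?W k z + ?W l z - ?W (- j) z - ?W (- k) z - ?W (- l) z" for z
  proof -
    define x where "x = r *\<^sub>R z"
    have 1: "wave j x * wave k x * wave l x = 1"
      using assms by (simp add: wave_add[symmetric])
    have "j + k = - l" "j + l = - k" "k + l = - j"
      using assms by (simp_all add: eq_neg_iff_add_eq_0 add_ac)
    then have "wave j x * wave k x = wave (- l) x" "wave j x * wave l x = wave (- k) x"
      "wave k x * wave l x = wave (- j) x"
      by (simp_all only: wave_add[symmetric])
    moreover have "(wave j x - 1) * (wave k x - 1) * (wave l x - 1) =
      wave j x * wave k x * wave l x - wave j x * wave k x - wave j x * wave l x - wave k x * wave l x +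
      wave j x + wave k x + wave l x - 1"
      by (simp add: algebra_simps)
    ultimately have "(wave j x - 1) * (wave k x - 1) * (wave l x - 1) =
      wave j x + wave k x + wave l x - wave (- j) x - wave (- k) x - wave (- l) x"
      using 1 by simp
    then show ?thesis unfolding x_def by (simp only: right_diff_distrib distrib_left)
  qed
  show "integrable gauss (\<lambda>z. complex_of_real (z $ i) *
      ((wave j (r *\<^sub>R z) - 1) * (wave k (r *\<^sub>R z) - 1) * (wave l (r *\<^sub>R z) - 1)))"
    unfolding eq by (intro Bochner_Integration.integrable_diff Bochner_Integration.integrable_add int)
  have "(LINT z|gauss. ?W j z + ?W k z + ?W l z - ?W (- j) z - ?W (- k) z - ?W (- l) z) =
     (LINT z|gauss. ?W j z) + (LINT z|gauss. ?W k z) + (LINT z|gauss. ?W l z)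
     - (LINT z|gauss. ?W (- j) z) - (LINT z|gauss. ?W (- k) z) - (LINT z|gauss. ?W (- l) z)"
    using int by (simp del: wave_simps(4))
  then show "(LINT z|gauss. complex_of_real (z $ i) *
      ((wave j (r *\<^sub>R z) - 1) * (wave k (r *\<^sub>R z) - 1) * (wave l (r *\<^sub>R z) - 1))) =
     complex_of_real (2 * r) * (partial_symbol i j * heat r j + partial_symbol i k * heat r k + partial_symbol i l * heat r l)"
    unfolding eq val by (simp add: algebra_simps)
qed

lemma gauss_flux:
  assumes A: "finite A"
  shows "integrable gauss (\<lambda>z. complex_of_real (z $ p) * flux A a i (r *\<^sub>R z))"
    and "(LINT z|gauss. complex_of_real (z $ p) * flux A a i (r *\<^sub>R z)) = complex_of_real ((2 * pi)\<^sup>2) *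
      (\<Sum>j\<in>A. \<Sum>k\<in>A. \<Sum>l\<in>A. if j + k + l = 0 then a j * a k * a l * (complex_of_real (2 * r) * (riesz_symbol i j *
        (partial_symbol p j * heat r j + partial_symbol p k * heat r k + partial_symbol p l * heat r l))) else 0)"
proof -
  define f where "f = (\<lambda>j k l z. if j + k + l = 0 then (riesz_symbol i j * a j * a k * a l) *
      (complex_of_real (z $ p) * ((wave j (r *\<^sub>R z) - 1) * (wave k (r *\<^sub>R z) - 1) * (wave l (r *\<^sub>R z) - 1))) else 0)"
  have eq: "complex_of_real (z $ p) * flux A a i (r *\<^sub>R z) =
     complex_of_real ((2 * pi)\<^sup>2) * (\<Sum>j\<in>A. \<Sum>k\<in>A. \<Sum>l\<in>A. f j k l z)" for z
  proof -
    have "complex_of_real (z $ p) * (\<Sum>j\<in>A. \<Sum>k\<in>A. \<Sum>l\<in>A. if j + k + l = 0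
     then riesz_symbol i j * a j * a k * a l * ((wave j (r *\<^sub>R z) - 1) * (wave k (r *\<^sub>R z) - 1) * (wave l (r *\<^sub>R z) - 1)) else 0)
      = (\<Sum>j\<in>A. \<Sum>k\<in>A. \<Sum>l\<in>A. f j k l z)"
      unfolding sum_distrib_left f_def by (intro sum.cong refl) (simp add: mult_ac)
    then show ?thesis unfolding flux_eq[OF A] by (subst mult.left_commute) (simp only:)
  qed
  have int: "integrable gauss (f j k l)" for j k l
    unfolding f_def by (cases "j + k + l = 0") (simp_all only: if_True if_False simp_thms integrable_mult_right gauss_triple_moment(1) integrable_zero)
  have val: "(LINT z|gauss. f j k l z) = (if j + k + l = 0 then a j * a k * a l * (complex_of_real (2 * r) * (riesz_symbol i j *
        (partial_symbol p j * heat r j + partial_symbol p k * heat r k + partial_symbol p l * heat r l))) else 0)" for j k l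
  proof (cases "j + k + l = 0")
    case True
    show ?thesis unfolding f_def if_P[OF True] integral_mult_right_zero gauss_triple_moment(2)[OF True]
      by (simp only: mult_ac)
  qed (simp add: f_def)
  show "integrable gauss (\<lambda>z. complex_of_real (z $ p) * flux A a i (r *\<^sub>R z))"
    unfolding eq by (intro integrable_mult_right Bochner_Integration.integrable_sum int)
  show "(LINT z|gauss. complex_of_real (z $ p) * flux A a i (r *\<^sub>R z)) = complex_of_real ((2 * pi)\<^sup>2) *
      (\<Sum>j\<in>A. \<Sum>k\<in>A. \<Sum>l\<in>A. if j + k + l = 0 then a j * a k * a l * (complex_of_real (2 * r) * (riesz_symbol i j *
        (partial_symbol p j * heat r j + partial_symbol p k * heat r k + partial_symbol p l * heat r l))) else 0)"
    unfolding eq val[symmetric] using int by (simp add: Bochner_Integration.integral_sum)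
qed

text \<open>The \<open>heat r j\<close> terms drop out because \<open>sqg_symbol j j = 0\<close>.
  Antisymmetry merges the other two into \<open>- (4 * r)\<close> times the sum weighted by
  \<open>heat r l\<close>, and \<open>triad_total\<close> turns \<open>- heat r l\<close> into
  \<open>1 - heat r l\<close>.\<close>

lemma triad_heat:
  assumes A: "finite A"
  shows "complex_of_real ((2 * pi)\<^sup>2) * (complex_of_real (4 * r) * (\<Sum>l\<in>A. complex_of_real (1 - heat r l) * triad A a l)) =
    (LINT z|gauss. complex_of_real (z $ 2) * flux A a 1 (r *\<^sub>R z) - complex_of_real (z $ 1) * flux A a 2 (r *\<^sub>R z))"
proof -
  let ?t = "\<lambda>j k l. sqg_symbol j k * a j * a k * a l"
  have "(LINT z|gauss. complex_of_real (z $ 2) * flux A a 1 (r *\<^sub>R z) - complex_of_real (z $ 1) * flux A a 2 (r *\<^sub>R z)) =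
    complex_of_real ((2 * pi)\<^sup>2) * (\<Sum>j\<in>A. \<Sum>k\<in>A. \<Sum>l\<in>A. if j + k + l = 0 then
       complex_of_real (2 * r) * (heat r k * ?t j k l) - complex_of_real (2 * r) * (heat r l * ?t j k l) else 0)"
    unfolding Bochner_Integration.integral_diff[OF gauss_flux(1)[OF A] gauss_flux(1)[OF A]] gauss_flux(2)[OF A]
      right_diff_distrib[symmetric] sum_subtractf[symmetric]
  proof (intro arg_cong2[of _ _ _ _ "(*)"] sum.cong refl)
    fix j k l
    let ?L = "\<lambda>i p. riesz_symbol i j * (partial_symbol p j * heat r j + partial_symbol p k * heat r k + partial_symbol p l * heat r l)"
    show "(if j + k + l = 0 then a j * a k * a l * (2 * r * ?L 1 2) else 0) -
        (if j + k + l = 0 then a j * a k * a l * (2 * r * ?L 2 1) else 0) =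
      (if j + k + l = 0 then complex_of_real (2 * r) * (heat r k * ?t j k l - heat r l * ?t j k l) else 0)"
    proof (cases "j + k + l = 0")
      case True
      have "?L 1 2 - ?L 2 1 = sqg_symbol j j * heat r j + sqg_symbol j k * heat r k + sqg_symbol j l * heat r l"
        by (simp add: sqg_symbol_def algebra_simps)
      also have "\<dots> = sqg_symbol j k * heat r k - sqg_symbol j k * heat r l"
        using sqg_symbol_triad(1)[of j] sqg_symbol_triad(2)[OF True] by simp
      finally have "a j * a k * a l * (complex_of_real (2 * r) * (?L 1 2 - ?L 2 1)) =
         a j * a k * a l * (complex_of_real (2 * r) * (sqg_symbol j k * heat r k - sqg_symbol j k * heat r l))" by simp
      then show ?thesis unfolding if_P[OF True] by (simp only: right_diff_distrib mult_ac)
    qed simp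
  qed
  also have "(\<Sum>j\<in>A. \<Sum>k\<in>A. \<Sum>l\<in>A. if j + k + l = 0 then
       complex_of_real (2 * r) * (heat r k * ?t j k l) - complex_of_real (2 * r) * (heat r l * ?t j k l) else 0) =
    complex_of_real (2 * r) * (\<Sum>j\<in>A. \<Sum>k\<in>A. \<Sum>l\<in>A. if j + k + l = 0 then heat r k * ?t j k l else 0)
    - complex_of_real (2 * r) * (\<Sum>j\<in>A. \<Sum>k\<in>A. \<Sum>l\<in>A. if j + k + l = 0 then heat r l * ?t j k l else 0)"
    unfolding sum_distrib_left sum_subtractf[symmetric] by (intro sum.cong refl) auto
  also have "\<dots> = - (complex_of_real (4 * r) * (\<Sum>l\<in>A. complex_of_real (heat r l) * triad A a l))"
    using triad_sum[of "\<lambda>l. complex_of_real (heat r l)" A a] triad_sum_swap[of "\<lambda>l. complex_of_real (heat r l)" A a]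
    by simp
  also have "\<dots> = complex_of_real (4 * r) * (\<Sum>l\<in>A. complex_of_real (1 - heat r l) * triad A a l)"
  proof -
    have "(\<Sum>l\<in>A. complex_of_real (1 - heat r l) * triad A a l) =
       (\<Sum>l\<in>A. triad A a l) - (\<Sum>l\<in>A. complex_of_real (heat r l) * triad A a l)"
      by (simp add: left_diff_distrib sum_subtractf)
    then show ?thesis unfolding triad_total by simp
  qed
  finally show ?thesis ..
qed

lemma half_line_integral_sum:
  assumes "\<And>k. k \<in> A \<Longrightarrow> set_integrable lborel {0<..} (F k)"
  shows "set_integrable lborel {0<..} (\<lambda>r. \<Sum>k\<in>A. c k * F k r)"
    and "half_line_integral (\<lambda>r. \<Sum>k\<in>A. c k * F k r) = (\<Sum>k\<in>A. c k * half_line_integral (F k))"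
proof -
  have eq: "indicator {0<..} r *\<^sub>R (\<Sum>k\<in>A. c k * F k r) = (\<Sum>k\<in>A. c k * (indicator {0<..} r *\<^sub>R F k r))" for r
    unfolding scaleR_sum_right by (simp only: mult_scaleR_right)
  have int: "integrable lborel (\<lambda>r. c k * (indicator {0<..} r *\<^sub>R F k r))" if "k \<in> A" for k
    using assms[OF that] unfolding set_integrable_def by (rule integrable_mult_right)
  show "set_integrable lborel {0<..} (\<lambda>r. \<Sum>k\<in>A. c k * F k r)"
    unfolding set_integrable_def eq using int by (rule Bochner_Integration.integrable_sum)
  show "half_line_integral (\<lambda>r. \<Sum>k\<in>A. c k * F k r) = (\<Sum>k\<in>A. c k * half_line_integral (F k))"
    unfolding half_line_integral_def set_lebesgue_integral_def eq
    by (subst Bochner_Integration.integral_sum) (use int in \<open>simp_all only: integral_mult_right_zero\<close>)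
qed

text \<open>Dominating \<open>p * q\<^sup>2\<close> by \<open>p ^ 3 + q ^ 3\<close> lets velocity
  and scalar increments be estimated separately by the same theorem.\<close>

lemma inc3_product_bound:
  assumes "finite A"
  shows "cmod (flux A a i h) \<le> inc3 (trig A (\<lambda>k. riesz_symbol i k * a k)) h + inc3 (trig A a) h"
proof -
  let ?u = "trig A (\<lambda>k. riesz_symbol i k * a k)" and ?t = "trig A a"
  have mix: "p * (q * q) \<le> p ^ 3 + q ^ 3" if "0 \<le> p" "0 \<le> q" for p q :: real
  proof (cases "p \<le> q")
    case True
    then have "p * (q * q) \<le> q * (q * q)" using that by (intro mult_right_mono) auto
    also have "\<dots> \<le> p ^ 3 + q ^ 3" using that by (simp add: power3_eq_cube)
    finally show ?thesis .
  next
    case False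
    then have "p * (q * q) \<le> p * (p * p)" using that by (intro mult_left_mono mult_mono) auto
    also have "\<dots> \<le> p ^ 3 + q ^ 3" using that by (simp add: power3_eq_cube)
    finally show ?thesis .
  qed
  have "cmod (flux A a i h) \<le> (LINT x|TM. cmod ((?u (x + h) - ?u x) * ((?t (x + h) - ?t x) * (?t (x + h) - ?t x))))"
    unfolding flux_def by (rule integral_norm_bound)
  also have "\<dots> \<le> (LINT x|TM. cmod (?u (x + h) - ?u x) ^ 3 + cmod (?t (x + h) - ?t x) ^ 3)"
  proof (rule integral_mono)
    show "cmod ((?u (x + h) - ?u x) * ((?t (x + h) - ?t x) * (?t (x + h) - ?t x))) \<le>
      cmod (?u (x + h) - ?u x) ^ 3 + cmod (?t (x + h) - ?t x) ^ 3" for x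
      unfolding norm_mult by (rule mix) auto
  qed (intro integrable_TM_continuous continuous_intros)+
  also have "\<dots> = inc3 ?u h + inc3 ?t h"
    unfolding inc3_def
    by (subst Bochner_Integration.integral_add) (auto intro!: integrable_TM_continuous continuous_intros)
  finally show ?thesis .
qed

text \<open>Being a minimum of powers, the profile separates the deterministic scale from the
  Gaussian length \<open>t\<close>. The extra factor \<open>t\<close> is the coordinate left over
  from the integration by parts.\<close>

lemma profile_mult_le:
  assumes "0 \<le> \<rho>" "0 \<le> t" "0 < \<beta>" "\<beta> < 1" "0 < \<alpha>" "\<alpha> < 1"
  shows "t * profile \<alpha> \<beta> (\<rho> * t) \<le> 2 * (1 + t ^ 8) * profile \<alpha> \<beta> \<rho>"
proof -
  have t1: "t * t powr \<beta> \<le> 1 + t ^ 8" and t2: "t * t powr (2 + \<alpha>) \<le> 1 + t ^ 8"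
  proof -
    have eq: "t * t powr p = t powr (1 + p)" for p
      using assms(2) by (cases "t = 0") (simp_all add: powr_add)
    show "t * t powr \<beta> \<le> 1 + t ^ 8" "t * t powr (2 + \<alpha>) \<le> 1 + t ^ 8"
      unfolding eq using assms by (intro powr_le_1_plus; simp)+
  qed
  have "t * profile \<alpha> \<beta> (\<rho> * t) = min (\<rho> powr \<beta> * (t * t powr \<beta>)) (\<rho> powr (2 + \<alpha>) * (t * t powr (2 + \<alpha>)))"
    using assms by (simp add: profile_def powr_mult min_mult_distrib_left mult_ac)
  also have "\<dots> \<le> min (\<rho> powr \<beta> * (1 + t ^ 8)) (\<rho> powr (2 + \<alpha>) * (1 + t ^ 8))"
    by (intro min.mono mult_left_mono t1 t2) auto
  also have "\<dots> = (1 + t ^ 8) * profile \<alpha> \<beta> \<rho>"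
    by (simp add: profile_def min_mult_distrib_left mult.commute)
  also have "\<dots> \<le> 2 * (1 + t ^ 8) * profile \<alpha> \<beta> \<rho>"
    by (intro mult_right_mono) auto
  finally show ?thesis .
qed

text \<open>Scaling contributes \<open>\<kappa> powr (1 + 2 * \<alpha>)\<close>, which together with
  the weight \<open>norm (wavevec k) powr (- \<beta>)\<close> of the increment bound makes up the
  exponent \<open>2 * \<alpha> + 1 - \<beta>\<close>.\<close>

lemma profile_integral:
  assumes "0 < \<beta>" "\<beta> < 1" "0 < \<alpha>" "\<alpha> < 1"
  obtains P where "0 < P"
    "\<And>\<kappa>. 0 \<le> \<kappa> \<Longrightarrow> set_integrable lborel {0<..} (\<lambda>r. r powr (- (2 + 2 * \<alpha>)) * profile \<alpha> \<beta> (\<kappa> * r))"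
    "\<And>\<kappa>. 0 \<le> \<kappa> \<Longrightarrow> half_line_integral (\<lambda>r. r powr (- (2 + 2 * \<alpha>)) * profile \<alpha> \<beta> (\<kappa> * r)) = \<kappa> powr (1 + 2 * \<alpha>) * P"
proof -
  let ?F = "\<lambda>r. r powr (- (2 + 2 * \<alpha>)) * profile \<alpha> \<beta> r"
  have int: "set_integrable lborel {0<..} ?F"
  proof (rule set_integrable_half_line_bound)
    show "set_integrable lborel {0<..} (\<lambda>r. min (r powr (- \<alpha>)) (r powr (\<beta> - 2 - 2 * \<alpha>)))"
      using assms by (intro set_integrable_min_powr) auto
    show "?F \<in> borel_measurable borel" unfolding profile_def by measurable
    fix r :: real assume r: "r > 0"
    have "r powr (- (2 + 2 * \<alpha>)) * r powr \<beta> = r powr (\<beta> - 2 - 2 * \<alpha>)"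
      "r powr (- (2 + 2 * \<alpha>)) * r powr (2 + \<alpha>) = r powr (- \<alpha>)"
      by (simp_all only: powr_add[symmetric]) (simp_all add: algebra_simps)
    then have "?F r = min (r powr (- \<alpha>)) (r powr (\<beta> - 2 - 2 * \<alpha>))"
      by (simp only: profile_def min_mult_distrib_left powr_ge_zero if_True min.commute)
    then show "\<bar>?F r\<bar> \<le> min (r powr (- \<alpha>)) (r powr (\<beta> - 2 - 2 * \<alpha>))" by simp
  qed
  define P where "P = half_line_integral ?F"
  have "0 < P" unfolding P_def by (rule half_line_integral_pos[OF int]) (auto simp: profile_def)
  moreover have "set_integrable lborel {0<..} (\<lambda>r. r powr (- (2 + 2 * \<alpha>)) * profile \<alpha> \<beta> (\<kappa> * r)) \<and>
    half_line_integral (\<lambda>r. r powr (- (2 + 2 * \<alpha>)) * profile \<alpha> \<beta> (\<kappa> * r)) = \<kappa> powr (1 + 2 * \<alpha>) * P" if "0 \<le> \<kappa>" for \<kappa>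
  proof (cases "\<kappa> = 0")
    case True
    then show ?thesis
      by (simp add: profile_def half_line_integral_def set_integrable_def set_lebesgue_integral_def)
  next
    case False
    then have \<kappa>: "\<kappa> > 0" using that by simp
    have e: "2 + 2 * \<alpha> - 1 = 1 + 2 * \<alpha>" by simp
    show ?thesis using half_line_scaling[OF \<kappa> int] unfolding P_def e by (rule conjI)
  qed
  ultimately show thesis using that by blast
qed

text \<open>Integrate the form with weight \<open>1 - heat r l\<close> against
  \<open>r powr (- (1 + 2 * \<alpha>))\<close>. On the left this restores the weight of
  \<open>\<Lambda>\<^sup>2\<^sup>\<alpha>\<close>; on the right the \<open>1 / r\<close> from the
  integration by parts raises the singularity to \<open>r powr (- (2 + 2 * \<alpha>))\<close>, which
  the profile still absorbs.\<close>

theorem trilinear_bound: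
  assumes \<beta>: "0 < \<beta>" "\<beta> < 1" and \<alpha>: "0 < \<alpha>" "\<alpha> < 1"
  obtains C where "C > 0"
    "\<And>A a K. finite A \<Longrightarrow> holder_bound \<beta> K (trig A a) \<Longrightarrow>
       cmod (\<Sum>l\<in>A. complex_of_real (norm (wavevec l) powr (2 * \<alpha>)) * triad A a l) \<le>
       C * K * (\<Sum>k\<in>A. (cmod (a k))\<^sup>2 * norm (wavevec k) powr (2 * \<alpha> + 1 - \<beta>))"
proof -
  obtain CR where CR: "CR > 0" "\<And>A a K j. finite A \<Longrightarrow> holder_bound \<beta> K (trig A a) \<Longrightarrow>
        holder_bound \<beta> (CR * K) (trig A (\<lambda>k. riesz_symbol j k * a k))"
    using riesz_holder[OF \<beta>] by blast
  obtain CI where CI: "CI > 0" "\<And>A b L h. finite A \<Longrightarrow> holder_bound \<beta> L (trig A b) \<Longrightarrow> inc3 (trig A b) h \<le>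
       CI * L * (\<Sum>k\<in>A. (cmod (b k))\<^sup>2 * norm (wavevec k) powr (- \<beta>) * profile \<alpha> \<beta> (norm (wavevec k) * norm h))"
    using increment_cube_bound[OF \<beta> \<alpha>] by blast
  obtain P where P: "0 < P"
    "\<And>\<kappa>. 0 \<le> \<kappa> \<Longrightarrow> set_integrable lborel {0<..} (\<lambda>r. r powr (- (2 + 2 * \<alpha>)) * profile \<alpha> \<beta> (\<kappa> * r))"
    "\<And>\<kappa>. 0 \<le> \<kappa> \<Longrightarrow> half_line_integral (\<lambda>r. r powr (- (2 + 2 * \<alpha>)) * profile \<alpha> \<beta> (\<kappa> * r)) = \<kappa> powr (1 + 2 * \<alpha>) * P"
    using profile_integral[OF \<beta> \<alpha>] by blast
  \<comment> \<open>Velocity increments come with Hoelder constant \<open>CR * K\<close>, those of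
    the scalar with \<open>K\<close>, and \<open>inc3_product_bound\<close> adds the two. In
    \<open>C1\<close> the denominator is the factor of \<open>triad_heat\<close>, the numerator
    stems from its two flux terms.\<close>
  define C0 where "C0 = CI * (CR + 1)"
  define C1 where "C1 = 4 * C0 * gauss_moment / (4 * (2 * pi)\<^sup>2)"
  have C0: "C0 > 0" using CI(1) CR(1) by (simp add: C0_def)
  have C1: "C1 > 0" using C0 gauss_moment_ge_1 by (simp add: C1_def)
  define C where "C = C1 * P / frac_const \<alpha>"
  have frac: "0 < frac_const \<alpha>" using \<alpha> by (rule frac_const_pos)
  have C: "C > 0" using C1 P(1) frac by (simp add: C_def)
  have "cmod (\<Sum>l\<in>A. complex_of_real (norm (wavevec l) powr (2 * \<alpha>)) * triad A a l) \<le>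
       C * K * (\<Sum>k\<in>A. (cmod (a k))\<^sup>2 * norm (wavevec k) powr (2 * \<alpha> + 1 - \<beta>))"
    if A: "finite A" and hb: "holder_bound \<beta> K (trig A a)" for A a K
  proof -
    have K: "0 \<le> K" using hb by (rule holder_bound_nonneg)
    define c where "c = (\<lambda>k. (cmod (a k))\<^sup>2 * norm (wavevec k) powr (- \<beta>))"
    have c0: "0 \<le> c k" for k by (simp add: c_def)
    define S where "S = (\<lambda>\<rho>. \<Sum>k\<in>A. c k * profile \<alpha> \<beta> (norm (wavevec k) * \<rho>))"
    have S0: "0 \<le> S \<rho>" for \<rho> unfolding S_def by (intro sum_nonneg mult_nonneg_nonneg c0) auto
    have flux: "cmod (flux A a i h) \<le> C0 * K * S (norm h)" for i h
    proof -
      let ?b = "\<lambda>k. riesz_symbol i k * a k"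
      have "inc3 (trig A ?b) h \<le> CI * (CR * K) * (\<Sum>k\<in>A. (cmod (?b k))\<^sup>2 * norm (wavevec k) powr (- \<beta>) * profile \<alpha> \<beta> (norm (wavevec k) * norm h))"
        by (intro CI(2) CR(2) A hb)
      also have "\<dots> \<le> CI * (CR * K) * S (norm h)"
      proof -
        have "(cmod (?b k))\<^sup>2 \<le> (cmod (a k))\<^sup>2" for k
          using norm_riesz_symbol_le[of i k] by (intro power_mono) (auto simp: norm_mult mult_left_le_one_le)
        then show ?thesis using CI(1) CR(1) K unfolding S_def c_def
          by (intro mult_left_mono sum_mono mult_right_mono) auto
      qed
      finally have 1: "inc3 (trig A ?b) h \<le> CI * (CR * K) * S (norm h)" .
      have 2: "inc3 (trig A a) h \<le> CI * K * S (norm h)"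
        unfolding S_def c_def by (intro CI(2) A hb)
      have "cmod (flux A a i h) \<le> CI * (CR * K) * S (norm h) + CI * K * S (norm h)"
        using inc3_product_bound[OF A, of a i h] 1 2 by linarith
      then show ?thesis by (simp add: C0_def algebra_simps)
    qed
    have pw: "cmod (complex_of_real (z $ p) * flux A a i (r *\<^sub>R z)) \<le> 2 * (C0 * K * S r) * (1 + norm z ^ 8)"
      if r: "r > 0" for p i r z
    proof -
      have "cmod (complex_of_real (z $ p) * flux A a i (r *\<^sub>R z)) \<le> norm z * (C0 * K * S (norm (r *\<^sub>R z)))"
        unfolding norm_mult norm_of_real by (intro mult_mono flux component_le_norm_cart) auto
      also have "\<dots> = C0 * K * (\<Sum>k\<in>A. c k * (norm z * profile \<alpha> \<beta> (norm (wavevec k) * r * norm z)))"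
        unfolding S_def using r by (simp add: sum_distrib_left mult_ac)
      also have "\<dots> \<le> C0 * K * (\<Sum>k\<in>A. c k * (2 * (1 + norm z ^ 8) * profile \<alpha> \<beta> (norm (wavevec k) * r)))"
        using C0 K c0 r \<alpha> \<beta> by (intro mult_left_mono sum_mono profile_mult_le) auto
      also have "\<dots> = 2 * (C0 * K * S r) * (1 + norm z ^ 8)"
        unfolding S_def by (simp only: sum_distrib_left sum_distrib_right mult_ac)
      finally show ?thesis .
    qed
    define T where "T = (\<lambda>r. \<Sum>l\<in>A. complex_of_real (1 - heat r l) * triad A a l)"
    have T: "cmod (T r) \<le> C1 * K * S r / r" if r: "r > 0" for r
    proof -
      have "4 * (2 * pi)\<^sup>2 * r * cmod (T r) = cmod (complex_of_real ((2 * pi)\<^sup>2) * (4 * r * T r))"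
        using r by (simp add: norm_mult norm_power)
      also have "\<dots> = cmod (LINT z|gauss. complex_of_real (z $ 2) * flux A a 1 (r *\<^sub>R z) - complex_of_real (z $ 1) * flux A a 2 (r *\<^sub>R z))"
        unfolding T_def triad_heat[OF A] ..
      also have "\<dots> \<le> 4 * (C0 * K * S r) * gauss_moment"
      proof (rule gauss_integral_bound)
        show "(\<lambda>z. complex_of_real (z $ 2) * flux A a 1 (r *\<^sub>R z) - complex_of_real (z $ 1) * flux A a 2 (r *\<^sub>R z)) \<in> borel_measurable borel"
          using borel_measurable_integrable[OF Bochner_Integration.integrable_diff[OF gauss_flux(1)[OF A] gauss_flux(1)[OF A]]]
          unfolding measurable_gauss .
        show "cmod (complex_of_real (z $ 2) * flux A a 1 (r *\<^sub>R z) - complex_of_real (z $ 1) * flux A a 2 (r *\<^sub>R z)) \<le>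
            4 * (C0 * K * S r) * (1 + norm z ^ 8)" for z
          using pw[OF r, of z 2 1] pw[OF r, of z 1 2]
            norm_triangle_ineq4[of "complex_of_real (z $ 2) * flux A a 1 (r *\<^sub>R z)" "complex_of_real (z $ 1) * flux A a 2 (r *\<^sub>R z)"]
          by linarith
      qed
      finally have "cmod (T r) * (4 * (2 * pi)\<^sup>2 * r) \<le> 4 * (C0 * K * S r) * gauss_moment" by (simp only: mult_ac)
      then have "cmod (T r) \<le> 4 * (C0 * K * S r) * gauss_moment / (4 * (2 * pi)\<^sup>2 * r)"
        using r by (subst pos_le_divide_eq) auto
      also have "\<dots> = C1 * K * S r / r" by (simp add: C1_def mult_ac)
      finally show ?thesis .
    qed
    let ?w = "\<lambda>r. r powr (- (1 + 2 * \<alpha>))"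
    have wt: "set_integrable lborel {0<..} (\<lambda>r. complex_of_real (?w r * (1 - heat r l)))"
      "(LINT r:{0<..}|lborel. complex_of_real (?w r * (1 - heat r l))) = complex_of_real (norm (wavevec l) powr (2 * \<alpha>) * frac_const \<alpha>)" for l
    proof -
      have i: "set_integrable lborel {0<..} (\<lambda>r. ?w r * (1 - heat r l))"
        by (rule frac_integral(2)[OF \<alpha> norm_ge_zero])
      have v: "half_line_integral (\<lambda>r. ?w r * (1 - heat r l)) = norm (wavevec l) powr (2 * \<alpha>) * frac_const \<alpha>"
        by (rule frac_integral(3)[OF \<alpha> norm_ge_zero])
      have eq: "indicator {0<..} r *\<^sub>R complex_of_real (?w r * (1 - heat r l)) =
         complex_of_real (indicator {0<..} r *\<^sub>R (?w r * (1 - heat r l)))" for r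
        by (simp add: scaleR_conv_of_real)
      show "set_integrable lborel {0<..} (\<lambda>r. complex_of_real (?w r * (1 - heat r l)))"
        unfolding set_integrable_def eq using i[unfolded set_integrable_def] by (rule integrable_of_real)
      show "(LINT r:{0<..}|lborel. complex_of_real (?w r * (1 - heat r l))) = complex_of_real (norm (wavevec l) powr (2 * \<alpha>) * frac_const \<alpha>)"
        unfolding set_lebesgue_integral_def eq integral_complex_of_real v[unfolded half_line_integral_def set_lebesgue_integral_def] ..
    qed
    have wT: "?w r * T r = (\<Sum>l\<in>A. triad A a l * complex_of_real (?w r * (1 - heat r l)))" for r
      unfolding T_def by (simp add: sum_distrib_left mult_ac)
    have intT: "set_integrable lborel {0<..} (\<lambda>r. ?w r * T r)"
    proof -
      have "integrable lborel (\<lambda>r. \<Sum>l\<in>A. triad A a l * (indicator {0<..} r *\<^sub>R complex_of_real (?w r * (1 - heat r l))))"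
        using wt(1) unfolding set_integrable_def
        by (intro Bochner_Integration.integrable_sum integrable_mult_right) auto
      then show ?thesis unfolding set_integrable_def wT scaleR_sum_right by (simp only: mult_scaleR_right)
    qed
    have "frac_const \<alpha> * (\<Sum>l\<in>A. complex_of_real (norm (wavevec l) powr (2 * \<alpha>)) * triad A a l) =
      (\<Sum>l\<in>A. triad A a l * (LINT r:{0<..}|lborel. complex_of_real (?w r * (1 - heat r l))))"
      unfolding wt(2) by (simp add: sum_distrib_left mult_ac)
    also have "\<dots> = (LINT r|lborel. (\<Sum>l\<in>A. triad A a l * (indicator {0<..} r *\<^sub>R complex_of_real (?w r * (1 - heat r l)))))"
    proof -
      have "integrable lborel (\<lambda>r. triad A a l * (indicator {0<..} r *\<^sub>R complex_of_real (?w r * (1 - heat r l))))" for l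
        using wt(1) unfolding set_integrable_def by (rule integrable_mult_right)
      then show ?thesis unfolding set_lebesgue_integral_def
        by (subst Bochner_Integration.integral_sum) (simp_all only: integral_mult_right_zero)
    qed
    also have "\<dots> = (LINT r:{0<..}|lborel. ?w r * T r)"
      unfolding set_lebesgue_integral_def wT scaleR_sum_right by (simp only: mult_scaleR_right)
    finally have "cmod (frac_const \<alpha> * (\<Sum>l\<in>A. complex_of_real (norm (wavevec l) powr (2 * \<alpha>)) * triad A a l)) =
      cmod (LINT r:{0<..}|lborel. ?w r * T r)"
      by (rule arg_cong)
    then have "frac_const \<alpha> * cmod (\<Sum>l\<in>A. complex_of_real (norm (wavevec l) powr (2 * \<alpha>)) * triad A a l) =
      cmod (LINT r:{0<..}|lborel. ?w r * T r)"
      using frac by (simp only: norm_mult norm_of_real abs_of_pos)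
    also have "\<dots> \<le> (LINT r:{0<..}|lborel. cmod (?w r * T r))"
      unfolding set_lebesgue_integral_def by (rule order_trans[OF integral_norm_bound]) simp
    also have "\<dots> \<le> half_line_integral (\<lambda>r. \<Sum>k\<in>A. C1 * K * c k * (r powr (- (2 + 2 * \<alpha>)) * profile \<alpha> \<beta> (norm (wavevec k) * r)))"
      unfolding half_line_integral_def
    proof (rule set_integral_mono)
      show "set_integrable lborel {0<..} (\<lambda>r. cmod (?w r * T r))" using intT by (rule set_integrable_norm)
      show "set_integrable lborel {0<..} (\<lambda>r. \<Sum>k\<in>A. C1 * K * c k * (r powr (- (2 + 2 * \<alpha>)) * profile \<alpha> \<beta> (norm (wavevec k) * r)))"
        by (rule half_line_integral_sum(1)[OF P(2)[OF norm_ge_zero]])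
      fix r :: real assume "r \<in> {0<..}"
      then have r: "r > 0" by simp
      have "cmod (?w r * T r) \<le> ?w r * (C1 * K * S r / r)"
        unfolding norm_mult using T[OF r] by (intro mult_mono) auto
      also have "?w r * (C1 * K * S r / r) = C1 * K * (r powr (- (2 + 2 * \<alpha>)) * S r)"
      proof -
        have "r powr (- (2 + 2 * \<alpha>)) = ?w r / r"
          using r powr_diff[of r "- (1 + 2 * \<alpha>)" 1] by (simp add: algebra_simps)
        then show ?thesis by simp
      qed
      also have "\<dots> = (\<Sum>k\<in>A. C1 * K * c k * (r powr (- (2 + 2 * \<alpha>)) * profile \<alpha> \<beta> (norm (wavevec k) * r)))"
        unfolding S_def by (simp add: sum_distrib_left mult_ac)
      finally show "cmod (?w r * T r) \<le> (\<Sum>k\<in>A. C1 * K * c k * (r powr (- (2 + 2 * \<alpha>)) * profile \<alpha> \<beta> (norm (wavevec k) * r)))" .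
    qed
    also have "\<dots> = (\<Sum>k\<in>A. C1 * K * c k * half_line_integral (\<lambda>r. r powr (- (2 + 2 * \<alpha>)) * profile \<alpha> \<beta> (norm (wavevec k) * r)))"
      by (rule half_line_integral_sum(2)[OF P(2)[OF norm_ge_zero]])
    also have "\<dots> = C1 * K * P * (\<Sum>k\<in>A. (cmod (a k))\<^sup>2 * norm (wavevec k) powr (2 * \<alpha> + 1 - \<beta>))"
    proof -
      have e: "norm (wavevec k) powr (2 * \<alpha> + 1 - \<beta>) = norm (wavevec k) powr (- \<beta>) * norm (wavevec k) powr (1 + 2 * \<alpha>)" for k
        by (simp flip: powr_add add: algebra_simps)
      show ?thesis unfolding P(3)[OF norm_ge_zero] c_def e sum_distrib_left
        by (simp only: mult_ac)
    qed
    finally show ?thesis unfolding C_def using frac by (simp add: field_simps)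
  qed
  with C show thesis by (rule that)
qed

section \<open>Low Sobolev norms of Hoelder functions and absorption into the dissipation\<close>

lemma gauss_increment_square:
  assumes A: "finite A" and hb: "holder_bound \<beta> K (trig A a)" and \<beta>: "0 < \<beta>" "\<beta> < 1" and r: "r > 0"
  shows "(\<Sum>k\<in>A. (cmod (a k))\<^sup>2 * (1 - heat r k)) \<le> gauss_moment * K\<^sup>2 * r powr (2 * \<beta>)"
proof -
  have K: "0 \<le> K" using hb by (rule holder_bound_nonneg)
  \<comment> \<open>Its Gaussian average is \<open>2 - 2 * heat r k\<close>: mean squares of
    increments yield the weight \<open>1 - heat r k\<close> by Parseval.\<close>
  have sq: "(cmod (wave k h - 1))\<^sup>2 = 2 - 2 * Re (wave k h)" for k h
  proof -
    have "(cmod (wave k h))\<^sup>2 = 1" by simp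
    then have "(Re (wave k h))\<^sup>2 + (Im (wave k h))\<^sup>2 = 1" by (simp only: cmod_power2)
    then show ?thesis by (simp add: cmod_power2 power2_diff)
  qed
  have incr: "(\<Sum>k\<in>A. (cmod (a k))\<^sup>2 * (cmod (wave k h - 1))\<^sup>2) \<le> K\<^sup>2 * norm h powr (2 * \<beta>)" for h
  proof -
    have "(2 * pi)\<^sup>2 * (\<Sum>k\<in>A. (cmod (a k))\<^sup>2 * (cmod (wave k h - 1))\<^sup>2) = sqnorm (trig A (\<lambda>k. a k * (wave k h - 1)))"
      by (simp add: trig_parseval[OF A] norm_mult power_mult_distrib)
    also have "\<dots> \<le> sqnorm (\<lambda>x. complex_of_real (K * norm h powr \<beta>))"
    proof (rule sqnorm_mono[OF trig_L2 L2_const])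
      fix x
      have "cmod (trig A a (x + h) - trig A a x) \<le> K * norm h powr \<beta>"
        using hb unfolding holder_bound_def by (metis add_diff_cancel_left')
      then show "cmod (trig A (\<lambda>k. a k * (wave k h - 1)) x) \<le> cmod (complex_of_real (K * norm h powr \<beta>))"
        unfolding trig_increment norm_of_real by (rule order_trans[OF _ abs_ge_self])
    qed
    also have "\<dots> = (2 * pi)\<^sup>2 * (K * norm h powr \<beta>)\<^sup>2"
      unfolding sqnorm_def norm_of_real power2_abs by (simp add: measure_TM)
    also have "(K * norm h powr \<beta>)\<^sup>2 = K\<^sup>2 * norm h powr (2 * \<beta>)"
    proof -
      have "(norm h powr \<beta>)\<^sup>2 = norm h powr (2 * \<beta>)"
        unfolding power2_eq_square mult_2 by (rule powr_add[symmetric])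
      then show ?thesis by (simp only: power_mult_distrib)
    qed
    finally show ?thesis by (rule mult_left_le_imp_le) simp
  qed
  have intw: "integrable gauss (\<lambda>z. wave k (r *\<^sub>R z))" for k
    by (rule integrable_gauss_bounded[of _ 1]) (auto intro!: borel_measurable_continuous_onI continuous_intros)
  have valw: "(LINT z|gauss. Re (wave k (r *\<^sub>R z))) = heat r k" for k
    using gauss_wave[of k 0 r] integral_Re[OF intw[of k]] by simp
  have "2 * (\<Sum>k\<in>A. (cmod (a k))\<^sup>2 * (1 - heat r k)) =
     (LINT z|gauss. (\<Sum>k\<in>A. (cmod (a k))\<^sup>2 * (2 - 2 * Re (wave k (r *\<^sub>R z)))))"
  proof -
    have e: "(LINT z|gauss. 2 - 2 * Re (wave k (r *\<^sub>R z))) = 2 - 2 * heat r k" for k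
    proof -
      have "(LINT z|gauss. 2 - 2 * Re (wave k (r *\<^sub>R z))) = (LINT z|gauss. 2) - 2 * (LINT z|gauss. Re (wave k (r *\<^sub>R z)))"
        using integrable_Re[OF intw[of k]] by simp
      then show ?thesis using gauss.prob_space unfolding valw by simp
    qed
    have "(LINT z|gauss. (\<Sum>k\<in>A. (cmod (a k))\<^sup>2 * (2 - 2 * Re (wave k (r *\<^sub>R z))))) =
       (\<Sum>k\<in>A. (cmod (a k))\<^sup>2 * (LINT z|gauss. 2 - 2 * Re (wave k (r *\<^sub>R z))))"
      using integrable_Re[OF intw] by (subst Bochner_Integration.integral_sum) auto
    also have "\<dots> = (\<Sum>k\<in>A. (cmod (a k))\<^sup>2 * (2 - 2 * heat r k))" unfolding e ..
    finally show ?thesis by (simp add: sum_distrib_left algebra_simps)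
  qed
  also have "\<dots> \<le> norm (LINT z|gauss. (\<Sum>k\<in>A. (cmod (a k))\<^sup>2 * (2 - 2 * Re (wave k (r *\<^sub>R z)))))" by simp
  also have "\<dots> \<le> K\<^sup>2 * r powr (2 * \<beta>) * gauss_moment"
  proof (rule gauss_integral_bound)
    show "(\<lambda>z. \<Sum>k\<in>A. (cmod (a k))\<^sup>2 * (2 - 2 * Re (wave k (r *\<^sub>R z)))) \<in> borel_measurable borel"
      by (intro borel_measurable_continuous_onI continuous_intros)
    fix z :: "real^2"
    have "0 \<le> (\<Sum>k\<in>A. (cmod (a k))\<^sup>2 * (cmod (wave k (r *\<^sub>R z) - 1))\<^sup>2)" by (intro sum_nonneg) auto
    then have "norm (\<Sum>k\<in>A. (cmod (a k))\<^sup>2 * (2 - 2 * Re (wave k (r *\<^sub>R z)))) =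
       (\<Sum>k\<in>A. (cmod (a k))\<^sup>2 * (cmod (wave k (r *\<^sub>R z) - 1))\<^sup>2)"
      unfolding sq by simp
    also have "\<dots> \<le> K\<^sup>2 * norm (r *\<^sub>R z) powr (2 * \<beta>)" by (rule incr)
    also have "\<dots> = K\<^sup>2 * r powr (2 * \<beta>) * norm z powr (2 * \<beta>)" using r by (simp add: powr_mult)
    also have "\<dots> \<le> K\<^sup>2 * r powr (2 * \<beta>) * (1 + norm z ^ 8)"
      using \<beta> by (intro mult_left_mono powr_le_1_plus) auto
    finally show "norm (\<Sum>k\<in>A. (cmod (a k))\<^sup>2 * (2 - 2 * Re (wave k (r *\<^sub>R z)))) \<le>
      K\<^sup>2 * r powr (2 * \<beta>) * (1 + norm z ^ 8)" .
  qed
  finally have "2 * (\<Sum>k\<in>A. (cmod (a k))\<^sup>2 * (1 - heat r k)) \<le> gauss_moment * K\<^sup>2 * r powr (2 * \<beta>)" by (simp only: mult_ac)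
  moreover have "0 \<le> (\<Sum>k\<in>A. (cmod (a k))\<^sup>2 * (1 - heat r k))" by (intro sum_nonneg) auto
  ultimately show ?thesis by linarith
qed

text \<open>Represent the weight as an integral over scales. Near zero the Hoelder bound gives
  \<open>r powr (2 * \<beta>)\<close>, integrable because \<open>\<beta>' < \<beta>\<close>; at
  infinity a bound uniform in \<open>r\<close> is enough.\<close>

lemma low_norm_bound:
  assumes \<beta>: "0 < \<beta>" "\<beta> < 1" and \<beta>': "0 < \<beta>'" "\<beta>' < \<beta>"
  obtains C where "C > 0"
    "\<And>A a K. finite A \<Longrightarrow> holder_bound \<beta> K (trig A a) \<Longrightarrow>
       (\<Sum>k\<in>A. (cmod (a k))\<^sup>2 * norm (wavevec k) powr (2 * \<beta>')) \<le> C * K\<^sup>2"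
proof -
  let ?G = "\<lambda>r::real. min (r powr (2 * \<beta> - (1 + 2 * \<beta>'))) (r powr (- (1 + 2 * \<beta>')))"
  have intG: "set_integrable lborel {0<..} ?G" using \<beta> \<beta>' by (intro set_integrable_min_powr) auto
  \<comment> \<open>A lower bound for \<open>1 - heat 1 k\<close> over all
    \<open>k \<noteq> 0\<close>, from the spectral gap.\<close>
  define e where "e = 1 - exp (- 1 / 2 :: real)"
  have e: "0 < e" "e \<le> 1" by (auto simp: e_def)
  define c1 where "c1 = gauss_moment / e"
  have c1: "c1 > 0" using e gauss_moment_ge_1 by (simp add: c1_def)
  have \<beta>'1: "\<beta>' < 1" using \<beta> \<beta>' by simp
  note fr = frac_const_pos[OF \<beta>'(1) \<beta>'1]
  define C where "C = c1 * half_line_integral ?G / frac_const \<beta>'"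
  have Gpos: "0 < half_line_integral ?G" by (rule half_line_integral_pos[OF intG]) simp
  have C: "C > 0" using c1 Gpos fr by (simp add: C_def)
  have "(\<Sum>k\<in>A. (cmod (a k))\<^sup>2 * norm (wavevec k) powr (2 * \<beta>')) \<le> C * K\<^sup>2"
    if A: "finite A" and hb: "holder_bound \<beta> K (trig A a)" for A a K
  proof -
    define S where "S = (\<lambda>r. \<Sum>k\<in>A. (cmod (a k))\<^sup>2 * (1 - heat r k))"
    have g1: "gauss_moment \<le> c1" using e gauss_moment_ge_1 by (simp add: c1_def le_divide_eq mult_left_le)
    have S1: "S r \<le> c1 * K\<^sup>2 * r powr (2 * \<beta>)" if "r > 0" for r
    proof -
      have "S r \<le> gauss_moment * K\<^sup>2 * r powr (2 * \<beta>)"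
        unfolding S_def by (rule gauss_increment_square[OF A hb \<beta> that])
      also have "\<dots> \<le> c1 * K\<^sup>2 * r powr (2 * \<beta>)" by (intro mult_right_mono g1) auto
      finally show ?thesis .
    qed
    have S2: "S r \<le> c1 * K\<^sup>2" for r
    proof -
      \<comment> \<open>Every scale is compared with scale 1, which makes the bound uniform in
        \<open>r\<close>.\<close>
      have "e * S r \<le> S 1"
        unfolding S_def sum_distrib_left
      proof (rule sum_mono)
        fix k
        have "e * (1 - heat r k) \<le> 1 - heat 1 k"
        proof (cases "k = 0")
          case False
          have "1 \<le> (norm (wavevec k))\<^sup>2" using one_le_norm_wavevec[OF False] by simp
          then have "heat 1 k \<le> exp (- 1 / 2)" by simp
          then have "e \<le> 1 - heat 1 k" by (simp add: e_def)
          moreover have "e * (1 - heat r k) \<le> e * 1" using e by (intro mult_left_mono) auto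
          ultimately show ?thesis by simp
        qed simp
        then have "(cmod (a k))\<^sup>2 * (e * (1 - heat r k)) \<le> (cmod (a k))\<^sup>2 * (1 - heat 1 k)"
          by (intro mult_left_mono) auto
        then show "e * ((cmod (a k))\<^sup>2 * (1 - heat r k)) \<le> (cmod (a k))\<^sup>2 * (1 - heat 1 k)"
          by (simp only: mult.left_commute)
      qed
      also have "\<dots> \<le> gauss_moment * K\<^sup>2 * 1 powr (2 * \<beta>)"
        unfolding S_def by (rule gauss_increment_square[OF A hb \<beta>]) simp
      finally have "S r * e \<le> gauss_moment * K\<^sup>2" by (simp add: mult.commute)
      then have "S r \<le> gauss_moment * K\<^sup>2 / e" using e(1) by (subst pos_le_divide_eq) auto
      then show ?thesis by (simp add: c1_def)
    qed
    let ?w = "\<lambda>r. r powr (- (1 + 2 * \<beta>'))"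
    have ints: "set_integrable lborel {0<..} (\<lambda>r. ?w r * (1 - heat r k))" for k
      by (rule frac_integral(2)[OF \<beta>'(1) \<beta>'1 norm_ge_zero])
    have vals: "half_line_integral (\<lambda>r. ?w r * (1 - heat r k)) = norm (wavevec k) powr (2 * \<beta>') * frac_const \<beta>'" for k
      by (rule frac_integral(3)[OF \<beta>'(1) \<beta>'1 norm_ge_zero])
    have wS: "(\<Sum>k\<in>A. (cmod (a k))\<^sup>2 * (?w r * (1 - heat r k))) = ?w r * S r" for r
      unfolding S_def sum_distrib_left by (intro sum.cong refl) (simp only: mult.left_commute)
    have "(\<Sum>k\<in>A. (cmod (a k))\<^sup>2 * norm (wavevec k) powr (2 * \<beta>')) * frac_const \<beta>' =
       half_line_integral (\<lambda>r. \<Sum>k\<in>A. (cmod (a k))\<^sup>2 * (?w r * (1 - heat r k)))"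
      unfolding half_line_integral_sum(2)[where F="\<lambda>k r. ?w r * (1 - heat r k)", OF ints] vals
      by (simp only: sum_distrib_right mult.assoc)
    also have "\<dots> \<le> half_line_integral (\<lambda>r. c1 * K\<^sup>2 * ?G r)"
    proof (rule half_line_integral_mono)
      show "set_integrable lborel {0<..} (\<lambda>r. \<Sum>k\<in>A. (cmod (a k))\<^sup>2 * (?w r * (1 - heat r k)))"
        by (rule half_line_integral_sum(1)[where F="\<lambda>k r. ?w r * (1 - heat r k)", OF ints])
      show "set_integrable lborel {0<..} (\<lambda>r. c1 * K\<^sup>2 * ?G r)"
        by (intro set_integrable_mult_right intG)
      fix r :: real assume r: "r > 0"
      have "?w r * S r \<le> ?w r * (c1 * K\<^sup>2 * r powr (2 * \<beta>))" "?w r * S r \<le> ?w r * (c1 * K\<^sup>2)"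
        using S1[OF r] S2[of r] by (intro mult_left_mono; simp)+
      moreover have "?w r * r powr (2 * \<beta>) = r powr (2 * \<beta> - (1 + 2 * \<beta>'))"
        by (simp only: powr_add[symmetric]) (simp add: algebra_simps)
      ultimately have "?w r * S r \<le> c1 * K\<^sup>2 * r powr (2 * \<beta> - (1 + 2 * \<beta>'))" "?w r * S r \<le> c1 * K\<^sup>2 * ?w r"
        by (simp_all add: mult_ac)
      then show "(\<Sum>k\<in>A. (cmod (a k))\<^sup>2 * (?w r * (1 - heat r k))) \<le> c1 * K\<^sup>2 * ?G r"
        unfolding wS by (simp add: min_def)
    qed
    also have "\<dots> = c1 * K\<^sup>2 * half_line_integral ?G"
      by (simp add: half_line_integral_def)
    finally show ?thesis using fr by (simp add: C_def field_simps)
  qed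
  with C show thesis by (rule that)
qed

text \<open>If half the dissipative term does not already dominate, then
  \<open>x powr \<delta>\<close> is below \<open>Y = 2 * C1 * K\<close>, so the surplus
  \<open>x powr (A - D)\<close> can be converted into a power of \<open>K\<close>. This is the
  splitting in frequency, done pointwise in \<open>x\<close>.\<close>

lemma weighted_young:
  fixes \<alpha> \<beta> \<gamma> C1 :: real
  assumes \<gamma>: "0 < \<gamma>" and \<alpha>: "0 < \<alpha>" "\<alpha> < 1" and \<beta>: "1 - \<gamma> < \<beta>" "0 < \<beta>" "\<beta> < 1" and C1: "C1 > 0"
  obtains C where "C > 0"
    "\<And>K x. 0 \<le> K \<Longrightarrow> 1 \<le> x \<Longrightarrow> C1 * K * x powr (2 * \<alpha> + 1 - \<beta>) \<le>
       1 / 2 * x powr (2 * \<alpha> + \<gamma>) + C * K powr (4 * \<gamma> / (\<gamma> + \<beta> - 1) - 2) * x powr (2 * (\<alpha> * \<beta>))"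
proof -
  define p where "p = 4 * \<gamma> / (\<gamma> + \<beta> - 1)"
  define A B D where "A = 2 * \<alpha> + 1 - \<beta>" and "B = 2 * \<alpha> + \<gamma>" and "D = 2 * (\<alpha> * \<beta>)"
  define \<delta> where "\<delta> = \<gamma> + \<beta> - 1"
  have \<delta>: "\<delta> > 0" "B - A = \<delta>" using \<beta> by (auto simp: \<delta>_def A_def B_def)
  have p\<delta>: "p * \<delta> = 4 * \<gamma>" using \<delta>(1) by (simp add: p_def \<delta>_def)
  \<comment> \<open>As \<open>\<beta> < 1\<close>, \<delta> is below \<gamma>; hence
    \<open>p \<ge> 4\<close>, and the exponents \<open>p - 2\<close> and \<open>p - 3\<close> are
    positive.\<close>
  have "4 * \<delta> \<le> p * \<delta>" using \<beta> unfolding p\<delta> by (simp add: \<delta>_def)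
  then have p4: "4 \<le> p" using \<delta>(1) by (rule mult_right_le_imp_le)
  \<comment> \<open>\<open>(p - 3) * \<delta> - (A - D)\<close> equals
    \<open>\<gamma> + 2 * (1 - \<alpha>) * (1 - \<beta>)\<close>.\<close>
  have "(1 - \<alpha>) * (1 - \<beta>) \<ge> 0" using \<alpha> \<beta> by simp
  then have AD: "A - D \<le> (p - 3) * \<delta>"
    using \<gamma> p\<delta> by (simp add: A_def D_def \<delta>_def algebra_simps)
  define C where "C = 1 / 2 * (2 * C1) powr (p - 2)"
  have C: "C > 0" using C1 by (simp add: C_def)
  have "C1 * K * x powr A \<le> 1 / 2 * x powr B + C * K powr (p - 2) * x powr D"
    if K: "0 \<le> K" and x: "1 \<le> x" for K x
  proof (cases "C1 * K * x powr A \<le> 1 / 2 * x powr B")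
    case True
    moreover have "0 \<le> C * K powr (p - 2) * x powr D" using C by simp
    ultimately show ?thesis by linarith
  next
    case False
    define Y where "Y = 2 * C1 * K"
    have "B = \<delta> + A" using \<delta>(2) by simp
    then have xB: "x powr B = x powr \<delta> * x powr A" by (simp only: powr_add)
    have xA: "x powr A > 0" using x by simp
    have "x powr \<delta> * x powr A < Y * x powr A" using False unfolding xB Y_def by simp
    then have xY: "x powr \<delta> < Y" using xA by (simp add: mult_less_cancel_right)
    have "1 \<le> x powr \<delta>" using x \<delta>(1) by (intro ge_one_powr_ge_zero) auto
    then have Y1: "1 \<le> Y" using xY by simp
    have xAD: "x powr (A - D) \<le> Y powr (p - 3)"
    proof (cases "A \<le> D")
      case True
      then have "x powr (A - D) \<le> 1" using x powr_mono[of "A - D" 0 x] by simp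
      also have "1 \<le> Y powr (p - 3)" using Y1 p4 by (intro ge_one_powr_ge_zero) auto
      finally show ?thesis .
    next
      case False
      have "x powr (A - D) \<le> x powr ((p - 3) * \<delta>)" using x AD by (intro powr_mono) auto
      also have "\<dots> = (x powr \<delta>) powr (p - 3)" by (simp add: powr_powr mult.commute)
      also have "\<dots> \<le> Y powr (p - 3)" using xY p4 by (intro powr_mono2) auto
      finally show ?thesis .
    qed
    have "C1 * K * x powr A = 1 / 2 * Y * x powr (A - D) * x powr D"
      by (simp add: Y_def mult.assoc flip: powr_add)
    also have "\<dots> \<le> 1 / 2 * Y * Y powr (p - 3) * x powr D"
      using xAD Y1 by (intro mult_right_mono mult_left_mono) auto
    also have "1 / 2 * Y * Y powr (p - 3) * x powr D = C * K powr (p - 2) * x powr D"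
    proof -
      have "Y * Y powr (p - 3) = Y powr (p - 2)" using Y1 powr_add[of Y 1 "p - 3"] by simp
      also have "\<dots> = (2 * C1) powr (p - 2) * K powr (p - 2)"
        using C1 K by (simp add: Y_def powr_mult)
      finally show ?thesis by (simp add: C_def)
    qed
    finally have "C1 * K * x powr A \<le> C * K powr (p - 2) * x powr D" .
    moreover have "0 \<le> 1 / 2 * x powr B" by simp
    ultimately show ?thesis by linarith
  qed
  with C show thesis unfolding A_def B_def D_def p_def by (rule that)
qed

theorem trilinear_absorbed:
  assumes \<gamma>: "0 < \<gamma>" and \<alpha>: "0 < \<alpha>" "\<alpha> < 1" and \<beta>: "1 - \<gamma> < \<beta>" "0 < \<beta>" "\<beta> < 1"
  obtains C where "C > 0"
    "\<And>A a K. finite A \<Longrightarrow> holder_bound \<beta> K (trig A a) \<Longrightarrow>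
       cmod (\<Sum>l\<in>A. complex_of_real (norm (wavevec l) powr (2 * \<alpha>)) * triad A a l) \<le>
       1 / 2 * (\<Sum>k\<in>A. norm (wavevec k) powr (2 * \<alpha> + \<gamma>) * (cmod (a k))\<^sup>2) + C * K powr (4 * \<gamma> / (\<gamma> + \<beta> - 1))"
proof -
  obtain C1 where C1: "C1 > 0" "\<And>A a K. finite A \<Longrightarrow> holder_bound \<beta> K (trig A a) \<Longrightarrow>
       cmod (\<Sum>l\<in>A. complex_of_real (norm (wavevec l) powr (2 * \<alpha>)) * triad A a l) \<le>
       C1 * K * (\<Sum>k\<in>A. (cmod (a k))\<^sup>2 * norm (wavevec k) powr (2 * \<alpha> + 1 - \<beta>))"
    using trilinear_bound[OF \<beta>(2,3) \<alpha>] by blast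
  \<comment> \<open>An exponent strictly below \<beta> is controlled by the Hoelder bound; this one
    makes the slack in \<open>weighted_young\<close> factorise.\<close>
  have "0 < \<alpha> * \<beta>" "\<alpha> * \<beta> < \<beta>" using \<alpha> \<beta> by auto
  then obtain C2 where C2: "C2 > 0" "\<And>A a K. finite A \<Longrightarrow> holder_bound \<beta> K (trig A a) \<Longrightarrow>
       (\<Sum>k\<in>A. (cmod (a k))\<^sup>2 * norm (wavevec k) powr (2 * (\<alpha> * \<beta>))) \<le> C2 * K\<^sup>2"
    using low_norm_bound[OF \<beta>(2,3)] by blast
  define p where "p = 4 * \<gamma> / (\<gamma> + \<beta> - 1)"
  obtain C3 where C3: "C3 > 0" "\<And>K x. 0 \<le> K \<Longrightarrow> 1 \<le> x \<Longrightarrow> C1 * K * x powr (2 * \<alpha> + 1 - \<beta>) \<le>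
       1 / 2 * x powr (2 * \<alpha> + \<gamma>) + C3 * K powr (p - 2) * x powr (2 * (\<alpha> * \<beta>))"
    using weighted_young[OF \<gamma> \<alpha> \<beta> C1(1)] unfolding p_def by blast
  have "cmod (\<Sum>l\<in>A. complex_of_real (norm (wavevec l) powr (2 * \<alpha>)) * triad A a l) \<le>
       1 / 2 * (\<Sum>k\<in>A. norm (wavevec k) powr (2 * \<alpha> + \<gamma>) * (cmod (a k))\<^sup>2) + C3 * C2 * K powr p"
    if A: "finite A" and hb: "holder_bound \<beta> K (trig A a)" for A a K
  proof -
    have K: "0 \<le> K" using hb by (rule holder_bound_nonneg)
    have "cmod (\<Sum>l\<in>A. complex_of_real (norm (wavevec l) powr (2 * \<alpha>)) * triad A a l) \<le>
       C1 * K * (\<Sum>k\<in>A. (cmod (a k))\<^sup>2 * norm (wavevec k) powr (2 * \<alpha> + 1 - \<beta>))" by (rule C1(2)[OF A hb])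
    also have "\<dots> = (\<Sum>k\<in>A. (cmod (a k))\<^sup>2 * (C1 * K * norm (wavevec k) powr (2 * \<alpha> + 1 - \<beta>)))"
      by (simp only: sum_distrib_left mult_ac)
    also have "\<dots> \<le> (\<Sum>k\<in>A. (cmod (a k))\<^sup>2 * (1 / 2 * norm (wavevec k) powr (2 * \<alpha> + \<gamma>) +
        C3 * K powr (p - 2) * norm (wavevec k) powr (2 * (\<alpha> * \<beta>))))"
    proof (intro sum_mono mult_left_mono)
      fix k
      show "C1 * K * norm (wavevec k) powr (2 * \<alpha> + 1 - \<beta>) \<le> 1 / 2 * norm (wavevec k) powr (2 * \<alpha> + \<gamma>) +
        C3 * K powr (p - 2) * norm (wavevec k) powr (2 * (\<alpha> * \<beta>))"
        by (cases "k = 0") (simp, intro C3(2) K one_le_norm_wavevec)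
    qed simp
    also have "\<dots> = 1 / 2 * (\<Sum>k\<in>A. norm (wavevec k) powr (2 * \<alpha> + \<gamma>) * (cmod (a k))\<^sup>2) +
        C3 * K powr (p - 2) * (\<Sum>k\<in>A. (cmod (a k))\<^sup>2 * norm (wavevec k) powr (2 * (\<alpha> * \<beta>)))"
      by (simp only: distrib_left sum.distrib sum_distrib_left mult_ac)
    also have "\<dots> \<le> 1 / 2 * (\<Sum>k\<in>A. norm (wavevec k) powr (2 * \<alpha> + \<gamma>) * (cmod (a k))\<^sup>2) +
        C3 * K powr (p - 2) * (C2 * K\<^sup>2)"
      using C3(1) by (intro add_left_mono mult_left_mono C2(2) A hb) auto
    also have "C3 * K powr (p - 2) * (C2 * K\<^sup>2) = C3 * C2 * K powr p"
    proof (cases "K = 0")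
      case False
      then have "K powr p = K powr (p - 2) * K\<^sup>2" using K powr_add[of K "p - 2" 2] by (simp add: powr_numeral)
      then show ?thesis by simp
    qed simp
    finally show ?thesis .
  qed
  moreover have "C3 * C2 > 0" using C3(1) C2(1) by simp
  ultimately show thesis unfolding p_def using that by blast
qed

subsection \<open>Square summable families\<close>

text \<open>A bound on all finite partial sums combines summability and the size of the sum in one
  statement, and it passes to coordinatewise limits directly.\<close>

definition ell2_le :: "real \<Rightarrow> ('i \<Rightarrow> complex) \<Rightarrow> bool" where
  "ell2_le X x \<longleftrightarrow> (\<forall>F. finite F \<longrightarrow> (\<Sum>k\<in>F. (cmod (x k))\<^sup>2) \<le> X)"

lemma ell2_le_D: "ell2_le X x \<Longrightarrow> finite F \<Longrightarrow> (\<Sum>k\<in>F. (cmod (x k))\<^sup>2) \<le> X"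
  by (simp add: ell2_le_def)

lemma ell2_le_nonneg: "ell2_le X x \<Longrightarrow> 0 \<le> X"
  using ell2_le_D[of X x "{}"] by simp

lemma ell2_le_cnj [simp]: "ell2_le X (\<lambda>k. cnj (x k)) \<longleftrightarrow> ell2_le X x"
  by (simp add: ell2_le_def)

lemma ell2_le_mono: "ell2_le X x \<Longrightarrow> (\<And>k. cmod (y k) \<le> cmod (x k)) \<Longrightarrow> ell2_le X y"
  unfolding ell2_le_def by (meson sum_mono order_trans power_mono norm_ge_zero)

lemma ell2_le_summable: "ell2_le X x \<Longrightarrow> (\<lambda>k. (cmod (x k))\<^sup>2) summable_on UNIV"
  by (intro nonneg_bdd_above_summable_on bdd_aboveI2[of _ _ X]) (auto intro: ell2_le_D)

lemma ell2_le_infsum: "(\<lambda>k. (cmod (x k))\<^sup>2) summable_on UNIV \<Longrightarrow> ell2_le (\<Sum>\<^sub>\<infinity>k. (cmod (x k))\<^sup>2) x"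
  unfolding ell2_le_def by (auto intro!: finite_sum_le_infsum)

lemma cauchy_schwarz_sum:
  "(\<Sum>k\<in>F. cmod (x k * y k)) \<le> sqrt (\<Sum>k\<in>F. (cmod (x k))\<^sup>2) * sqrt (\<Sum>k\<in>F. (cmod (y k))\<^sup>2)"
  using L2_set_mult_ineq[of "\<lambda>k. cmod (x k)" "\<lambda>k. cmod (y k)" F] by (simp add: L2_set_def norm_mult)

lemma ell2_le_mult:
  assumes "ell2_le X x" "ell2_le Y y"
  shows "(\<lambda>k. x k * y k) summable_on UNIV" "cmod (\<Sum>\<^sub>\<infinity>k. x k * y k) \<le> sqrt X * sqrt Y"
proof -
  have fin: "(\<Sum>k\<in>F. cmod (x k * y k)) \<le> sqrt X * sqrt Y" if "finite F" for F
    by (rule order_trans[OF cauchy_schwarz_sum])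
       (use assms that ell2_le_D ell2_le_nonneg in \<open>auto intro!: mult_mono sum_nonneg\<close>)
  have abs: "(\<lambda>k. cmod (x k * y k)) summable_on UNIV"
    by (intro nonneg_bdd_above_summable_on bdd_aboveI2[of _ _ "sqrt X * sqrt Y"]) (auto intro: fin)
  then show "(\<lambda>k. x k * y k) summable_on UNIV" by (rule abs_summable_summable)
  have "cmod (\<Sum>\<^sub>\<infinity>k. x k * y k) \<le> (\<Sum>\<^sub>\<infinity>k. cmod (x k * y k))"
    using abs by (rule norm_infsum_bound)
  also have "\<dots> \<le> sqrt X * sqrt Y" by (intro infsum_le_finite_sums abs fin)
  finally show "cmod (\<Sum>\<^sub>\<infinity>k. x k * y k) \<le> sqrt X * sqrt Y" .
qed

lemma ell2_le_add:
  assumes "ell2_le X x" "ell2_le Y y"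
  shows "ell2_le (2 * X + 2 * Y) (\<lambda>k. x k + y k)"
  unfolding ell2_le_def
proof (intro allI impI)
  fix F :: "'a set" assume F: "finite F"
  have "(cmod (a + b))\<^sup>2 \<le> 2 * (cmod a)\<^sup>2 + 2 * (cmod b)\<^sup>2" for a b
  proof -
    have "(cmod (a + b))\<^sup>2 \<le> (cmod a + cmod b)\<^sup>2" by (intro power_mono norm_triangle_ineq) auto
    also have "\<dots> \<le> 2 * (cmod a)\<^sup>2 + 2 * (cmod b)\<^sup>2"
      using sum_squares_bound[of "cmod a" "cmod b"] by (simp add: power2_sum)
    finally show ?thesis .
  qed
  then have "(\<Sum>k\<in>F. (cmod (x k + y k))\<^sup>2) \<le> (\<Sum>k\<in>F. 2 * (cmod (x k))\<^sup>2 + 2 * (cmod (y k))\<^sup>2)"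
    by (intro sum_mono)
  also have "\<dots> = 2 * (\<Sum>k\<in>F. (cmod (x k))\<^sup>2) + 2 * (\<Sum>k\<in>F. (cmod (y k))\<^sup>2)"
    by (simp add: sum.distrib sum_distrib_left)
  also have "\<dots> \<le> 2 * X + 2 * Y" using ell2_le_D[OF assms(1) F] ell2_le_D[OF assms(2) F] by simp
  finally show "(\<Sum>k\<in>F. (cmod (x k + y k))\<^sup>2) \<le> 2 * X + 2 * Y" .
qed

text \<open>Bounded sequences that converge coordinatewise converge weakly. The approximants have
  finite support, so their pairings are finite sums.\<close>

lemma ell2_le_weak_limit:
  assumes x: "\<And>n. ell2_le M (x n)" and lim: "\<And>k. (\<lambda>n. x n k) \<longlonglongrightarrow> x' k"
    and y: "ell2_le Y y" and A: "\<And>n. finite (A n)" "\<And>n k. k \<notin> A n \<Longrightarrow> x n k = 0"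
  shows "ell2_le M x'" "(\<lambda>n. \<Sum>k\<in>A n. x n k * y k) \<longlonglongrightarrow> (\<Sum>\<^sub>\<infinity>k. x' k * y k)"
proof -
  show x': "ell2_le M x'"
    unfolding ell2_le_def
  proof (intro allI impI)
    fix F :: "'a set" assume F: "finite F"
    have "(\<lambda>n. \<Sum>k\<in>F. (cmod (x n k))\<^sup>2) \<longlonglongrightarrow> (\<Sum>k\<in>F. (cmod (x' k))\<^sup>2)" by (intro tendsto_intros lim)
    then show "(\<Sum>k\<in>F. (cmod (x' k))\<^sup>2) \<le> M"
      by (rule LIMSEQ_le_const2) (use ell2_le_D[OF x F] in auto)
  qed
  have M: "0 \<le> M" using ell2_le_nonneg[OF x'] .
  define S where "S = (\<Sum>\<^sub>\<infinity>k. x' k * y k)"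
  have S: "((\<lambda>k. x' k * y k) has_sum S) UNIV"
    unfolding S_def by (rule has_sum_infsum[OF ell2_le_mult(1)[OF x' y]])
  have Ys: "((\<lambda>k. (cmod (y k))\<^sup>2) has_sum (\<Sum>\<^sub>\<infinity>k. (cmod (y k))\<^sup>2)) UNIV"
    by (rule has_sum_infsum[OF ell2_le_summable[OF y]])
  show "(\<lambda>n. \<Sum>k\<in>A n. x n k * y k) \<longlonglongrightarrow> (\<Sum>\<^sub>\<infinity>k. x' k * y k)"
  proof (rule LIMSEQ_I)
    fix r :: real assume r: "r > 0"
    \<comment> \<open>The added 1 keeps the quotient meaningful and the next inequality strict when
      \<open>M = 0\<close>.\<close>
    define \<epsilon> where "\<epsilon> = r / (3 * (sqrt M + 1))"
    have \<epsilon>: "\<epsilon> > 0" using r M by (simp add: \<epsilon>_def add_nonneg_pos)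
    have \<epsilon>M: "sqrt M * \<epsilon> < r / 3"
    proof -
      have "sqrt M * \<epsilon> < (sqrt M + 1) * \<epsilon>" using \<epsilon> by simp
      also have "\<dots> = r / 3" using M by (simp add: \<epsilon>_def add_nonneg_eq_0_iff field_simps)
      finally show ?thesis .
    qed
    obtain F1 where F1: "finite F1" "dist (\<Sum>k\<in>F1. (cmod (y k))\<^sup>2) (\<Sum>\<^sub>\<infinity>k. (cmod (y k))\<^sup>2) \<le> \<epsilon>\<^sup>2"
      using has_sum_finite_approximation[OF Ys, of "\<epsilon>\<^sup>2"] \<epsilon> by auto
    have "eventually (\<lambda>G. dist (\<Sum>k\<in>G. x' k * y k) S < r / 3) (finite_subsets_at_top UNIV)"
      using S r unfolding has_sum_def by (intro tendstoD) auto
    then obtain F2 where F2: "finite F2" "\<And>G. finite G \<Longrightarrow> F2 \<subseteq> G \<Longrightarrow> dist (\<Sum>k\<in>G. x' k * y k) S < r / 3"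
      unfolding eventually_finite_subsets_at_top by auto
    define F where "F = F1 \<union> F2"
    have F: "finite F" using F1 F2 by (simp add: F_def)
    have tail: "cmod (\<Sum>k\<in>B. x n k * y k) < r / 3" if B: "finite B" "B \<inter> F = {}" for B n
    proof -
      have "(\<Sum>k\<in>F1. (cmod (y k))\<^sup>2) + (\<Sum>k\<in>B. (cmod (y k))\<^sup>2) = (\<Sum>k\<in>F1 \<union> B. (cmod (y k))\<^sup>2)"
        using F1(1) B by (intro sum.union_disjoint[symmetric]) (auto simp: F_def)
      also have "\<dots> \<le> (\<Sum>\<^sub>\<infinity>k. (cmod (y k))\<^sup>2)"
        using F1(1) B(1) by (intro finite_sum_le_infsum ell2_le_summable[OF y]) auto
      finally have "(\<Sum>k\<in>B. (cmod (y k))\<^sup>2) \<le> \<epsilon>\<^sup>2" using F1(2) by (simp add: dist_real_def)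
      then have y\<epsilon>: "sqrt (\<Sum>k\<in>B. (cmod (y k))\<^sup>2) \<le> \<epsilon>" using \<epsilon> by (intro real_le_lsqrt) (auto intro: sum_nonneg)
      have "cmod (\<Sum>k\<in>B. x n k * y k) \<le> (\<Sum>k\<in>B. cmod (x n k * y k))" by (rule norm_sum)
      also have "\<dots> \<le> sqrt (\<Sum>k\<in>B. (cmod (x n k))\<^sup>2) * sqrt (\<Sum>k\<in>B. (cmod (y k))\<^sup>2)"
        by (rule cauchy_schwarz_sum)
      also have "\<dots> \<le> sqrt M * \<epsilon>"
        using y\<epsilon> M ell2_le_D[OF x B(1)] by (intro mult_mono) (auto intro: sum_nonneg)
      finally show ?thesis using \<epsilon>M by simp
    qed
    have limF: "(\<lambda>n. \<Sum>k\<in>F. x n k * y k) \<longlonglongrightarrow> (\<Sum>k\<in>F. x' k * y k)" by (intro tendsto_intros lim)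
    obtain N where N: "\<And>n. n \<ge> N \<Longrightarrow> cmod ((\<Sum>k\<in>F. x n k * y k) - (\<Sum>k\<in>F. x' k * y k)) < r / 3"
      using LIMSEQ_D[OF limF, of "r / 3"] r by auto
    have "cmod ((\<Sum>k\<in>A n. x n k * y k) - S) < r" if "n \<ge> N" for n
    proof -
      have "(\<Sum>k\<in>A n. x n k * y k) = (\<Sum>k\<in>A n \<union> F. x n k * y k)"
        using A F by (intro sum.mono_neutral_left) auto
      also have "\<dots> = (\<Sum>k\<in>F. x n k * y k) + (\<Sum>k\<in>A n - F. x n k * y k)"
        using A(1)[of n] F sum.union_disjoint[of F "A n - F" "\<lambda>k. x n k * y k"]
        by (simp add: Un_commute)
      finally have eq: "(\<Sum>k\<in>A n. x n k * y k) - S =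
         (\<Sum>k\<in>A n - F. x n k * y k) + ((\<Sum>k\<in>F. x n k * y k) - (\<Sum>k\<in>F. x' k * y k)) + ((\<Sum>k\<in>F. x' k * y k) - S)"
        by simp
      have tri: "cmod (a + b + c) < r" if "cmod a < r / 3" "cmod b < r / 3" "cmod c < r / 3" for a b c
        using norm_triangle_ineq[of "a + b" c] norm_triangle_ineq[of a b] that by linarith
      show ?thesis unfolding eq
      proof (rule tri)
        show "cmod (\<Sum>k\<in>A n - F. x n k * y k) < r / 3" using A(1) by (intro tail) auto
        show "cmod ((\<Sum>k\<in>F. x' k * y k) - S) < r / 3"
          using F2(2)[OF F] by (simp add: F_def dist_norm)
      qed (rule N[OF that])
    qed
    then show "\<exists>no. \<forall>n\<ge>no. norm ((\<Sum>k\<in>A n. x n k * y k) - (\<Sum>\<^sub>\<infinity>k. x' k * y k)) < r"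
      unfolding S_def by blast
  qed
qed

subsection \<open>Fejer means of Hoelder functions and of products\<close>

text \<open>Periodicity moves the translation from the kernel to \<phi>, so the mean is an average
  of translates of \<phi> with a nonnegative weight of total mass one, and each translate has the
  same Hoelder constant.\<close>

lemma fejer_holder:
  assumes per: "periodic \<phi>" and \<phi>: "(\<lambda>x. complex_of_real (\<phi> x)) \<in> L2"
    and hold: "\<And>x y. \<bar>\<phi> x - \<phi> y\<bar> \<le> K * norm (x - y) powr \<beta>" and n: "n > 0"
  shows "holder_bound \<beta> K (fejer n (\<lambda>x. complex_of_real (\<phi> x)))"
  unfolding holder_bound_def
proof (intro allI)
  fix x x' :: "real^2"
  let ?c = "\<lambda>x. complex_of_real (\<phi> x)"
  let ?F = "\<lambda>y. fejer_kernel n (- y)"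
  have kernel_per: "fejer_kernel n (u + axis i (2 * pi)) = fejer_kernel n u" for u i
    by (simp add: fejer_kernel_def wave_periodic)
  have rep: "fejer n ?c z = (LINT y|TM. ?c (y + z) * complex_of_real (?F y)) / complex_of_real ((2 * pi)\<^sup>2)"
    and int: "integrable TM (\<lambda>y. ?c (y + z) * complex_of_real (?F y))" for z
  proof -
    define g where "g = (\<lambda>y. ?c y * complex_of_real (fejer_kernel n (z - y)))"
    have g_per: "g (y + axis i (2 * pi)) = g y" for y i
    proof -
      have "fejer_kernel n (z - (y + axis i (2 * pi))) = fejer_kernel n (z - (y + axis i (2 * pi)) + axis i (2 * pi))"
        by (rule kernel_per[symmetric])
      also have "z - (y + axis i (2 * pi)) + axis i (2 * pi) = z - y" by simp
      finally show ?thesis using per by (simp add: g_def periodic_def)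
    qed
    have g_meas: "g \<in> borel_measurable borel"
      unfolding g_def using L2_D(1)[OF \<phi>]
      by (intro borel_measurable_times borel_measurable_of_real)
         (auto intro!: borel_measurable_continuous_onI continuous_fejer_kernel continuous_intros)
    have g_int: "integrable TM g"
      unfolding g_def by (rule integrable_mult_fejer_kernel[OF L2_integrable[OF \<phi>], simplified])
    have shift: "g (y + z) = ?c (y + z) * complex_of_real (?F y)" for y by (simp add: g_def)
    show "fejer n ?c z = (LINT y|TM. ?c (y + z) * complex_of_real (?F y)) / complex_of_real ((2 * pi)\<^sup>2)"
      using periodic_integral_translate(2)[OF g_per g_meas g_int, of z]
      unfolding fejer_eq_integral[OF \<phi>] shift by (simp add: g_def)
    show "integrable TM (\<lambda>y. ?c (y + z) * complex_of_real (?F y))"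
      using periodic_integral_translate(1)[OF g_per g_meas g_int, of z] unfolding shift .
  qed
  have F1: "(LINT y|TM. ?F y) = (2 * pi)\<^sup>2"
    using integral_fejer_kernel[OF n, of 0] integral_complex_of_real[of TM ?F]
    by (simp only: diff_0 of_real_eq_iff)
  have FI: "integrable TM ?F"
    by (intro integrable_TM_continuous continuous_fejer_kernel continuous_intros)
  let ?d = "\<lambda>y. (?c (y + x) - ?c (y + x')) * complex_of_real (?F y)"
  have dint: "integrable TM ?d" unfolding left_diff_distrib using int by (intro Bochner_Integration.integrable_diff)
  have "fejer n ?c x - fejer n ?c x' = (LINT y|TM. ?d y) / complex_of_real ((2 * pi)\<^sup>2)"
    unfolding rep left_diff_distrib Bochner_Integration.integral_diff[OF int int] by (rule diff_divide_distrib[symmetric])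
  then have "cmod (fejer n ?c x - fejer n ?c x') = cmod (LINT y|TM. ?d y) / (2 * pi)\<^sup>2"
    by (simp add: norm_divide norm_mult norm_power)
  also have "\<dots> \<le> (LINT y|TM. K * norm (x - x') powr \<beta> * ?F y) / (2 * pi)\<^sup>2"
  proof (intro divide_right_mono order_trans[OF integral_norm_bound] integral_mono)
    show "integrable TM (\<lambda>y. cmod (?d y))" using dint by (rule integrable_norm)
    show "integrable TM (\<lambda>y. K * norm (x - x') powr \<beta> * ?F y)" using FI by simp
    fix y
    have "cmod (?d y) = \<bar>\<phi> (y + x) - \<phi> (y + x')\<bar> * ?F y"
      using fejer_kernel_nonneg[of n "- y"] by (simp add: norm_mult flip: of_real_diff)
    also have "\<dots> \<le> K * norm ((y + x) - (y + x')) powr \<beta> * ?F y"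
      by (intro mult_right_mono hold fejer_kernel_nonneg)
    finally show "cmod (?d y) \<le> K * norm (x - x') powr \<beta> * ?F y" by simp
  qed simp
  also have "\<dots> = K * norm (x - x') powr \<beta>" using F1 by simp
  finally show "cmod (fejer n ?c x - fejer n ?c x') \<le> K * norm (x - x') powr \<beta>" .
qed

text \<open>A mean-free polynomial equals the average of its differences to all points of the cell,
  and \<open>4 * pi\<close> bounds the distances there through the sum of the coordinates.\<close>

lemma trig_sup_bound:
  assumes A: "finite A" and b0: "b 0 = 0" and hb: "holder_bound \<beta> L (trig A b)" and \<beta>: "0 < \<beta>"
    and x: "x \<in> torus"
  shows "cmod (trig A b x) \<le> L * (4 * pi) powr \<beta>"
proof -
  have L: "0 \<le> L" using hb by (rule holder_bound_nonneg)
  have mean: "(LINT y|TM. trig A b y) = 0"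
    using integral_trig_mult_wave[OF A, of b 0] b0 by simp
  have "complex_of_real ((2 * pi)\<^sup>2) * trig A b x = (LINT y|TM. trig A b x - trig A b y)"
    using mean by (simp add: measure_TM scaleR_conv_of_real)
  then have "cmod (complex_of_real ((2 * pi)\<^sup>2) * trig A b x) = cmod (LINT y|TM. trig A b x - trig A b y)"
    by (rule arg_cong)
  then have "(2 * pi)\<^sup>2 * cmod (trig A b x) = cmod (LINT y|TM. trig A b x - trig A b y)"
    by (simp only: norm_mult norm_of_real abs_of_nonneg zero_le_power2)
  also have "\<dots> \<le> (LINT y|TM. L * (4 * pi) powr \<beta>)"
  proof (intro order_trans[OF integral_norm_bound] integral_mono integrable_TM_continuous continuous_intros)
    fix y assume "y \<in> space TM"
    then have y: "y \<in> torus" by simp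
    have "\<bar>(x - y) $ i\<bar> \<le> 2 * pi" for i
    proof -
      have "- pi < x $ i" "x $ i < pi" "- pi < y $ i" "y $ i < pi" using x y by (auto simp: mem_torus)
      then show ?thesis by simp
    qed
    from this[of 1] this[of 2] have "norm (x - y) \<le> 4 * pi"
      using norm_le_l1_cart[of "x - y"] unfolding sum_2 by linarith
    then have "norm (x - y) powr \<beta> \<le> (4 * pi) powr \<beta>" using \<beta> by (intro powr_mono2) auto
    then have "L * norm (x - y) powr \<beta> \<le> L * (4 * pi) powr \<beta>" using L by (intro mult_left_mono)
    then show "cmod (trig A b x - trig A b y) \<le> L * (4 * pi) powr \<beta>"
      using hb[unfolded holder_bound_def, rule_format, of x y] by linarith
  qed
  also have "\<dots> = (2 * pi)\<^sup>2 * (L * (4 * pi) powr \<beta>)" by (simp add: measure_TM)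
  finally show ?thesis by (rule mult_left_le_imp_le) simp
qed

lemma integrable_mult_wave:
  assumes "integrable TM f"
  shows "integrable TM (\<lambda>x. f x * cnj (wave k x))"
proof (rule Bochner_Integration.integrable_bound[OF assms])
  show "(\<lambda>x. f x * cnj (wave k x)) \<in> borel_measurable TM"
    by (rule borel_measurable_times[OF borel_measurable_integrable[OF assms]
          measurable_TM[OF borel_measurable_cnj[OF measurable_wave]]])
qed (simp add: norm_mult)

lemma fc_norm_le: "cmod (fc \<phi> k) \<le> (LINT x|TM. cmod (\<phi> x)) / (2 * pi)\<^sup>2"
proof -
  have "cmod (LINT x|TM. \<phi> x * cnj (wave k x)) \<le> (LINT x|TM. cmod (\<phi> x))"
    using integral_norm_bound[of TM "\<lambda>x. \<phi> x * cnj (wave k x)"] by (simp add: norm_mult)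
  then show ?thesis by (simp add: fc_def norm_divide norm_mult norm_power divide_right_mono)
qed

text \<open>By Cauchy-Schwarz the product of two mean-square convergent sequences converges in the
  integral norm, and this norm dominates each coefficient.\<close>

lemma fc_fejer_mult_tendsto:
  assumes \<phi>: "\<phi> \<in> L2" and \<psi>: "\<psi> \<in> L2"
  shows "(\<lambda>n. fc (\<lambda>x. fejer n \<phi> x * fejer n \<psi> x) k) \<longlonglongrightarrow> fc (\<lambda>x. \<phi> x * \<psi> x) k"
proof -
  have f1: "(\<lambda>n. sqnorm (\<lambda>x. \<phi> x - fejer n \<phi> x)) \<longlonglongrightarrow> 0" and f2: "(\<lambda>n. sqnorm (\<lambda>x. \<psi> x - fejer n \<psi> x)) \<longlonglongrightarrow> 0"
    using L2_fejer_conv[OF \<phi>] L2_fejer_conv[OF \<psi>] by (auto simp: fejer_conv_def)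
  define E where "E = (\<lambda>n. (sqrt (sqnorm (\<lambda>x. \<phi> x - fejer n \<phi> x)) * sqrt (sqnorm \<psi>) +
      sqrt (sqnorm \<phi>) * sqrt (sqnorm (\<lambda>x. \<psi> x - fejer n \<psi> x))) / (2 * pi)\<^sup>2)"
  have "E \<longlonglongrightarrow> (sqrt 0 * sqrt (sqnorm \<psi>) + sqrt (sqnorm \<phi>) * sqrt 0) / (2 * pi)\<^sup>2"
    unfolding E_def by (intro tendsto_intros f1 f2) simp
  then have E: "E \<longlonglongrightarrow> 0" by simp
  have bound: "cmod (fc (\<lambda>x. \<phi> x * \<psi> x) k - fc (\<lambda>x. fejer n \<phi> x * fejer n \<psi> x) k) \<le> E n" for n
  proof -
    let ?p = "\<lambda>x. \<phi> x - fejer n \<phi> x" and ?q = "\<lambda>x. \<psi> x - fejer n \<psi> x"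
    have p: "?p \<in> L2" and q: "?q \<in> L2" using \<phi> \<psi> by (auto intro: L2_diff)
    have lin: "fc (\<lambda>x. f x - g x) k = fc f k - fc g k" if "integrable TM f" "integrable TM g" for f g
      using that[THEN integrable_mult_wave] by (simp add: fc_def left_diff_distrib diff_divide_distrib)
    have i1: "integrable TM (\<lambda>x. \<phi> x * \<psi> x)" by (rule L2_mult_integrable[OF \<phi> \<psi>])
    have i2: "integrable TM (\<lambda>x. fejer n \<phi> x * fejer n \<psi> x)" by (rule L2_mult_integrable) auto
    have "fc (\<lambda>x. \<phi> x * \<psi> x) k - fc (\<lambda>x. fejer n \<phi> x * fejer n \<psi> x) k =
       fc (\<lambda>x. \<phi> x * \<psi> x - fejer n \<phi> x * fejer n \<psi> x) k"
      using lin[OF i1 i2] by simp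
    also have "cmod \<dots> \<le> (LINT x|TM. cmod (\<phi> x * \<psi> x - fejer n \<phi> x * fejer n \<psi> x)) / (2 * pi)\<^sup>2"
      by (rule fc_norm_le)
    also have "\<dots> \<le> ((LINT x|TM. cmod (?p x) * cmod (fejer n \<psi> x)) + (LINT x|TM. cmod (\<phi> x) * cmod (?q x))) / (2 * pi)\<^sup>2"
    proof (rule divide_right_mono)
      have j1: "integrable TM (\<lambda>x. cmod (?p x) * cmod (fejer n \<psi> x))"
        using integrable_norm[OF L2_mult_integrable[OF p fejer_L2]] by (simp add: norm_mult)
      have j2: "integrable TM (\<lambda>x. cmod (\<phi> x) * cmod (?q x))"
        using integrable_norm[OF L2_mult_integrable[OF \<phi> q]] by (simp add: norm_mult)
      have "(LINT x|TM. cmod (\<phi> x * \<psi> x - fejer n \<phi> x * fejer n \<psi> x)) \<le>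
         (LINT x|TM. cmod (?p x) * cmod (fejer n \<psi> x) + cmod (\<phi> x) * cmod (?q x))"
      proof (rule integral_mono)
        fix x
        have "\<phi> x * \<psi> x - fejer n \<phi> x * fejer n \<psi> x = ?p x * fejer n \<psi> x + \<phi> x * ?q x"
          by (simp add: algebra_simps)
        then show "cmod (\<phi> x * \<psi> x - fejer n \<phi> x * fejer n \<psi> x) \<le> cmod (?p x) * cmod (fejer n \<psi> x) + cmod (\<phi> x) * cmod (?q x)"
          using norm_triangle_ineq[of "?p x * fejer n \<psi> x" "\<phi> x * ?q x"] by (simp add: norm_mult)
      qed (use i1 i2 j1 j2 in auto)
      then show "(LINT x|TM. cmod (\<phi> x * \<psi> x - fejer n \<phi> x * fejer n \<psi> x)) \<le>
         (LINT x|TM. cmod (?p x) * cmod (fejer n \<psi> x)) + (LINT x|TM. cmod (\<phi> x) * cmod (?q x))"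
        using j1 j2 by simp
    qed simp
    also have "\<dots> \<le> E n"
      unfolding E_def
    proof (intro divide_right_mono add_mono)
      show "(LINT x|TM. cmod (?p x) * cmod (fejer n \<psi> x)) \<le> sqrt (sqnorm ?p) * sqrt (sqnorm \<psi>)"
        by (rule order_trans[OF L2_cauchy_schwarz[OF p fejer_L2]])
           (intro mult_left_mono real_sqrt_le_mono fejer_contraction[OF \<psi>] real_sqrt_ge_zero sqnorm_nonneg)
      show "(LINT x|TM. cmod (\<phi> x) * cmod (?q x)) \<le> sqrt (sqnorm \<phi>) * sqrt (sqnorm ?q)"
        by (rule L2_cauchy_schwarz[OF \<phi> q])
    qed simp
    finally show ?thesis .
  qed
  have "(\<lambda>n. cmod (fc (\<lambda>x. \<phi> x * \<psi> x) k - fc (\<lambda>x. fejer n \<phi> x * fejer n \<psi> x) k)) \<longlonglongrightarrow> 0"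
    by (rule tendsto_sandwich[OF _ _ tendsto_const E]) (use bound in auto)
  then show ?thesis
    by (subst tendsto_iff) (simp add: tendsto_iff dist_norm norm_minus_commute)
qed

lemma fc_trig_mult:
  assumes A: "finite A"
  shows "complex_of_real ((2 * pi)\<^sup>2) * fc (\<lambda>x. trig A b x * trig A c x) (- l) =
    complex_of_real ((2 * pi)\<^sup>2) * (\<Sum>j\<in>A. \<Sum>k\<in>A. if j + k + l = 0 then b j * c k else 0)"
proof -
  have "complex_of_real ((2 * pi)\<^sup>2) * fc (\<lambda>x. trig A b x * trig A c x) (- l) =
     (LINT x|TM. (\<Sum>j\<in>A. \<Sum>k\<in>A. b j * c k * wave (j + k + l) x))"
    by (simp add: fc_def trig_mult sum_distrib_right wave_add mult.assoc)
  also have "\<dots> = (\<Sum>j\<in>A. \<Sum>k\<in>A. b j * c k * (LINT x|TM. wave (j + k + l) x))"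
    by (simp add: Bochner_Integration.integral_sum)
  also have "\<dots> = (\<Sum>j\<in>A. \<Sum>k\<in>A. complex_of_real ((2 * pi)\<^sup>2) * (if j + k + l = 0 then b j * c k else 0))"
    by (intro sum.cong refl) (auto simp: integral_wave)
  finally show ?thesis by (simp add: sum_distrib_left)
qed

subsection \<open>The nonlinear term of a solution\<close>

lemma torus_L2_L2:
  assumes "\<phi> \<in> torus_L2"
  shows "(\<lambda>x. complex_of_real (\<phi> x)) \<in> L2"
  using assms unfolding torus_L2_def L2_def set_integrable_torus by auto

lemma fc_real_minus: "fc (\<lambda>x. complex_of_real (g x)) (- k) = cnj (fc (\<lambda>x. complex_of_real (g x)) k)"
proof -
  have "cnj (LINT x|TM. complex_of_real (g x) * cnj (wave k x)) = (LINT x|TM. complex_of_real (g x) * wave k x)"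
    by (subst Bochner_Integration.integral_cnj[symmetric]) simp
  then show ?thesis by (simp add: fc_def)
qed

lemma zero_powr_weight [simp]: "norm (wavevec 0) powr \<sigma> = 0"
  by simp

lemma Hnorm_sq_UNIV:
  "Hnorm_sq \<sigma> \<phi> = (\<Sum>\<^sub>\<infinity>k. norm (wavevec k) powr (2 * \<sigma>) * (cmod (fourier_coeff \<phi> k))\<^sup>2)"
  "(\<lambda>k. norm (wavevec k) powr (2 * \<sigma>) * (cmod (fourier_coeff \<phi> k))\<^sup>2) summable_on (UNIV - {0}) \<longleftrightarrow>
   (\<lambda>k. norm (wavevec k) powr (2 * \<sigma>) * (cmod (fourier_coeff \<phi> k))\<^sup>2) summable_on UNIV"
  unfolding Hnorm_sq_def by (rule infsum_cong_neutral; simp) (rule summable_on_cong_neutral; simp)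

lemma weight_mono:
  assumes "\<sigma> \<le> \<tau>"
  shows "norm (wavevec k) powr \<sigma> \<le> norm (wavevec k) powr \<tau>"
proof (cases "k = 0")
  case False
  then show ?thesis using one_le_norm_wavevec[OF False] assms by (intro powr_mono) auto
qed simp

lemma sobolev_summable:
  assumes "\<phi> \<in> sobolev s" "\<sigma> \<le> 2 * s"
  shows "(\<lambda>k. norm (wavevec k) powr \<sigma> * (cmod (fourier_coeff \<phi> k))\<^sup>2) summable_on UNIV"
proof (rule summable_on_comparison_test)
  show "(\<lambda>k. norm (wavevec k) powr (2 * s) * (cmod (fourier_coeff \<phi> k))\<^sup>2) summable_on UNIV"
    using assms(1) unfolding sobolev_def Hnorm_sq_UNIV(2) by simp
  show "norm (wavevec k) powr \<sigma> * (cmod (fourier_coeff \<phi> k))\<^sup>2 \<le> norm (wavevec k) powr (2 * s) * (cmod (fourier_coeff \<phi> k))\<^sup>2" for k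
    using assms(2) by (intro mult_right_mono weight_mono) auto
qed simp

lemma cmod_weight_sq: "(cmod (complex_of_real (norm (wavevec k) powr \<sigma>) * z))\<^sup>2 = norm (wavevec k) powr (2 * \<sigma>) * (cmod z)\<^sup>2"
  unfolding norm_mult norm_of_real power_mult_distrib power2_abs
  by (simp add: power2_eq_square flip: powr_add)

text \<open>For Fejer means the pairing is exactly the trilinear form of a polynomial with the same
  Hoelder constant, so the bound is uniform in \<open>n\<close>. Weak convergence of the product
  coefficients then suffices, as \<open>\<Lambda>\<^sup>2\<^sup>\<alpha>\<close> applied to \<phi>
  is square summable by \<open>2 * \<alpha> \<le> s\<close>.\<close>

theorem nonlinear_term_bound:
  assumes \<gamma>: "0 < \<gamma>" and \<alpha>: "0 < \<alpha>" "\<alpha> < 1" and \<beta>: "1 - \<gamma> < \<beta>" "0 < \<beta>" "\<beta> < 1"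
    and s: "2 * \<alpha> \<le> s" "2 * \<alpha> + \<gamma> \<le> 2 * s"
  obtains C where "C > 0"
    "\<And>K \<phi> D R. \<phi> \<in> sobolev s \<Longrightarrow> (\<And>x y. \<bar>\<phi> x - \<phi> y\<bar> \<le> K * norm (x - y) powr \<beta>) \<Longrightarrow>
      (\<And>j. multiplier_image (partial_symbol j) \<phi> (D j)) \<Longrightarrow> (\<And>j. multiplier_image (riesz_symbol j) \<phi> (R j)) \<Longrightarrow>
      cmod (\<Sum>\<^sub>\<infinity>k. norm (wavevec k) powr (2 * \<alpha>) * fourier_coeff \<phi> k *
        cnj (fourier_coeff (\<lambda>x. - R 2 x * D 1 x + R 1 x * D 2 x) k)) \<le>
      1 / 2 * Hnorm_sq (\<alpha> + \<gamma> / 2) \<phi> + C * K powr (4 * \<gamma> / (\<gamma> + \<beta> - 1)) \<and>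
      (\<lambda>k. norm (wavevec k) powr (2 * \<alpha>) * fourier_coeff \<phi> k *
        cnj (fourier_coeff (\<lambda>x. - R 2 x * D 1 x + R 1 x * D 2 x) k)) summable_on UNIV"
proof -
  obtain C where C: "C > 0" "\<And>A a K. finite A \<Longrightarrow> holder_bound \<beta> K (trig A a) \<Longrightarrow>
       cmod (\<Sum>l\<in>A. complex_of_real (norm (wavevec l) powr (2 * \<alpha>)) * triad A a l) \<le>
       1 / 2 * (\<Sum>k\<in>A. norm (wavevec k) powr (2 * \<alpha> + \<gamma>) * (cmod (a k))\<^sup>2) + C * K powr (4 * \<gamma> / (\<gamma> + \<beta> - 1))"
    using trilinear_absorbed[OF \<gamma> \<alpha> \<beta>] by blast
  obtain CR where CR: "CR > 0" "\<And>A a K j. finite A \<Longrightarrow> holder_bound \<beta> K (trig A a) \<Longrightarrow>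
        holder_bound \<beta> (CR * K) (trig A (\<lambda>k. riesz_symbol j k * a k))"
    using riesz_holder[OF \<beta>(2,3)] by blast
  show thesis
  proof (rule that[OF C(1)])
    fix K :: real and \<phi> :: "real^2 \<Rightarrow> real" and D R :: "2 \<Rightarrow> real^2 \<Rightarrow> real"
    assume sob: "\<phi> \<in> sobolev s" and hold: "\<And>x y. \<bar>\<phi> x - \<phi> y\<bar> \<le> K * norm (x - y) powr \<beta>"
      and D: "\<And>j. multiplier_image (partial_symbol j) \<phi> (D j)"
      and R: "\<And>j. multiplier_image (riesz_symbol j) \<phi> (R j)"
    let ?c = "\<lambda>g :: real^2 \<Rightarrow> real. (\<lambda>x. complex_of_real (g x))"
    let ?w = "\<lambda>k. norm (wavevec k) powr (2 * \<alpha>)"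
    define a where "a = fourier_coeff \<phi>"
    define g where "g = (\<lambda>x. - R 2 x * D 1 x + R 1 x * D 2 x)"
    define an where "an = (\<lambda>n k. complex_of_real (fejer_weight n k) * a k)"
    let ?A = fejer_supp
    have L2\<phi>: "?c \<phi> \<in> L2" using sob by (auto simp: sobolev_def intro: torus_L2_L2)
    have L2D: "?c (D j) \<in> L2" for j using D[of j] by (auto simp: multiplier_image_def intro: torus_L2_L2)
    have L2R: "?c (R j) \<in> L2" for j using R[of j] by (auto simp: multiplier_image_def intro: torus_L2_L2)
    have per: "periodic \<phi>" using sob by (simp add: sobolev_def torus_L2_def)
    have a0: "a 0 = 0"
    proof -
      have "(LINT x|TM. \<phi> x) = 0" using sob by (simp add: sobolev_def set_integral_torus)
      then show ?thesis by (simp add: a_def fourier_coeff_TM)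
    qed
    have fc\<phi>: "fc (?c \<phi>) k = a k" for k by (simp add: a_def fourier_coeff_fc)
    have fcD: "fc (?c (D j)) k = partial_symbol j k * a k" for j k
      using D[of j] by (simp add: a_def multiplier_image_def fourier_coeff_fc)
    have fcR: "fc (?c (R j)) k = riesz_symbol j k * a k" for j k
      using R[of j] by (simp add: a_def multiplier_image_def fourier_coeff_fc)
    have f\<phi>: "fejer n (?c \<phi>) = trig (?A n) (an n)" for n by (simp add: fejer_def fc\<phi> an_def)
    have fD: "fejer n (?c (D j)) = trig (?A n) (\<lambda>k. partial_symbol j k * an n k)" for n j
      by (simp add: fejer_def fcD an_def mult.left_commute)
    have fR: "fejer n (?c (R j)) = trig (?A n) (\<lambda>k. riesz_symbol j k * an n k)" for n j
      by (simp add: fejer_def fcR an_def mult.left_commute)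
    have hb: "holder_bound \<beta> K (trig (?A n) (an n))" if "n > 0" for n
      unfolding f\<phi>[symmetric] by (rule fejer_holder[OF per L2\<phi> hold that])
    \<comment> \<open>A supremum bound for the velocity means, uniform in \<open>n\<close>. It
      upgrades the products from the integral norm to mean square, with the bound \<open>M\<close>
      below.\<close>
    define U where "U = CR * K * (4 * pi) powr \<beta>"
    have Ub: "cmod (fejer n (?c (R j)) x) \<le> U" if "n > 0" "x \<in> torus" for n j x
      unfolding fR U_def using a0 that
      by (intro trig_sup_bound CR(2) hb \<beta>(2)) (auto simp: an_def)
    define gn where "gn = (\<lambda>n x. fejer n (?c (R 1)) x * fejer n (?c (D 2)) x - fejer n (?c (R 2)) x * fejer n (?c (D 1)) x)"
    define bn where "bn = (\<lambda>n l. fc (\<lambda>x. fejer n (?c (R 1)) x * fejer n (?c (D 2)) x) (- l) -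
       fc (\<lambda>x. fejer n (?c (R 2)) x * fejer n (?c (D 1)) x) (- l))"
    have prodL2: "(\<lambda>x. fejer n (?c (R i)) x * fejer n (?c (D j)) x) \<in> L2" for n i j
      unfolding fR fD L2_def by (auto intro!: integrable_TM_continuous borel_measurable_continuous_onI continuous_intros)
    have gnL2: "gn n \<in> L2" for n unfolding gn_def by (intro L2_diff prodL2)
    have bn_fc: "bn n l = fc (gn n) (- l)" for n l
      unfolding bn_def gn_def by (rule fc_diff[OF prodL2 prodL2, symmetric])
    define M where "M = (U\<^sup>2 * 2 * (sqnorm (?c (D 2)) + sqnorm (?c (D 1)))) / (2 * pi)\<^sup>2"
    have bnM: "ell2_le M (bn n)" if n: "n > 0" for n
    proof -
      let ?q2 = "\<lambda>x. (cmod (fejer n (?c (D 2)) x))\<^sup>2" and ?q1 = "\<lambda>x. (cmod (fejer n (?c (D 1)) x))\<^sup>2"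
      have U0: "0 \<le> U" using Ub[OF n, of 0 1] by (rule order_trans[OF norm_ge_zero]) (simp add: mem_torus)
      have "sqnorm (gn n) \<le> (LINT x|TM. U\<^sup>2 * 2 * (?q2 x + ?q1 x))"
        unfolding sqnorm_def
      proof (rule integral_mono[OF L2_D(3)[OF gnL2]])
        show "integrable TM (\<lambda>x. U\<^sup>2 * 2 * (?q2 x + ?q1 x))"
          by (intro integrable_mult_right Bochner_Integration.integrable_add L2_D(3) fejer_L2)
        fix x assume "x \<in> space TM"
        then have x: "x \<in> torus" by simp
        have "cmod (gn n x) \<le> cmod (fejer n (?c (R 1)) x * fejer n (?c (D 2)) x) + cmod (fejer n (?c (R 2)) x * fejer n (?c (D 1)) x)"
          unfolding gn_def by (rule norm_triangle_ineq4)
        also have "\<dots> \<le> U * cmod (fejer n (?c (D 2)) x) + U * cmod (fejer n (?c (D 1)) x)"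
          unfolding norm_mult by (intro add_mono mult_right_mono Ub n x) auto
        finally have "(cmod (gn n x))\<^sup>2 \<le> (U * (cmod (fejer n (?c (D 2)) x) + cmod (fejer n (?c (D 1)) x)))\<^sup>2"
          by (intro power_mono) (auto simp: distrib_left)
        also have "\<dots> = U\<^sup>2 * (cmod (fejer n (?c (D 2)) x) + cmod (fejer n (?c (D 1)) x))\<^sup>2"
          by (rule power_mult_distrib)
        also have "\<dots> \<le> U\<^sup>2 * (2 * (?q2 x + ?q1 x))"
          using sum_squares_bound[of "cmod (fejer n (?c (D 2)) x)" "cmod (fejer n (?c (D 1)) x)"]
          by (intro mult_left_mono) (auto simp: power2_sum)
        finally show "(cmod (gn n x))\<^sup>2 \<le> U\<^sup>2 * 2 * (?q2 x + ?q1 x)" by (simp only: mult.assoc)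
      qed
      also have "\<dots> = U\<^sup>2 * 2 * (sqnorm (fejer n (?c (D 2))) + sqnorm (fejer n (?c (D 1))))"
        unfolding sqnorm_def using L2_D(3)[OF fejer_L2] by simp
      also have "\<dots> \<le> U\<^sup>2 * 2 * (sqnorm (?c (D 2)) + sqnorm (?c (D 1)))"
        by (intro mult_left_mono add_mono fejer_contraction L2D) auto
      also have "\<dots> = M * (2 * pi)\<^sup>2" unfolding M_def by (rule nonzero_eq_divide_eq[THEN iffD1, symmetric]) auto
      finally have sqnorm_gn: "sqnorm (gn n) \<le> M * (2 * pi)\<^sup>2" .
      show ?thesis
        unfolding ell2_le_def bn_fc
      proof (intro allI impI)
        fix F :: "(int^2) set" assume F: "finite F"
        have reindex: "(\<Sum>k\<in>F. (cmod (fc (gn n) (- k)))\<^sup>2) = (\<Sum>k\<in>uminus ` F. (cmod (fc (gn n) k))\<^sup>2)"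
          by (subst sum.reindex) (auto simp: inj_on_def)
        have "(2 * pi)\<^sup>2 * (\<Sum>k\<in>F. (cmod (fc (gn n) (- k)))\<^sup>2) \<le> M * (2 * pi)\<^sup>2"
          unfolding reindex by (rule order_trans[OF bessel[OF gnL2 finite_imageI[OF F]] sqnorm_gn])
        then have "(2 * pi)\<^sup>2 * (\<Sum>k\<in>F. (cmod (fc (gn n) (- k)))\<^sup>2) \<le> (2 * pi)\<^sup>2 * M" by (simp only: mult.commute)
        then show "(\<Sum>k\<in>F. (cmod (fc (gn n) (- k)))\<^sup>2) \<le> M" by (rule mult_left_le_imp_le) simp
      qed
    qed
    have gint: "fourier_coeff g k = fc (\<lambda>x. ?c (R 1) x * ?c (D 2) x) k - fc (\<lambda>x. ?c (R 2) x * ?c (D 1) x) k" for k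
    proof -
      have i: "integrable TM (\<lambda>x. ?c (R i) x * ?c (D j) x * cnj (wave k x))" for i j
        by (rule integrable_mult_wave[OF L2_mult_integrable[OF L2R L2D]])
      have "(LINT x|TM. ?c g x * cnj (wave k x)) =
        (LINT x|TM. ?c (R 1) x * ?c (D 2) x * cnj (wave k x) - ?c (R 2) x * ?c (D 1) x * cnj (wave k x))"
        by (simp add: g_def algebra_simps)
      also have "\<dots> = (LINT x|TM. ?c (R 1) x * ?c (D 2) x * cnj (wave k x)) - (LINT x|TM. ?c (R 2) x * ?c (D 1) x * cnj (wave k x))"
        by (rule Bochner_Integration.integral_diff[OF i i])
      finally show ?thesis by (simp only: fourier_coeff_fc fc_def diff_divide_distrib)
    qed
    have bn_lim: "(\<lambda>n. bn n l) \<longlonglongrightarrow> cnj (fourier_coeff g l)" for l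
    proof -
      have "(\<lambda>n. bn n l) \<longlonglongrightarrow> fourier_coeff g (- l)"
        unfolding bn_def gint by (intro tendsto_diff fc_fejer_mult_tendsto L2R L2D)
      then show ?thesis by (simp add: fourier_coeff_fc fc_real_minus)
    qed
    \<comment> \<open>The Fejer weight of the third factor is grouped with \<open>bn\<close>, so
      that the other side of the pairing does not depend on \<open>n\<close>.\<close>
    have key: "(\<Sum>l\<in>?A n. complex_of_real (?w l) * triad (?A n) (an n) l) = (\<Sum>l\<in>?A n. fejer_weight n l * bn n l * (?w l * a l))" for n
    proof (intro sum.cong refl)
      fix l
      have P: "(2 * pi)\<^sup>2 \<noteq> (0::real)" by simp
      have fm: "fc (\<lambda>x. trig (?A n) b x * trig (?A n) c x) (- l) = (\<Sum>j\<in>?A n. \<Sum>k\<in>?A n. if j + k + l = 0 then b j * c k else 0)" for b c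
        using fc_trig_mult[OF finite_fejer_supp[of n], of b c l] P by simp
      have "triad (?A n) (an n) l = bn n l * an n l"
        unfolding triad_def bn_def fR fD fm sum_subtractf[symmetric] sum_distrib_right
        by (intro sum.cong refl) (simp add: sqg_symbol_def algebra_simps)
      then show "complex_of_real (?w l) * triad (?A n) (an n) l = fejer_weight n l * bn n l * (?w l * a l)"
        by (simp add: an_def)
    qed
    have summ: "(\<lambda>k. norm (wavevec k) powr \<sigma> * (cmod (a k))\<^sup>2) summable_on UNIV" if "\<sigma> \<le> 2 * s" for \<sigma>
      unfolding a_def by (rule sobolev_summable[OF sob that])
    define Y where "Y = (\<Sum>\<^sub>\<infinity>k. (cmod (complex_of_real (?w k) * a k))\<^sup>2)"
    have y: "ell2_le Y (\<lambda>k. ?w k * a k)"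
      unfolding Y_def using summ[of "2 * (2 * \<alpha>)"] s(1) by (intro ell2_le_infsum) (simp add: cmod_weight_sq)
    \<comment> \<open>\<open>Suc n\<close>, since the Hoelder bound for the means is available for
      positive order only.\<close>
    define x where "x = (\<lambda>n k. complex_of_real (fejer_weight (Suc n) k) * bn (Suc n) k)"
    have xM: "ell2_le M (x n)" for n
      unfolding x_def using fejer_weight_nonneg[of "Suc n"] fejer_weight_le_1[of "Suc n"]
      by (intro ell2_le_mono[OF bnM[of "Suc n"]]) (auto simp: norm_mult mult_left_le_one_le)
    have xlim: "(\<lambda>n. x n k) \<longlonglongrightarrow> cnj (fourier_coeff g k)" for k
    proof -
      have "(\<lambda>n. complex_of_real (fejer_weight n k) * bn n k) \<longlonglongrightarrow> complex_of_real 1 * cnj (fourier_coeff g k)"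
        by (intro tendsto_mult tendsto_of_real fejer_weight_tendsto bn_lim)
      from LIMSEQ_Suc[OF this] show ?thesis by (simp add: x_def)
    qed
    note wl = ell2_le_weak_limit[of M x "\<lambda>k. cnj (fourier_coeff g k)" Y "\<lambda>k. complex_of_real (?w k) * a k" "\<lambda>n. ?A (Suc n)", OF xM xlim y]
    have x0: "x n k = 0" if "k \<notin> ?A (Suc n)" for n k using that by (simp add: x_def fejer_weight_outside)
    have lim: "(\<lambda>n. \<Sum>k\<in>?A (Suc n). x n k * (?w k * a k)) \<longlonglongrightarrow> (\<Sum>\<^sub>\<infinity>k. cnj (fourier_coeff g k) * (?w k * a k))"
      and g2: "ell2_le M (\<lambda>k. cnj (fourier_coeff g k))"
      using wl x0 by auto
    have bound: "cmod (\<Sum>k\<in>?A (Suc n). x n k * (?w k * a k)) \<le>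
        1 / 2 * Hnorm_sq (\<alpha> + \<gamma> / 2) \<phi> + C * K powr (4 * \<gamma> / (\<gamma> + \<beta> - 1))" for n
    proof -
      have "(\<Sum>k\<in>?A (Suc n). x n k * (?w k * a k)) = (\<Sum>l\<in>?A (Suc n). complex_of_real (?w l) * triad (?A (Suc n)) (an (Suc n)) l)"
        unfolding key x_def by simp
      also have "cmod \<dots> \<le> 1 / 2 * (\<Sum>k\<in>?A (Suc n). norm (wavevec k) powr (2 * \<alpha> + \<gamma>) * (cmod (an (Suc n) k))\<^sup>2) + C * K powr (4 * \<gamma> / (\<gamma> + \<beta> - 1))"
        by (rule C(2)[OF finite_fejer_supp hb]) simp
      also have "(\<Sum>k\<in>?A (Suc n). norm (wavevec k) powr (2 * \<alpha> + \<gamma>) * (cmod (an (Suc n) k))\<^sup>2) \<le> Hnorm_sq (\<alpha> + \<gamma> / 2) \<phi>"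
      proof -
        have "(\<Sum>k\<in>?A (Suc n). norm (wavevec k) powr (2 * \<alpha> + \<gamma>) * (cmod (an (Suc n) k))\<^sup>2) \<le>
          (\<Sum>k\<in>?A (Suc n). norm (wavevec k) powr (2 * \<alpha> + \<gamma>) * (cmod (a k))\<^sup>2)"
          using fejer_weight_nonneg[of "Suc n"] fejer_weight_le_1[of "Suc n"]
          by (intro sum_mono mult_left_mono power_mono) (auto simp: an_def norm_mult mult_left_le_one_le)
        also have "\<dots> \<le> (\<Sum>\<^sub>\<infinity>k. norm (wavevec k) powr (2 * \<alpha> + \<gamma>) * (cmod (a k))\<^sup>2)"
          by (intro finite_sum_le_infsum summ s) auto
        finally show ?thesis by (simp add: Hnorm_sq_UNIV a_def distrib_left)
      qed
      finally show ?thesis by simp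
    qed
    have "cmod (\<Sum>\<^sub>\<infinity>k. cnj (fourier_coeff g k) * (?w k * a k)) \<le> 1 / 2 * Hnorm_sq (\<alpha> + \<gamma> / 2) \<phi> + C * K powr (4 * \<gamma> / (\<gamma> + \<beta> - 1))"
      by (rule LIMSEQ_le_const2[OF tendsto_norm[OF lim]]) (use bound in auto)
    moreover have "(\<lambda>k. cnj (fourier_coeff g k) * (?w k * a k)) summable_on UNIV"
      by (rule ell2_le_mult(1)[OF g2 y])
    moreover have "(\<lambda>k. cnj (fourier_coeff g k) * (?w k * a k)) = (\<lambda>k. ?w k * fourier_coeff \<phi> k * cnj (fourier_coeff g k))"
      by (simp add: a_def mult_ac)
    ultimately show "cmod (\<Sum>\<^sub>\<infinity>k. ?w k * fourier_coeff \<phi> k * cnj (fourier_coeff (\<lambda>x. - R 2 x * D 1 x + R 1 x * D 2 x) k)) \<le>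
      1 / 2 * Hnorm_sq (\<alpha> + \<gamma> / 2) \<phi> + C * K powr (4 * \<gamma> / (\<gamma> + \<beta> - 1)) \<and>
      (\<lambda>k. ?w k * fourier_coeff \<phi> k * cnj (fourier_coeff (\<lambda>x. - R 2 x * D 1 x + R 1 x * D 2 x) k)) summable_on UNIV"
      unfolding g_def[symmetric] by simp
  qed
qed

subsection \<open>Differentiation in time\<close>

lemma ell2_le_bessel: "\<phi> \<in> L2 \<Longrightarrow> ell2_le (sqnorm \<phi> / (2 * pi)\<^sup>2) (fc \<phi>)"
  unfolding ell2_le_def using bessel[of \<phi>] by (auto simp: le_divide_eq mult.commute)

lemma sobolev_L2: "\<phi> \<in> sobolev s \<Longrightarrow> (\<lambda>x. complex_of_real (\<phi> x)) \<in> L2"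
  by (auto simp: sobolev_def intro: torus_L2_L2)

lemma fourier_coeff_diff:
  assumes "\<phi> \<in> sobolev s" "\<psi> \<in> sobolev s"
  shows "fourier_coeff (\<lambda>x. \<phi> x - \<psi> x) k = fourier_coeff \<phi> k - fourier_coeff \<psi> k"
  unfolding fourier_coeff_fc of_real_diff
  by (rule fc_diff[OF sobolev_L2[OF assms(1)] sobolev_L2[OF assms(2)]])

text \<open>By the spectral gap, continuity in the highest norm controls differences in every lower
  weight, in particular in the weight \<open>2 * \<alpha>\<close> of the test function.\<close>

lemma ell2_le_sobolev_diff:
  assumes "\<phi> \<in> sobolev s" "\<psi> \<in> sobolev s" "\<sigma> \<le> s"
  shows "ell2_le (Hnorm_sq s (\<lambda>x. \<phi> x - \<psi> x))
    (\<lambda>k. norm (wavevec k) powr \<sigma> * (fourier_coeff \<phi> k - fourier_coeff \<psi> k))"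
  unfolding ell2_le_def
proof (intro allI impI)
  fix F :: "(int^2) set" assume F: "finite F"
  let ?d = "\<lambda>k. fourier_coeff \<phi> k - fourier_coeff \<psi> k"
  have summ: "(\<lambda>k. norm (wavevec k) powr (2 * s) * (cmod (?d k))\<^sup>2) summable_on UNIV"
  proof (rule summable_on_comparison_test)
    show "(\<lambda>k. 2 * (norm (wavevec k) powr (2 * s) * (cmod (fourier_coeff \<phi> k))\<^sup>2) +
        2 * (norm (wavevec k) powr (2 * s) * (cmod (fourier_coeff \<psi> k))\<^sup>2)) summable_on UNIV"
      by (intro summable_on_add summable_on_cmult_right
          sobolev_summable[OF assms(1) order_refl] sobolev_summable[OF assms(2) order_refl])
    fix k
    have "(cmod (?d k))\<^sup>2 \<le> (cmod (fourier_coeff \<phi> k) + cmod (fourier_coeff \<psi> k))\<^sup>2"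
      by (intro power_mono norm_triangle_ineq4) auto
    also have "\<dots> \<le> 2 * (cmod (fourier_coeff \<phi> k))\<^sup>2 + 2 * (cmod (fourier_coeff \<psi> k))\<^sup>2"
      using sum_squares_bound[of "cmod (fourier_coeff \<phi> k)" "cmod (fourier_coeff \<psi> k)"] by (simp add: power2_sum)
    finally have "norm (wavevec k) powr (2 * s) * (cmod (?d k))\<^sup>2 \<le>
       norm (wavevec k) powr (2 * s) * (2 * (cmod (fourier_coeff \<phi> k))\<^sup>2 + 2 * (cmod (fourier_coeff \<psi> k))\<^sup>2)"
      by (rule mult_left_mono) simp
    then show "norm (wavevec k) powr (2 * s) * (cmod (?d k))\<^sup>2 \<le> 2 * (norm (wavevec k) powr (2 * s) * (cmod (fourier_coeff \<phi> k))\<^sup>2) +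
        2 * (norm (wavevec k) powr (2 * s) * (cmod (fourier_coeff \<psi> k))\<^sup>2)"
      by (simp only: distrib_left mult.left_commute)
  qed simp
  have "(\<Sum>k\<in>F. (cmod (norm (wavevec k) powr \<sigma> * ?d k))\<^sup>2) \<le> (\<Sum>k\<in>F. norm (wavevec k) powr (2 * s) * (cmod (?d k))\<^sup>2)"
    unfolding cmod_weight_sq using assms(3) by (intro sum_mono mult_right_mono weight_mono) auto
  also have "\<dots> \<le> (\<Sum>\<^sub>\<infinity>k. norm (wavevec k) powr (2 * s) * (cmod (?d k))\<^sup>2)"
    by (intro finite_sum_le_infsum summ F) auto
  also have "\<dots> = Hnorm_sq s (\<lambda>x. \<phi> x - \<psi> x)"
    unfolding Hnorm_sq_UNIV fourier_coeff_diff[OF assms(1,2)] ..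
  finally show "(\<Sum>k\<in>F. (cmod (norm (wavevec k) powr \<sigma> * ?d k))\<^sup>2) \<le> Hnorm_sq s (\<lambda>x. \<phi> x - \<psi> x)" .
qed

text \<open>The first term is paired with the \<open>L\<^sup>2\<close> error of the time difference quotient, the second with the
  error in \<open>H\<^sup>2\<^sup>\<alpha>\<close>, so that neither needs more regularity than a strong solution has.\<close>

lemma energy_difference_quotient:
  fixes x y b :: complex and w \<delta> :: real
  assumes "\<delta> \<noteq> 0"
  shows "(w * (cmod x)\<^sup>2 - w * (cmod y)\<^sup>2) / \<delta> - 2 * Re (w * b * cnj y) =
    Re (((x - y) / \<delta> - b) * cnj (w * (x + y)) + b * cnj (w * (x - y)))"
proof -
  define z where "z = (x - y) * cnj (x + y)"
  have eq: "((x - y) / \<delta> - b) * cnj (w * (x + y)) + b * cnj (w * (x - y)) =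
     complex_of_real (w / \<delta>) * z - 2 * (w * b * cnj y)"
    using assms by (simp add: z_def field_simps)
  have "Re z = (cmod x)\<^sup>2 - (cmod y)\<^sup>2"
    unfolding z_def cmod_power2 by (simp add: power2_eq_square algebra_simps)
  moreover have "Re (complex_of_real (w / \<delta>) * z - 2 * (w * b * cnj y)) = w / \<delta> * Re z - 2 * Re (w * b * cnj y)"
    by simp
  ultimately show ?thesis unfolding eq
    by (simp only: right_diff_distrib diff_divide_distrib times_divide_eq_left)
qed

text \<open>Sum \<open>energy_difference_quotient\<close> over all frequencies. By Cauchy-Schwarz
  one part is at most the error of the time quotient times a bounded norm, the other the norm of
  \<open>\<theta>'\<close> times the distance of \<open>\<theta> \<tau>\<close> from
  \<open>\<theta> t\<close>; both vanish as \<tau> tends to \<open>t\<close>.\<close>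

theorem Hnorm_sq_time_derivative:
  assumes \<sigma>: "2 * \<alpha> \<le> s" "0 \<le> s" and t: "0 \<le> t"
    and sob: "\<And>\<tau>. 0 \<le> \<tau> \<Longrightarrow> \<theta> \<tau> \<in> sobolev s"
    and cont: "((\<lambda>\<tau>. Hnorm_sq s (\<lambda>x. \<theta> \<tau> x - \<theta> t x)) \<longlongrightarrow> 0) (at t within {0..})"
    and deriv: "has_time_derivative \<theta> \<theta>' t"
  shows "((\<lambda>\<tau>. Hnorm_sq \<alpha> (\<theta> \<tau>)) has_real_derivative
      2 * Re (\<Sum>\<^sub>\<infinity>k. norm (wavevec k) powr (2 * \<alpha>) * fourier_coeff \<theta>' k * cnj (fourier_coeff (\<theta> t) k))) (at t within {0..})"
    and "(\<lambda>k. norm (wavevec k) powr (2 * \<alpha>) * fourier_coeff \<theta>' k * cnj (fourier_coeff (\<theta> t) k)) summable_on UNIV"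
proof -
  define w where "w = (\<lambda>k. norm (wavevec k) powr (2 * \<alpha>))"
  define a where "a = (\<lambda>\<tau>. fourier_coeff (\<theta> \<tau>))"
  define b where "b = fourier_coeff \<theta>'"
  define H where "H = (\<lambda>\<tau>. Hnorm_sq \<alpha> (\<theta> \<tau>))"
  define N where "N = (\<Sum>\<^sub>\<infinity>k. (cmod (w k * a t k))\<^sup>2)"
  have L2': "(\<lambda>x. complex_of_real (\<theta>' x)) \<in> L2"
    using deriv by (auto simp: has_time_derivative_def intro: torus_L2_L2)
  define Nb where "Nb = sqnorm (\<lambda>x. complex_of_real (\<theta>' x)) / (2 * pi)\<^sup>2"
  have lb: "ell2_le Nb b"
    using ell2_le_bessel[OF L2'] by (simp add: Nb_def b_def fourier_coeff_fc[abs_def])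
  have ly: "ell2_le N (\<lambda>k. w k * a t k)"
    unfolding N_def w_def a_def using sobolev_summable[OF sob[OF t], of "2 * (2 * \<alpha>)"] \<sigma>
    by (intro ell2_le_infsum) (simp add: cmod_weight_sq)
  define e1 where "e1 = (\<lambda>\<tau>. (LINT x:torus|lborel. ((\<theta> \<tau> x - \<theta> t x) / (\<tau> - t) - \<theta>' x)\<^sup>2) / (2 * pi)\<^sup>2)"
  define e2 where "e2 = (\<lambda>\<tau>. Hnorm_sq s (\<lambda>x. \<theta> \<tau> x - \<theta> t x))"
  have e1: "(e1 \<longlongrightarrow> 0) (at t within {0..})"
  proof -
    have "(e1 \<longlongrightarrow> 0 / (2 * pi)\<^sup>2) (at t within {0..})"
      unfolding e1_def using deriv by (intro tendsto_divide tendsto_const) (auto simp: has_time_derivative_def)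
    then show ?thesis by simp
  qed
  have e2: "(e2 \<longlongrightarrow> 0) (at t within {0..})" unfolding e2_def by (rule cont)
  have lq: "ell2_le (e1 \<tau>) (\<lambda>k. (a \<tau> k - a t k) / complex_of_real (\<tau> - t) - b k)" if \<tau>: "0 \<le> \<tau>" for \<tau>
  proof -
    let ?c = "\<lambda>g :: real^2 \<Rightarrow> real. (\<lambda>x. complex_of_real (g x))"
    let ?q = "\<lambda>x. complex_of_real (1 / (\<tau> - t)) * (?c (\<theta> \<tau>) x - ?c (\<theta> t) x) - ?c \<theta>' x"
    note L2s = sobolev_L2[OF sob[OF \<tau>]] sobolev_L2[OF sob[OF t]]
    have "?q \<in> L2" by (intro L2_diff L2_cmult L2s L2')
    then have lq: "ell2_le (sqnorm ?q / (2 * pi)\<^sup>2) (fc ?q)" by (rule ell2_le_bessel)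
    have fcq: "fc ?q k = (a \<tau> k - a t k) / complex_of_real (\<tau> - t) - b k" for k
      by (subst fc_diff[OF L2_cmult[OF L2_diff[OF L2s]] L2'], subst fc_cmult, subst fc_diff[OF L2s])
         (simp add: a_def b_def fourier_coeff_fc)
    have nq: "sqnorm ?q = (LINT x:torus|lborel. ((\<theta> \<tau> x - \<theta> t x) / (\<tau> - t) - \<theta>' x)\<^sup>2)"
    proof -
      have "(cmod (?q x))\<^sup>2 = ((\<theta> \<tau> x - \<theta> t x) / (\<tau> - t) - \<theta>' x)\<^sup>2" for x
      proof -
        have "?q x = complex_of_real ((\<theta> \<tau> x - \<theta> t x) / (\<tau> - t) - \<theta>' x)" by simp
        then show ?thesis by (simp only: norm_of_real power2_abs)
      qed
      then show ?thesis unfolding sqnorm_def set_integral_torus by simp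
    qed
    show ?thesis unfolding e1_def nq[symmetric] fcq[symmetric] by (rule lq)
  qed
  have ld: "ell2_le (e2 \<tau>) (\<lambda>k. w k * (a \<tau> k - a t k))" if "0 \<le> \<tau>" for \<tau>
    unfolding e2_def w_def a_def by (rule ell2_le_sobolev_diff[OF sob[OF that] sob[OF t] \<sigma>(1)])
  \<comment> \<open>The sum is the difference plus \<open>2 * a t k\<close>, so it stays bounded as
    \<tau> approaches \<open>t\<close>.\<close>
  have lsum: "ell2_le (2 * e2 \<tau> + 2 * (4 * N)) (\<lambda>k. w k * (a \<tau> k + a t k))" if "0 \<le> \<tau>" for \<tau>
  proof -
    have "ell2_le (4 * N) (\<lambda>k. 2 * (w k * a t k))"
      using ly unfolding ell2_le_def by (simp add: norm_mult power_mult_distrib flip: sum_distrib_left)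
    from ell2_le_add[OF ld[OF that] this] show ?thesis
      by (simp add: algebra_simps)
  qed
  have lyc: "ell2_le N (\<lambda>k. cnj (w k * a t k))" using ly by (rule ell2_le_cnj[THEN iffD2])
  have bs: "(\<lambda>k. w k * b k * cnj (a t k)) summable_on UNIV"
    using ell2_le_mult(1)[OF lb lyc] by (simp add: mult_ac)
  then show "(\<lambda>k. norm (wavevec k) powr (2 * \<alpha>) * fourier_coeff \<theta>' k * cnj (fourier_coeff (\<theta> t) k)) summable_on UNIV"
    by (simp add: w_def a_def b_def)
  define d where "d = 2 * Re (\<Sum>\<^sub>\<infinity>k. w k * b k * cnj (a t k))"
  have d: "((\<lambda>k. 2 * Re (w k * b k * cnj (a t k))) has_sum d) UNIV"
    unfolding d_def by (intro has_sum_cmult_right has_sum_Re has_sum_infsum bs)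
  have Hs: "((\<lambda>k. w k * (cmod (a \<tau> k))\<^sup>2) has_sum H \<tau>) UNIV" if "0 \<le> \<tau>" for \<tau>
    unfolding H_def Hnorm_sq_UNIV w_def a_def
    using \<sigma> by (intro has_sum_infsum sobolev_summable[OF sob[OF that]]) auto
  have bound: "norm ((H \<tau> - H t) / (\<tau> - t) - d) \<le>
      sqrt (e1 \<tau>) * sqrt (2 * e2 \<tau> + 2 * (4 * N)) + sqrt Nb * sqrt (e2 \<tau>)" if \<tau>: "0 \<le> \<tau>" "\<tau> \<noteq> t" for \<tau>
  proof -
    let ?q = "\<lambda>k. (a \<tau> k - a t k) / complex_of_real (\<tau> - t) - b k"
    have l1: "ell2_le (2 * e2 \<tau> + 2 * (4 * N)) (\<lambda>k. cnj (w k * (a \<tau> k + a t k)))" using lsum[OF \<tau>(1)] by (rule ell2_le_cnj[THEN iffD2])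
    have l2: "ell2_le (e2 \<tau>) (\<lambda>k. cnj (w k * (a \<tau> k - a t k)))" using ld[OF \<tau>(1)] by (rule ell2_le_cnj[THEN iffD2])
    define S1 where "S1 = (\<Sum>\<^sub>\<infinity>k. ?q k * cnj (w k * (a \<tau> k + a t k)))"
    define S2 where "S2 = (\<Sum>\<^sub>\<infinity>k. b k * cnj (w k * (a \<tau> k - a t k)))"
    have S1: "((\<lambda>k. ?q k * cnj (w k * (a \<tau> k + a t k))) has_sum S1) UNIV"
      unfolding S1_def by (rule has_sum_infsum[OF ell2_le_mult(1)[OF lq[OF \<tau>(1)] l1]])
    have S2: "((\<lambda>k. b k * cnj (w k * (a \<tau> k - a t k))) has_sum S2) UNIV"
      unfolding S2_def by (rule has_sum_infsum[OF ell2_le_mult(1)[OF lb l2]])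
    have "((\<lambda>k. Re (?q k * cnj (w k * (a \<tau> k + a t k)) + b k * cnj (w k * (a \<tau> k - a t k)))) has_sum Re (S1 + S2)) UNIV"
      by (intro has_sum_Re has_sum_add S1 S2)
    moreover have "((\<lambda>k. (w k * (cmod (a \<tau> k))\<^sup>2 - w k * (cmod (a t k))\<^sup>2) / (\<tau> - t) - 2 * Re (w k * b k * cnj (a t k)))
        has_sum ((H \<tau> - H t) / (\<tau> - t) - d)) UNIV"
    proof -
      have m: "((\<lambda>k. - f k) has_sum (- c)) UNIV" if "(f has_sum c) UNIV" for f :: "int^2 \<Rightarrow> real" and c
        using that by (rule has_sum_uminusI)
      have "((\<lambda>k. (1 / (\<tau> - t)) * (w k * (cmod (a \<tau> k))\<^sup>2 + - (w k * (cmod (a t k))\<^sup>2)) + - (2 * Re (w k * b k * cnj (a t k))))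
        has_sum ((1 / (\<tau> - t)) * (H \<tau> + - H t) + - d)) UNIV"
        by (intro has_sum_add has_sum_cmult_right m Hs \<tau> t d)
      moreover have "(1 / (\<tau> - t)) * (u + - v) + - z = (u - v) / (\<tau> - t) - z" for u v z by simp
      ultimately show ?thesis by (simp only:)
    qed
    moreover have "(\<lambda>k. (w k * (cmod (a \<tau> k))\<^sup>2 - w k * (cmod (a t k))\<^sup>2) / (\<tau> - t) - 2 * Re (w k * b k * cnj (a t k))) =
       (\<lambda>k. Re (?q k * cnj (w k * (a \<tau> k + a t k)) + b k * cnj (w k * (a \<tau> k - a t k))))"
      using \<tau>(2) by (intro ext energy_difference_quotient) simp
    ultimately have "(H \<tau> - H t) / (\<tau> - t) - d = Re (S1 + S2)"
      by (metis (no_types, lifting) has_sum_unique)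
    then have "norm ((H \<tau> - H t) / (\<tau> - t) - d) \<le> cmod S1 + cmod S2"
      using abs_Re_le_cmod[of "S1 + S2"] norm_triangle_ineq[of S1 S2] by simp
    moreover have "cmod S1 \<le> sqrt (e1 \<tau>) * sqrt (2 * e2 \<tau> + 2 * (4 * N))"
      unfolding S1_def by (rule ell2_le_mult(2)[OF lq[OF \<tau>(1)] l1])
    moreover have "cmod S2 \<le> sqrt Nb * sqrt (e2 \<tau>)"
      unfolding S2_def by (rule ell2_le_mult(2)[OF lb l2])
    ultimately show ?thesis by linarith
  qed
  have "((\<lambda>\<tau>. sqrt (e1 \<tau>) * sqrt (2 * e2 \<tau> + 2 * (4 * N)) + sqrt Nb * sqrt (e2 \<tau>)) \<longlongrightarrow>
      sqrt 0 * sqrt (2 * 0 + 2 * (4 * N)) + sqrt Nb * sqrt 0) (at t within {0..})"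
    by (intro tendsto_intros e1 e2)
  then have lim: "((\<lambda>\<tau>. sqrt (e1 \<tau>) * sqrt (2 * e2 \<tau> + 2 * (4 * N)) + sqrt Nb * sqrt (e2 \<tau>)) \<longlongrightarrow> 0) (at t within {0..})"
    by simp
  have "((\<lambda>\<tau>. (H \<tau> - H t) / (\<tau> - t) - d) \<longlongrightarrow> 0) (at t within {0..})"
    by (rule Lim_null_comparison[OF _ lim]) (use bound in \<open>auto simp: eventually_at_filter\<close>)
  then have "((\<lambda>\<tau>. (H \<tau> - H t) / (\<tau> - t)) \<longlongrightarrow> d) (at t within {0..})"
    by (rule LIM_zero_cancel)
  then show "((\<lambda>\<tau>. Hnorm_sq \<alpha> (\<theta> \<tau>)) has_real_derivative
      2 * Re (\<Sum>\<^sub>\<infinity>k. norm (wavevec k) powr (2 * \<alpha>) * fourier_coeff \<theta>' k * cnj (fourier_coeff (\<theta> t) k))) (at t within {0..})"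
    unfolding has_field_derivative_iff H_def d_def w_def a_def b_def .
qed

section \<open>The equation in Fourier coefficients and the differential inequality\<close>

lemma holder_seminorm_le:
  assumes "holder_seminorm \<beta> \<phi> \<le> ereal K"
  shows "\<bar>\<phi> x - \<phi> y\<bar> \<le> K * norm (x - y) powr \<beta>"
proof (cases "x = y")
  case False
  then have "(x, y) \<in> {(x, y). x \<noteq> y}" by simp
  from SUP_upper[OF this, of "\<lambda>(x, y). ereal (\<bar>\<phi> x - \<phi> y\<bar> / norm (x - y) powr \<beta>)"]
  have "ereal (\<bar>\<phi> x - \<phi> y\<bar> / norm (x - y) powr \<beta>) \<le> holder_seminorm \<beta> \<phi>"
    unfolding holder_seminorm_def by simp
  also note assms
  finally have "\<bar>\<phi> x - \<phi> y\<bar> / norm (x - y) powr \<beta> \<le> K" by simp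
  then show ?thesis using False by (simp add: divide_le_eq)
qed simp

text \<open>The nonlinear term enters as an integrable product. Integrability gives meaning to its
  coefficients and allows an equation valid almost everywhere to be read frequency by
  frequency.\<close>

lemma sqg_fourier_coeff:
  assumes "f \<in> torus_L2" "\<theta>' \<in> torus_L2" "L \<in> torus_L2" "\<And>j. D j \<in> torus_L2" "\<And>j. R j \<in> torus_L2"
    and eq: "AE x in lborel. \<theta>' x + (- R 2 x * D 1 x + R 1 x * D 2 x) + L x = f x"
  shows "fourier_coeff \<theta>' k = fourier_coeff f k - fourier_coeff (\<lambda>x. - R 2 x * D 1 x + R 1 x * D 2 x) k - fourier_coeff L k"
proof -
  let ?c = "\<lambda>g :: real^2 \<Rightarrow> real. (\<lambda>x. complex_of_real (g x))"
  let ?g = "\<lambda>x. - R 2 x * D 1 x + R 1 x * D 2 x"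
  note L2s = assms(1-5)[THEN torus_L2_L2]
  have gI: "integrable TM (?c ?g)"
  proof -
    have "integrable TM (\<lambda>x. ?c (R 1) x * ?c (D 2) x - ?c (R 2) x * ?c (D 1) x)"
      by (intro Bochner_Integration.integrable_diff L2_mult_integrable L2s)
    then show ?thesis by (simp add: algebra_simps)
  qed
  have I: "integrable TM (\<lambda>x. ?c \<theta>' x * cnj (wave k x))" "integrable TM (\<lambda>x. ?c ?g x * cnj (wave k x))"
    "integrable TM (\<lambda>x. ?c L x * cnj (wave k x))" "integrable TM (\<lambda>x. ?c f x * cnj (wave k x))"
    by (intro integrable_mult_wave L2_integrable L2s gI)+
  have "(LINT x|TM. ?c f x * cnj (wave k x)) =
     (LINT x|TM. ?c \<theta>' x * cnj (wave k x) + ?c ?g x * cnj (wave k x) + ?c L x * cnj (wave k x))"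
  proof (rule integral_cong_AE)
    show "AE x in TM. ?c f x * cnj (wave k x) = ?c \<theta>' x * cnj (wave k x) + ?c ?g x * cnj (wave k x) + ?c L x * cnj (wave k x)"
      using AE_TM[OF eq]
    proof eventually_elim
      case (elim x)
      then have "?c f x = ?c \<theta>' x + ?c ?g x + ?c L x" by (simp only: of_real_add[symmetric])
      then show ?case by (simp only: distrib_right)
    qed
  qed (intro borel_measurable_integrable Bochner_Integration.integrable_add I)+
  also have "\<dots> = (LINT x|TM. ?c \<theta>' x * cnj (wave k x)) + (LINT x|TM. ?c ?g x * cnj (wave k x)) + (LINT x|TM. ?c L x * cnj (wave k x))"
    by (subst Bochner_Integration.integral_add, intro Bochner_Integration.integrable_add I, rule I,
        subst Bochner_Integration.integral_add, rule I, rule I, rule refl)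
  finally show ?thesis
    unfolding fourier_coeff_fc fc_def diff_divide_distrib[symmetric] by simp
qed

text \<open>The regularity index collects three demands: \<open>1\<close> for a square integrable
  gradient, \<gamma> for the dissipative term, and \<open>2 * \<alpha>\<close> for the test function
  \<open>\<Lambda>\<^sup>2\<^sup>\<alpha>\<theta>\<close>. The constant is fixed before
  \<open>K\<close>, the force and the solution.\<close>

theorem theoremB1:
  fixes \<gamma> \<alpha> \<beta> :: real
  assumes "0 < \<gamma>" and "\<gamma> < 2"
    and "0 < \<alpha>" and "\<alpha> < 1"
    and "max (1 - \<gamma>) 0 < \<beta>" and "\<beta> < 1"
  shows "\<exists>c>0. \<forall>(K::real) (f :: real^2 \<Rightarrow> real) (\<theta>\<^sub>0 :: real^2 \<Rightarrow> real) (\<theta> :: real \<Rightarrow> real^2 \<Rightarrow> real).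
           f \<in> sobolev \<alpha> \<longrightarrow>
           (LINT x:torus|lborel. \<theta>\<^sub>0 x) = 0 \<longrightarrow>
           sqg_solution \<gamma> (max 1 (max \<gamma> (2 * \<alpha>))) f \<theta>\<^sub>0 \<theta> \<longrightarrow>
           (\<forall>t\<ge>0. holder_seminorm \<beta> (\<theta> t) \<le> ereal K) \<longrightarrow>
           (\<forall>t\<ge>0. \<exists>d. ((\<lambda>\<tau>. Hnorm_sq \<alpha> (\<theta> \<tau>)) has_real_derivative d) (at t within {0..}) \<and>
              d + 1 / 4 * Hnorm_sq (\<alpha> + \<gamma> / 2) (\<theta> t)
                \<le> c * K powr (4 * \<gamma> / (\<gamma> + \<beta> - 1)) + c * Hnorm_sq \<alpha> f)"
proof -
  define s where "s = max 1 (max \<gamma> (2 * \<alpha>))"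
  have s: "2 * \<alpha> \<le> s" "2 * \<alpha> + \<gamma> \<le> 2 * s" "0 \<le> s" by (auto simp: s_def)
  have \<beta>: "1 - \<gamma> < \<beta>" "0 < \<beta>" using assms(5) by auto
  obtain C where C: "C > 0"
    "\<And>K \<phi> D R. \<phi> \<in> sobolev s \<Longrightarrow> (\<And>x y. \<bar>\<phi> x - \<phi> y\<bar> \<le> K * norm (x - y) powr \<beta>) \<Longrightarrow>
      (\<And>j. multiplier_image (partial_symbol j) \<phi> (D j)) \<Longrightarrow> (\<And>j. multiplier_image (riesz_symbol j) \<phi> (R j)) \<Longrightarrow>
      cmod (\<Sum>\<^sub>\<infinity>k. norm (wavevec k) powr (2 * \<alpha>) * fourier_coeff \<phi> k *
        cnj (fourier_coeff (\<lambda>x. - R 2 x * D 1 x + R 1 x * D 2 x) k)) \<le>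
      1 / 2 * Hnorm_sq (\<alpha> + \<gamma> / 2) \<phi> + C * K powr (4 * \<gamma> / (\<gamma> + \<beta> - 1)) \<and>
      (\<lambda>k. norm (wavevec k) powr (2 * \<alpha>) * fourier_coeff \<phi> k *
        cnj (fourier_coeff (\<lambda>x. - R 2 x * D 1 x + R 1 x * D 2 x) k)) summable_on UNIV"
    using nonlinear_term_bound[OF assms(1,3,4) \<beta> assms(6) s(1,2)] by blast
  show ?thesis
    unfolding s_def[symmetric]
  \<comment> \<open>\<open>4\<close> is the weight of the force in Young's inequality and
    \<open>2 * C\<close> comes from twice the trilinear form; one sum covers both.\<close>
  proof (rule exI[of _ "4 + 2 * C"], intro conjI allI impI)
    show "4 + 2 * C > 0" using C(1) by simp
    fix K :: real and f \<theta>\<^sub>0 :: "real^2 \<Rightarrow> real" and \<theta> :: "real \<Rightarrow> real^2 \<Rightarrow> real" and t :: real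
    assume f: "f \<in> sobolev \<alpha>" and sol: "sqg_solution \<gamma> s f \<theta>\<^sub>0 \<theta>"
      and hold: "\<forall>t\<ge>0. holder_seminorm \<beta> (\<theta> t) \<le> ereal K" and t: "0 \<le> t"
    have sob: "\<theta> \<tau> \<in> sobolev s" if "0 \<le> \<tau>" for \<tau> using sol that by (simp add: sqg_solution_def)
    have cont: "((\<lambda>\<tau>. Hnorm_sq s (\<lambda>x. \<theta> \<tau> x - \<theta> t x)) \<longlongrightarrow> 0) (at t within {0..})"
      using sol t by (simp add: sqg_solution_def)
    obtain \<theta>' D R L where der: "has_time_derivative \<theta> \<theta>' t"
      and D: "\<And>j. multiplier_image (partial_symbol j) (\<theta> t) (D j)"
      and R: "\<And>j. multiplier_image (riesz_symbol j) (\<theta> t) (R j)"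
      and L: "multiplier_image (Lambda_symbol \<gamma>) (\<theta> t) L"
      and eq: "AE x in lborel. \<theta>' x + (- R 2 x * D 1 x + R 1 x * D 2 x) + L x = f x"
      using sol t unfolding sqg_solution_def by blast
    define w where "w = (\<lambda>k. norm (wavevec k) powr (2 * \<alpha>))"
    define a where "a = fourier_coeff (\<theta> t)"
    define g where "g = fourier_coeff (\<lambda>x. - R 2 x * D 1 x + R 1 x * D 2 x)"
    define p where "p = 4 * \<gamma> / (\<gamma> + \<beta> - 1)"
    define H where "H = Hnorm_sq (\<alpha> + \<gamma> / 2) (\<theta> t)"
    define T where "T = (\<Sum>\<^sub>\<infinity>k. w k * a k * cnj (g k))"
    have T: "cmod T \<le> 1 / 2 * H + C * K powr p" "(\<lambda>k. w k * a k * cnj (g k)) summable_on UNIV"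
      using C(2)[OF sob[OF t] holder_seminorm_le[OF hold[rule_format, OF t]] D R]
      unfolding T_def w_def a_def g_def p_def H_def by auto
    have b: "fourier_coeff \<theta>' k = fourier_coeff f k - g k - norm (wavevec k) powr \<gamma> * a k" for k
    proof -
      have "f \<in> torus_L2" using f by (simp add: sobolev_def)
      moreover have "\<theta>' \<in> torus_L2" using der by (simp add: has_time_derivative_def)
      moreover have "L \<in> torus_L2" "D j \<in> torus_L2" "R j \<in> torus_L2" for j
        using L D R by (auto simp: multiplier_image_def)
      moreover have "fourier_coeff L k = norm (wavevec k) powr \<gamma> * a k"
        using L by (simp add: multiplier_image_def Lambda_symbol_def a_def)
      ultimately show ?thesis using sqg_fourier_coeff[OF _ _ _ _ _ eq, of k] by (simp add: g_def)
    qed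
    define d where "d = 2 * Re (\<Sum>\<^sub>\<infinity>k. w k * fourier_coeff \<theta>' k * cnj (a k))"
    have deriv: "((\<lambda>\<tau>. Hnorm_sq \<alpha> (\<theta> \<tau>)) has_real_derivative d) (at t within {0..})"
      and ds: "(\<lambda>k. w k * fourier_coeff \<theta>' k * cnj (a k)) summable_on UNIV"
      using Hnorm_sq_time_derivative[OF s(1,3) t sob cont der] by (simp_all add: d_def w_def a_def)
    have d: "((\<lambda>k. 2 * Re (w k * fourier_coeff \<theta>' k * cnj (a k))) has_sum d) UNIV"
      unfolding d_def by (intro has_sum_cmult_right has_sum_Re has_sum_infsum ds)
    have hT: "((\<lambda>k. 2 * Re (w k * a k * cnj (g k))) has_sum (2 * Re T)) UNIV"
      unfolding T_def by (intro has_sum_cmult_right has_sum_Re has_sum_infsum T(2))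
    have hH: "((\<lambda>k. norm (wavevec k) powr (2 * \<alpha> + \<gamma>) * (cmod (a k))\<^sup>2) has_sum H) UNIV"
      unfolding H_def a_def Hnorm_sq_UNIV
      using has_sum_infsum[OF sobolev_summable[OF sob[OF t] s(2)]] by (simp add: distrib_left)
    have hf: "((\<lambda>k. w k * (cmod (fourier_coeff f k))\<^sup>2) has_sum Hnorm_sq \<alpha> f) UNIV"
      unfolding Hnorm_sq_UNIV w_def by (intro has_sum_infsum sobolev_summable[OF f]) simp
    \<comment> \<open>After insertion of the equation for \<open>\<theta>'\<close>, the two added
      sums cancel transport and dissipation, leaving only the pairing with the force.\<close>
    have "((\<lambda>k. 2 * Re (w k * fourier_coeff \<theta>' k * cnj (a k)) + 2 * Re (w k * a k * cnj (g k)) +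
        2 * (norm (wavevec k) powr (2 * \<alpha> + \<gamma>) * (cmod (a k))\<^sup>2)) has_sum (d + 2 * Re T + 2 * H)) UNIV"
      by (intro has_sum_add has_sum_cmult_right d hT hH)
    moreover have "((\<lambda>k. 4 * (w k * (cmod (fourier_coeff f k))\<^sup>2) + 1 / 4 * (norm (wavevec k) powr (2 * \<alpha> + \<gamma>) * (cmod (a k))\<^sup>2))
        has_sum (4 * Hnorm_sq \<alpha> f + 1 / 4 * H)) UNIV"
      by (intro has_sum_add has_sum_cmult_right hf hH)
    moreover have "2 * Re (w k * fourier_coeff \<theta>' k * cnj (a k)) + 2 * Re (w k * a k * cnj (g k)) +
        2 * (norm (wavevec k) powr (2 * \<alpha> + \<gamma>) * (cmod (a k))\<^sup>2) \<le>
        4 * (w k * (cmod (fourier_coeff f k))\<^sup>2) + 1 / 4 * (norm (wavevec k) powr (2 * \<alpha> + \<gamma>) * (cmod (a k))\<^sup>2)" for k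
    proof -
      define F where "F = fourier_coeff f k"
      have wg: "norm (wavevec k) powr (2 * \<alpha> + \<gamma>) = w k * norm (wavevec k) powr \<gamma>" by (simp add: w_def powr_add)
      have "Re (w k * fourier_coeff \<theta>' k * cnj (a k)) =
         w k * Re (F * cnj (a k)) - w k * Re (a k * cnj (g k)) - w k * norm (wavevec k) powr \<gamma> * (cmod (a k))\<^sup>2"
        unfolding b F_def[symmetric] cmod_power2 by (simp add: power2_eq_square algebra_simps)
      moreover have "Re (w k * a k * cnj (g k)) = w k * Re (a k * cnj (g k))" by (simp add: algebra_simps)
      moreover have "2 * (w k * Re (F * cnj (a k))) \<le> w k * (4 * (cmod F)\<^sup>2 + 1 / 4 * (cmod (a k))\<^sup>2)"
      proof -
        have "2 * Re (F * cnj (a k)) \<le> 2 * (cmod F * cmod (a k))"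
          using complex_Re_le_cmod[of "F * cnj (a k)"] by (simp add: norm_mult)
        \<comment> \<open>Weighted so that the coefficient of \<theta> costs only a quarter of the
          dissipation.\<close>
        also have "\<dots> \<le> 4 * (cmod F)\<^sup>2 + 1 / 4 * (cmod (a k))\<^sup>2"
          using sum_squares_bound[of "2 * cmod F" "1 / 2 * cmod (a k)"] by (simp add: power_mult_distrib power_divide)
        finally have "w k * (2 * Re (F * cnj (a k))) \<le> w k * (4 * (cmod F)\<^sup>2 + 1 / 4 * (cmod (a k))\<^sup>2)"
          by (rule mult_left_mono) (simp add: w_def)
        then show ?thesis by (simp only: mult.left_commute)
      qed
      \<comment> \<open>The spectral gap again: the \<open>H\<^sup>\<alpha>\<close> part left by
        Young's inequality is dominated by the dissipation.\<close>
      moreover have "w k * (cmod (a k))\<^sup>2 \<le> norm (wavevec k) powr (2 * \<alpha> + \<gamma>) * (cmod (a k))\<^sup>2"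
        unfolding w_def using assms(1) by (intro mult_right_mono weight_mono) auto
      ultimately show ?thesis unfolding wg F_def[symmetric] by (simp add: algebra_simps)
    qed
    ultimately have "d + 2 * Re T + 2 * H \<le> 4 * Hnorm_sq \<alpha> f + 1 / 4 * H"
      by (rule has_sum_mono)
    moreover have "- cmod T \<le> Re T" using abs_Re_le_cmod[of T] by linarith
    moreover have "0 \<le> H" "0 \<le> Hnorm_sq \<alpha> f" unfolding H_def Hnorm_sq_def by (intro infsum_nonneg; simp)+
    moreover have "(4 + 2 * C) * K powr p = 4 * K powr p + 2 * (C * K powr p)"
      "(4 + 2 * C) * Hnorm_sq \<alpha> f = 4 * Hnorm_sq \<alpha> f + 2 * (C * Hnorm_sq \<alpha> f)" by (simp_all add: algebra_simps)
    moreover have "0 \<le> K powr p" "0 \<le> C * Hnorm_sq \<alpha> f" using C(1) \<open>0 \<le> Hnorm_sq \<alpha> f\<close> by auto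
    \<comment> \<open>Of the dissipation \<open>2 * H\<close>, the trilinear form uses
      \<open>H\<close> and the force \<open>H / 4\<close>; the remaining \<open>3 / 4 * H\<close>
      exceeds what is claimed.\<close>
    ultimately have "d + 1 / 4 * H \<le> (4 + 2 * C) * K powr p + (4 + 2 * C) * Hnorm_sq \<alpha> f"
      using T(1) by linarith
    with deriv show "\<exists>d. ((\<lambda>\<tau>. Hnorm_sq \<alpha> (\<theta> \<tau>)) has_real_derivative d) (at t within {0..}) \<and>
        d + 1 / 4 * Hnorm_sq (\<alpha> + \<gamma> / 2) (\<theta> t) \<le> (4 + 2 * C) * K powr (4 * \<gamma> / (\<gamma> + \<beta> - 1)) + (4 + 2 * C) * Hnorm_sq \<alpha> f"
      unfolding H_def p_def by blast
  qed
qed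

end
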